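(* Let $d,n\ge 1$, let $\omega\in\mathbb{R}^d$ be Diophantine, i.e. $\omega\in\mathcal{DC}(\kappa,\tau)$ for some $\kappa>0$ and $\tau>d-1$, and let $A:\mathbb{T}^d\to gl(n,\mathbb{R})$ be $\mathcal{C}^\infty$ (so the cocycle $X_{\omega,A}$ is real). If $X_{\omega,A}$ is almost reducible, then $X_{\frac{\omega}{2},A_2}$ is real almost reducible, where $A_2(\theta)=A(2\theta)$ for all $\theta\in\mathbb{T}^d$. Explicitly: there exist $\mathcal{C}^\infty$ maps $Z_j:\mathbb{T}^d\to Gl(n,\mathbb{R})$, $F_j:\mathbb{T}^d\to gl(n,\mathbb{R})$ and matrices $B_j\in gl(n,\mathbb{R})$ such that $\partial_{\frac{\omega}{2}}Z_j(\theta)=A(2\theta)Z_j(\theta)-Z_j(\theta)(B_j+F_j(\theta))$ for all $\theta$, and $\lim_{j\to\infty}\|Z_j^{\pm1}\|_{\mathcal{C}^r}^m\|F_j\|_{\mathcal{C}^r}=0$ for all $r,m\in\mathbb{N}$.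
   Context: $\mathbb{T}^d=\mathbb{R}^d/\mathbb{Z}^d$. For $k\in\mathbb{Z}^d$, $|k|=\sum_i|k_i|$. $\omega\in\mathcal{DC}(\kappa,\tau)$ means $|\langle k,\omega\rangle|\ge \kappa|k|^{-\tau}$ for all $k\in\mathbb{Z}^d\setminus\{0\}$. For a map $Z$ on $\mathbb{T}^d$ and $v\in\mathbb{R}^d$, $\partial_v Z(\theta)=\frac{d}{dt}Z(\theta+tv)|_{t=0}$. Matrix norm: operator norm $\|\cdot\|$; $\|A\|_{\mathcal{C}^0}=\sup_\theta\|A(\theta)\|$, $\|A\|_{\mathcal{C}^r}=\max\{\|\partial^\alpha A\|_{\mathcal{C}^0}:|\alpha|\le r\}$. The cocycle $X_{\omega,A}:\mathbb{R}\times\mathbb{T}^d\to Gl(n,\mathbb{C})$ is the solution of $\frac{d}{dt}X^t(\theta)=A(\theta+t\omega)X^t(\theta)$, $X^0=I$. $X_{\omega,A}$ is almost reducible if there exist $\mathcal{C}^\infty$ maps $Z_j:\mathbb{T}^d\to Gl(n,\mathbb{C})$, $F_j:\mathbb{T}^d\to gl(n,\mathbb{C})$ and constant matrices $B_j\in gl(n,\mathbb{C})$ with $\partial_\omega Z_j=AZ_j-Z_j(B_j+F_j)$ on $\mathbb{T}^d$ and $\lim_j\|Z_j^{\pm1}\|_{\mathcal{C}^r}^m\|F_j\|_{\mathcal{C}^r}=0$ for all $r,m\in\mathbb{N}$ (meaning both for $Z_j$ and $Z_j^{-1}$). It is real almost reducible if $A$ is real and this holds with $Z_j$ real-valued and $B_j$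 real. *)

theory Defs
  imports "HOL-Analysis.Analysis"
begin

text \<open>Maps on the torus T^d = R^d / Z^d are represented as Z^d-periodic maps on real^'d,
  where the finite type 'd indexes the coordinates (d = CARD('d)).\<close>

definition periodic_map :: "(real^'d \<Rightarrow> 'a) \<Rightarrow> bool" where
  "periodic_map f \<longleftrightarrow> (\<forall>\<theta> i. f (\<theta> + axis i 1) = f \<theta>)"

definition dir_deriv :: "real^'d \<Rightarrow> (real^'d \<Rightarrow> 'a::real_normed_vector) \<Rightarrow> real^'d \<Rightarrow> 'a" where
  "dir_deriv v f \<theta> = vector_derivative (\<lambda>t. f (\<theta> + t *\<^sub>R v)) (at 0)"

text \<open>Iterated partial derivative along the coordinate directions listed (a multi-index
  of order = length of the list).\<close>
fun dpart :: "'d list \<Rightarrow> (real^'d \<Rightarrow> 'a::real_normed_vector) \<Rightarrow> real^'d \<Rightarrow> 'a" where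
  "dpart [] f = f"
| "dpart (i # is) f = dir_deriv (axis i 1) (dpart is f)"

definition smooth :: "(real^'d \<Rightarrow> 'a::real_normed_vector) \<Rightarrow> bool" where
  "smooth f \<longleftrightarrow> (\<forall>is. (dpart is f) differentiable_on UNIV)"

definition mat_norm :: "'a::real_normed_field^'n^'m \<Rightarrow> real" where
  "mat_norm M = onorm (\<lambda>x. M *v x)"

definition Cr_norm :: "nat \<Rightarrow> (real^'d \<Rightarrow> 'a::real_normed_field^'n^'m) \<Rightarrow> real" where
  "Cr_norm r f = Sup {mat_norm (dpart is f \<theta>) | is \<theta>. length is \<le> r}"

definition diophantine :: "real \<Rightarrow> real \<Rightarrow> real^'d \<Rightarrow> bool" where
  "diophantine \<kappa> \<tau> \<omega> \<longleftrightarrow>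
     (\<forall>k::int^'d. k \<noteq> 0 \<longrightarrow>
        \<bar>\<Sum>i\<in>UNIV. of_int (k $ i) * \<omega> $ i\<bar> \<ge> \<kappa> * (real_of_int (\<Sum>i\<in>UNIV. \<bar>k $ i\<bar>)) powr (- \<tau>))"

definition almost_reducible :: "real^'d \<Rightarrow> (real^'d \<Rightarrow> complex^'n^'n) \<Rightarrow> bool" where
  "almost_reducible \<omega> A \<longleftrightarrow>
    (\<exists>(Z :: nat \<Rightarrow> real^'d \<Rightarrow> complex^'n^'n) (F :: nat \<Rightarrow> real^'d \<Rightarrow> complex^'n^'n)
       (B :: nat \<Rightarrow> complex^'n^'n).
      (\<forall>j. periodic_map (Z j) \<and> smooth (Z j) \<and> (\<forall>\<theta>. invertible (Z j \<theta>)) \<and>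
           periodic_map (F j) \<and> smooth (F j) \<and>
           (\<forall>\<theta>. dir_deriv \<omega> (Z j) \<theta> = A \<theta> ** Z j \<theta> - Z j \<theta> ** (B j + F j \<theta>))) \<and>
      (\<forall>r m. (\<lambda>j. Cr_norm r (Z j) ^ m * Cr_norm r (F j)) \<longlonglongrightarrow> 0 \<and>
             (\<lambda>j. Cr_norm r (\<lambda>\<theta>. matrix_inv (Z j \<theta>)) ^ m * Cr_norm r (F j)) \<longlonglongrightarrow> 0))"

definition real_almost_reducible :: "real^'d \<Rightarrow> (real^'d \<Rightarrow> real^'n^'n) \<Rightarrow> bool" where
  "real_almost_reducible \<omega> A \<longleftrightarrow>
    (\<exists>(Z :: nat \<Rightarrow> real^'d \<Rightarrow> real^'n^'n) (F :: nat \<Rightarrow> real^'d \<Rightarrow> real^'n^'n)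
       (B :: nat \<Rightarrow> real^'n^'n).
      (\<forall>j. periodic_map (Z j) \<and> smooth (Z j) \<and> (\<forall>\<theta>. invertible (Z j \<theta>)) \<and>
           periodic_map (F j) \<and> smooth (F j) \<and>
           (\<forall>\<theta>. dir_deriv \<omega> (Z j) \<theta> = A \<theta> ** Z j \<theta> - Z j \<theta> ** (B j + F j \<theta>))) \<and>
      (\<forall>r m. (\<lambda>j. Cr_norm r (Z j) ^ m * Cr_norm r (F j)) \<longlonglongrightarrow> 0 \<and>
             (\<lambda>j. Cr_norm r (\<lambda>\<theta>. matrix_inv (Z j \<theta>)) ^ m * Cr_norm r (F j)) \<longlonglongrightarrow> 0))"

definition cmat :: "real^'n^'m \<Rightarrow> complex^'n^'m" where
  "cmat M = (\<chi> i j. complex_of_real (M $ i $ j))"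

end

theory Submission
  imports Defs "HOL-Computational_Algebra.Fundamental_Theorem_Algebra"
begin

text \<open>If \<open>Z\<close> conjugates the real system to \<open>B + F\<close> with \<open>F\<close> tiny, then \<open>W = cnj Z\<^sup>-\<^sup>1 Z\<close> intertwines
  \<open>B\<close> with its conjugate up to a tiny error. Triangularize \<open>B\<close>, decoupling eigenvalues whose imaginary
  parts \<open>\<beta>\<^sub>i\<close> are not close; everything stays polynomially bounded in the size \<open>M\<close> of \<open>Z\<close>. The Fourier
  coefficient of \<open>W\<^sub>i\<^sub>j\<close> at \<open>k\<close> is then negligible unless \<open>\<beta>\<^sub>i + \<beta>\<^sub>j + 2 \<pi> \<langle>k, \<omega>\<rangle>\<close> is nearly \<open>0\<close>, and by the
  Diophantine condition there is at most one such \<open>k\<close> of moderate size. These resonances are removed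
  by a diagonal map with entries of frequency \<open>\<kappa>\<^sub>i / 2\<close>, which is why the period doubles. Afterwards \<open>W\<close> is
  nearly a constant \<open>C\<close> with \<open>cnj C C\<close> nearly the identity, that is, a real structure commuting with the
  constant part of the system. In a basis \<open>P\<close> of the real subspace it defines, the constant part becomes real up to
  a tiny error, and the real part of the conjugation is the new \<open>Z\<close>. Since \<open>F\<close> is smaller than every
  power of \<open>M\<close>, all polynomial losses are harmless, and a diagonal choice along the given sequence
  handles all \<open>r\<close> and \<open>m\<close> at once.\<close>

section \<open>Iterated partial derivatives\<close>

text \<open>Nothing in the hypotheses controls the eigenvalues of \<open>B\<close>, which may nearly
  collide, so eigenvector bases can be arbitrarily badly conditioned, while every change of basis
  must be bounded by a power of M. The equation for W holds because A is real: Z and its conjugate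
  solve equations with the same A, which cancels. Resonances are conditions on pairs (i, j), whereas
  a diagonal map has one frequency per index. Such frequencies exist because a closed loop of
  resonances adds up to a moderate frequency with a tiny divisor, which must be 0. The cutoff for
  frequencies is M, and the tolerance \<eta> is a power M^(-t) just below the divisors at that
  cutoff. Modes beyond the cutoff are handled by differentiability of an order r far above the order
  R wanted in the result, so that a high negative power of M beats every loss. The constant C
  inherits cnj W W = 1 only approximately, and this has to be repaired before a real basis exists.
  Invertibility of the real part is not automatic: it follows because the map and its conjugate
  agree up to a small relative error.\<close>

definition bounded_Cr :: "nat \<Rightarrow> real \<Rightarrow> (real^'d \<Rightarrow> 'a::real_normed_vector) \<Rightarrow> bool" where
  "bounded_Cr r K f \<longleftrightarrow> (\<forall>is \<theta>. length is \<le> r \<longrightarrow> norm (dpart is f \<theta>) \<le> K)"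

text \<open>A finite order makes induction possible: the derivative of a product or of an inverse
  involves the map itself, which is then already known to lower order.\<close>

definition smooth_upto :: "nat \<Rightarrow> (real^'d \<Rightarrow> 'a::real_normed_vector) \<Rightarrow> bool" where
  "smooth_upto n f \<longleftrightarrow> (\<forall>is. length is \<le> n \<longrightarrow> dpart is f differentiable_on UNIV)"

lemma smooth_iff_upto: "smooth f \<longleftrightarrow> (\<forall>n. smooth_upto n f)"
  unfolding smooth_def smooth_upto_def by blast

lemma smooth_dpart_differentiable: "smooth f \<Longrightarrow> dpart is f differentiable (at \<theta>)"
  unfolding smooth_def by (auto simp: differentiable_on_def)

lemma smooth_differentiable: "smooth f \<Longrightarrow> f differentiable (at \<theta>)"
  using smooth_dpart_differentiable[of f "[]"] by simp

lemma smooth_continuous_on: "smooth f \<Longrightarrow> continuous_on S f"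
  by (meson continuous_at_imp_continuous_on differentiable_imp_continuous_within smooth_differentiable)

lemma has_vector_derivative_along:
  assumes "(f has_derivative D) (at (\<theta> + s *\<^sub>R v))"
  shows "((\<lambda>t. f (\<theta> + t *\<^sub>R v)) has_vector_derivative D v) (at s)"
proof -
  interpret D: bounded_linear D using assms by (rule has_derivative_bounded_linear)
  have "((\<lambda>t. \<theta> + t *\<^sub>R v) has_derivative (\<lambda>t. t *\<^sub>R v)) (at s)"
    by (auto intro!: derivative_eq_intros)
  from has_derivative_compose[OF this assms]
  have "((\<lambda>t. f (\<theta> + t *\<^sub>R v)) has_derivative (\<lambda>t. D (t *\<^sub>R v))) (at s)" .
  then show ?thesis by (simp add: has_vector_derivative_def D.scaleR)
qed

lemma dir_deriv_eq:
  assumes "(f has_derivative D) (at \<theta>)"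
  shows "dir_deriv v f \<theta> = D v"
  unfolding dir_deriv_def
  using has_vector_derivative_along[of f D \<theta> 0 v] assms by (auto intro: vector_derivative_at)

lemma dir_deriv_along:
  assumes "f differentiable (at (\<theta> + s *\<^sub>R v))"
  shows "((\<lambda>t. f (\<theta> + t *\<^sub>R v)) has_vector_derivative dir_deriv v f (\<theta> + s *\<^sub>R v)) (at s)"
  using assms has_vector_derivative_along dir_deriv_eq frechet_derivative_works by metis

lemma dir_deriv_axis_sum:
  assumes "f differentiable (at \<theta>)"
  shows "dir_deriv v f \<theta> = (\<Sum>i\<in>UNIV. (v $ i) *\<^sub>R dir_deriv (axis i 1) f \<theta>)"
proof -
  obtain D where D: "(f has_derivative D) (at \<theta>)" using assms by (auto simp: differentiable_def)
  interpret D: bounded_linear D using D by (rule has_derivative_bounded_linear)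
  have "D v = D (\<Sum>i\<in>UNIV. (v $ i) *\<^sub>R axis i 1)"
    by (intro arg_cong[of _ _ D]) (simp add: vec_eq_iff axis_def if_distrib[of "\<lambda>x. _ * x"] cong: if_cong)
  then show ?thesis by (simp add: dir_deriv_eq[OF D] D.sum D.scaleR)
qed

lemma dpart_append: "dpart (is @ js) f = dpart is (dpart js f)"
  by (induction "is") auto

text \<open>The last list entry is the innermost derivative. Peeling it off turns order
  \<open>Suc n\<close> of a map into order n of its first derivatives, the form in which the product
  rule fits an induction.\<close>

lemma all_lists_Suc_iff:
  "(\<forall>is. length is \<le> Suc n \<longrightarrow> P is) \<longleftrightarrow> P [] \<and> (\<forall>i is. length is \<le> n \<longrightarrow> P (is @ [i]))"
  by (metis append_butlast_last_id length_append_singleton list.size(3) not_less_eq_eq zero_le)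

lemma smooth_upto_Suc:
  "smooth_upto (Suc n) f \<longleftrightarrow>
     f differentiable_on UNIV \<and> (\<forall>i. smooth_upto n (dir_deriv (axis i 1) f))"
  unfolding smooth_upto_def all_lists_Suc_iff by (auto simp: dpart_append)

lemma bounded_Cr_Suc:
  "bounded_Cr (Suc n) K f \<longleftrightarrow>
     (\<forall>\<theta>. norm (f \<theta>) \<le> K) \<and> (\<forall>i. bounded_Cr n K (dir_deriv (axis i 1) f))"
proof -
  have "bounded_Cr (Suc n) K f \<longleftrightarrow> (\<forall>is. length is \<le> Suc n \<longrightarrow> (\<forall>\<theta>. norm (dpart is f \<theta>) \<le> K))"
    unfolding bounded_Cr_def by auto
  then show ?thesis unfolding all_lists_Suc_iff by (auto simp: dpart_append bounded_Cr_def)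
qed

lemma bounded_Cr_0: "bounded_Cr 0 K f \<longleftrightarrow> (\<forall>\<theta>. norm (f \<theta>) \<le> K)"
  unfolding bounded_Cr_def by auto

lemma bounded_Cr_norm: "bounded_Cr r K f \<Longrightarrow> norm (f \<theta>) \<le> K"
  unfolding bounded_Cr_def by (metis dpart.simps(1) le0 list.size(3))

lemma bounded_Cr_mono: "bounded_Cr r K f \<Longrightarrow> r' \<le> r \<Longrightarrow> K \<le> K' \<Longrightarrow> bounded_Cr r' K' f"
  unfolding bounded_Cr_def by (meson order_trans)

lemma bounded_Cr_nonneg: "bounded_Cr r K f \<Longrightarrow> 0 \<le> K"
  using bounded_Cr_norm norm_ge_zero order_trans by blast

lemma smooth_dir_deriv_axis: "smooth f \<Longrightarrow> smooth (dir_deriv (axis i 1) f)"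
  using smooth_upto_Suc unfolding smooth_iff_upto by blast

lemma smooth_dpart: "smooth f \<Longrightarrow> smooth (dpart is f)"
  unfolding smooth_def by (metis dpart_append)

lemma dir_deriv_const [simp]: "dir_deriv v (\<lambda>_. c) = (\<lambda>_. 0)"
  by (rule ext) (rule dir_deriv_eq, rule has_derivative_const)

lemma dpart_const: "dpart is (\<lambda>_. c) = (\<lambda>_. if is = [] then c else 0)"
  by (induction "is") auto

lemma smooth_const [intro, simp]: "smooth (\<lambda>_. c)"
  unfolding smooth_def by (auto simp: dpart_const)

lemma bounded_Cr_const: "norm c \<le> K \<Longrightarrow> bounded_Cr r K (\<lambda>_. c)"
  unfolding bounded_Cr_def dpart_const using order_trans[OF norm_ge_zero] by auto

subsection \<open>Linear images\<close>

lemma dir_deriv_linear: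
  assumes "bounded_linear h" "\<And>\<theta>. f differentiable (at \<theta>)"
  shows "dir_deriv v (\<lambda>\<theta>. h (f \<theta>)) = (\<lambda>\<theta>. h (dir_deriv v f \<theta>))"
proof
  fix \<theta>
  obtain D where D: "(f has_derivative D) (at \<theta>)" using assms(2) by (auto simp: differentiable_def)
  from bounded_linear.has_derivative[OF assms(1) this]
  show "dir_deriv v (\<lambda>\<theta>. h (f \<theta>)) \<theta> = h (dir_deriv v f \<theta>)"
    by (simp add: dir_deriv_eq[OF D] dir_deriv_eq)
qed

lemma dpart_linear:
  assumes "bounded_linear h" "smooth f"
  shows "dpart is (\<lambda>\<theta>. h (f \<theta>)) = (\<lambda>\<theta>. h (dpart is f \<theta>))"
  by (induction "is") (auto simp: dir_deriv_linear[OF assms(1) smooth_dpart_differentiable[OF assms(2)]])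

lemma differentiable_bounded_linear:
  assumes "bounded_linear h" "f differentiable F"
  shows "(\<lambda>\<theta>. h (f \<theta>)) differentiable F"
  using assms bounded_linear.has_derivative unfolding differentiable_def by blast

lemma smooth_linear:
  assumes "bounded_linear h" "smooth f"
  shows "smooth (\<lambda>\<theta>. h (f \<theta>))"
  unfolding smooth_def dpart_linear[OF assms]
  using differentiable_bounded_linear[OF assms(1)] assms(2)
  unfolding smooth_def differentiable_on_def by blast

lemma bounded_Cr_linear:
  assumes "bounded_linear h" "smooth f" "bounded_Cr r K f" "\<And>x. norm (h x) \<le> c * norm x" "0 \<le> c"
  shows "bounded_Cr r (c * K) (\<lambda>\<theta>. h (f \<theta>))"
  unfolding bounded_Cr_def dpart_linear[OF assms(1,2)]
  using assms(3,4,5) unfolding bounded_Cr_def by (meson mult_left_mono order_trans)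

lemma dir_deriv_add:
  assumes "f differentiable (at \<theta>)" "g differentiable (at \<theta>)"
  shows "dir_deriv v (\<lambda>\<theta>. f \<theta> + g \<theta>) \<theta> = dir_deriv v f \<theta> + dir_deriv v g \<theta>"
proof -
  obtain D E where D: "(f has_derivative D) (at \<theta>)" "(g has_derivative E) (at \<theta>)"
    using assms by (auto simp: differentiable_def)
  show ?thesis
    using dir_deriv_eq[OF has_derivative_add[OF D], of v] by (simp add: dir_deriv_eq[OF D(1)] dir_deriv_eq[OF D(2)])
qed

lemma dpart_add_upto:
  assumes "smooth_upto n f" "smooth_upto n g" "length is \<le> Suc n"
  shows "dpart is (\<lambda>\<theta>. f \<theta> + g \<theta>) = (\<lambda>\<theta>. dpart is f \<theta> + dpart is g \<theta>)"
  using assms(3)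
proof (induction "is")
  case (Cons i "is")
  then have "dpart is f differentiable (at \<theta>)" "dpart is g differentiable (at \<theta>)" for \<theta>
    using assms(1,2) by (auto simp: smooth_upto_def differentiable_on_def)
  with Cons show ?case by (auto simp: dir_deriv_add)
qed auto

lemma smooth_upto_add:
  assumes "smooth_upto n f" "smooth_upto n g"
  shows "smooth_upto n (\<lambda>\<theta>. f \<theta> + g \<theta>)"
  unfolding smooth_upto_def
proof (intro allI impI)
  fix "is" :: "'a list" assume "length is \<le> n"
  then show "dpart is (\<lambda>\<theta>. f \<theta> + g \<theta>) differentiable_on UNIV"
    using assms unfolding dpart_add_upto[OF assms le_SucI[OF \<open>length is \<le> n\<close>]]
    by (auto simp: smooth_upto_def differentiable_on_def)
qed

lemma smooth_add: "smooth f \<Longrightarrow> smooth g \<Longrightarrow> smooth (\<lambda>\<theta>. f \<theta> + g \<theta>)"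
  by (simp add: smooth_iff_upto smooth_upto_add)

lemma dpart_add:
  assumes "smooth f" "smooth g"
  shows "dpart is (\<lambda>\<theta>. f \<theta> + g \<theta>) = (\<lambda>\<theta>. dpart is f \<theta> + dpart is g \<theta>)"
  using dpart_add_upto[of "length is" f g "is"] assms by (simp add: smooth_iff_upto)

lemma bounded_Cr_add:
  assumes "smooth f" "smooth g" "bounded_Cr r K f" "bounded_Cr r L g"
  shows "bounded_Cr r (K + L) (\<lambda>\<theta>. f \<theta> + g \<theta>)"
  using assms(3,4) unfolding bounded_Cr_def dpart_add[OF assms(1,2)]
  by (meson add_mono norm_triangle_le)

lemma smooth_minus: "smooth f \<Longrightarrow> smooth (\<lambda>\<theta>. - f \<theta>)"
  using smooth_linear[OF bounded_linear_minus[OF bounded_linear_ident]] .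

lemma bounded_Cr_minus:
  assumes "smooth f" "bounded_Cr r K f"
  shows "bounded_Cr r K (\<lambda>\<theta>. - f \<theta>)"
  using bounded_Cr_linear[OF bounded_linear_minus[OF bounded_linear_ident] assms, of 1] by simp

lemma smooth_diff: "smooth f \<Longrightarrow> smooth g \<Longrightarrow> smooth (\<lambda>\<theta>. f \<theta> - g \<theta>)"
  using smooth_add[OF _ smooth_minus] by force

lemma smooth_sum: "(\<And>i. i \<in> S \<Longrightarrow> smooth (f i)) \<Longrightarrow> smooth (\<lambda>\<theta>. \<Sum>i\<in>S. f i \<theta>)"
  by (induction S rule: infinite_finite_induct) (auto intro: smooth_add)

subsection \<open>Products\<close>


lemma dir_deriv_bilinear:
  assumes "bounded_bilinear p" "f differentiable (at \<theta>)" "g differentiable (at \<theta>)"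
  shows "dir_deriv v (\<lambda>\<theta>. p (f \<theta>) (g \<theta>)) \<theta> = p (f \<theta>) (dir_deriv v g \<theta>) + p (dir_deriv v f \<theta>) (g \<theta>)"
proof -
  obtain D E where D: "(f has_derivative D) (at \<theta>)" "(g has_derivative E) (at \<theta>)"
    using assms by (auto simp: differentiable_def)
  show ?thesis
    using dir_deriv_eq[OF bounded_bilinear.FDERIV[OF assms(1) D], of v]
    by (simp add: dir_deriv_eq[OF D(1)] dir_deriv_eq[OF D(2)])
qed

lemma differentiable_bilinear:
  assumes "bounded_bilinear p" "f differentiable (at \<theta> within S)" "g differentiable (at \<theta> within S)"
  shows "(\<lambda>\<theta>. p (f \<theta>) (g \<theta>)) differentiable (at \<theta> within S)"
  using assms(2,3) by (auto simp: differentiable_def dest!: bounded_bilinear.FDERIV[OF assms(1)])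

lemma smooth_upto_bilinear:
  assumes "bounded_bilinear p"
  shows "smooth_upto n f \<Longrightarrow> smooth_upto n g \<Longrightarrow> smooth_upto n (\<lambda>\<theta>. p (f \<theta>) (g \<theta>))"
proof (induction n arbitrary: f g)
  case 0
  then show ?case
    by (auto simp: smooth_upto_def differentiable_on_def intro!: differentiable_bilinear[OF assms])
next
  case (Suc n)
  have d: "f differentiable (at \<theta>)" "g differentiable (at \<theta>)" for \<theta>
    using Suc.prems by (auto simp: smooth_upto_Suc differentiable_on_def)
  have l: "smooth_upto n f" "smooth_upto n g" using Suc.prems by (auto simp: smooth_upto_def)
  have "smooth_upto n (dir_deriv (axis i 1) (\<lambda>\<theta>. p (f \<theta>) (g \<theta>)))" for i
  proof -
    have "dir_deriv (axis i 1) (\<lambda>\<theta>. p (f \<theta>) (g \<theta>)) =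
      (\<lambda>\<theta>. p (f \<theta>) (dir_deriv (axis i 1) g \<theta>) + p (dir_deriv (axis i 1) f \<theta>) (g \<theta>))"
      using dir_deriv_bilinear[OF assms d] by blast
    then show ?thesis
      using Suc.prems l by (auto simp: smooth_upto_Suc intro!: smooth_upto_add Suc.IH)
  qed
  then show ?case
    unfolding smooth_upto_Suc using d
    by (auto simp: differentiable_on_def intro!: differentiable_bilinear[OF assms])
qed

lemma smooth_bilinear:
  "bounded_bilinear p \<Longrightarrow> smooth f \<Longrightarrow> smooth g \<Longrightarrow> smooth (\<lambda>\<theta>. p (f \<theta>) (g \<theta>))"
  by (simp add: smooth_iff_upto smooth_upto_bilinear)

text \<open>Each derivative splits a product into two terms, hence the factor
  \<open>2 ^ r\<close>.\<close>

lemma bounded_Cr_bilinear: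
  assumes p: "bounded_bilinear p" "\<And>a b. norm (p a b) \<le> norm a * norm b"
  shows "smooth f \<Longrightarrow> smooth g \<Longrightarrow> bounded_Cr r K f \<Longrightarrow> bounded_Cr r L g \<Longrightarrow>
    bounded_Cr r (2 ^ r * (K * L)) (\<lambda>\<theta>. p (f \<theta>) (g \<theta>))"
proof (induction r arbitrary: f g)
  case 0
  have "norm (p (f \<theta>) (g \<theta>)) \<le> K * L" for \<theta>
    using p(2) bounded_Cr_norm[OF 0(3)] bounded_Cr_norm[OF 0(4)] bounded_Cr_nonneg[OF 0(3)]
    by (meson mult_mono norm_ge_zero order_trans)
  then show ?case by (simp add: bounded_Cr_0)
next
  case (Suc r)
  note KL = bounded_Cr_nonneg[OF Suc.prems(3)] bounded_Cr_nonneg[OF Suc.prems(4)]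
  have "norm (p (f \<theta>) (g \<theta>)) \<le> K * L" for \<theta>
    using p(2) bounded_Cr_norm[OF Suc.prems(3)] bounded_Cr_norm[OF Suc.prems(4)] KL
    by (meson mult_mono norm_ge_zero order_trans)
  moreover have "K * L \<le> 2 ^ Suc r * (K * L)"
    using KL mult_right_mono[of 1 "2 ^ Suc r" "K * L"] by (simp del: power_Suc)
  ultimately have n: "norm (p (f \<theta>) (g \<theta>)) \<le> 2 ^ Suc r * (K * L)" for \<theta> by (meson order_trans)
  have "bounded_Cr r (2 ^ Suc r * (K * L)) (dir_deriv (axis i 1) (\<lambda>\<theta>. p (f \<theta>) (g \<theta>)))" for i
  proof -
    have e: "dir_deriv (axis i 1) (\<lambda>\<theta>. p (f \<theta>) (g \<theta>)) =
      (\<lambda>\<theta>. p (f \<theta>) (dir_deriv (axis i 1) g \<theta>) + p (dir_deriv (axis i 1) f \<theta>) (g \<theta>))"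
      using dir_deriv_bilinear[OF p(1) smooth_differentiable[OF Suc.prems(1)] smooth_differentiable[OF Suc.prems(2)]] by blast
    have b: "bounded_Cr r K f" "bounded_Cr r L g" 
      using Suc.prems(3,4) bounded_Cr_mono[of "Suc r" _ _ r] by auto
    have "bounded_Cr r (2 ^ r * (K * L) + 2 ^ r * (K * L)) (dir_deriv (axis i 1) (\<lambda>\<theta>. p (f \<theta>) (g \<theta>)))"
      unfolding e using Suc.prems b
      by (intro bounded_Cr_add smooth_bilinear[OF p(1)] Suc.IH) (auto simp: bounded_Cr_Suc smooth_dir_deriv_axis)
    then show ?thesis by (simp add: mult_ac)
  qed
  then show ?case using n by (simp add: bounded_Cr_Suc)
qed

lemma dpart_scale:
  assumes "smooth f"
  shows "dpart is (\<lambda>\<theta>. f (c *\<^sub>R \<theta>)) = (\<lambda>\<theta>. c ^ length is *\<^sub>R dpart is f (c *\<^sub>R \<theta>))"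
proof (induction "is")
  case (Cons i "is")
  have "dir_deriv v (\<lambda>\<theta>. c ^ length is *\<^sub>R dpart is f (c *\<^sub>R \<theta>)) \<theta> =
      c ^ length is *\<^sub>R (c *\<^sub>R dir_deriv v (dpart is f) (c *\<^sub>R \<theta>))" for v \<theta>
  proof -
    obtain D where D: "(dpart is f has_derivative D) (at (c *\<^sub>R \<theta>))" 
      using smooth_dpart_differentiable[OF assms] by (auto simp: differentiable_def)
    interpret D: bounded_linear D using D by (rule has_derivative_bounded_linear)
    have "((\<lambda>\<theta>. c *\<^sub>R \<theta>) has_derivative (\<lambda>\<theta>. c *\<^sub>R \<theta>)) (at \<theta>)"
      by (auto intro!: derivative_eq_intros)
    from has_derivative_scaleR_right[OF has_derivative_compose[OF this D], of "c ^ length is"]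
    have "((\<lambda>\<theta>. c ^ length is *\<^sub>R dpart is f (c *\<^sub>R \<theta>)) has_derivative (\<lambda>x. c ^ length is *\<^sub>R D (c *\<^sub>R x))) (at \<theta>)" .
    then show ?thesis by (simp add: dir_deriv_eq dir_deriv_eq[OF D] D.scaleR)
  qed
  with Cons show ?case by (auto simp: mult.commute)
qed auto

lemma smooth_scale:
  assumes "smooth f"
  shows "smooth (\<lambda>\<theta>. f (c *\<^sub>R \<theta>))"
proof -
  have "(\<lambda>\<theta>. dpart is f (c *\<^sub>R \<theta>)) differentiable (at \<theta>)" for "is" \<theta>
    using differentiable_chain_at[of "\<lambda>\<theta>. c *\<^sub>R \<theta>" \<theta> "dpart is f"] smooth_dpart_differentiable[OF assms]
    by (auto simp: o_def)
  then show ?thesis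
    unfolding smooth_def dpart_scale[OF assms] by (auto simp: differentiable_on_def)
qed

lemma bounded_Cr_scale:
  assumes "smooth f" "bounded_Cr r K f" "1 \<le> c"
  shows "bounded_Cr r (c ^ r * K) (\<lambda>\<theta>. f (c *\<^sub>R \<theta>))"
  unfolding bounded_Cr_def dpart_scale[OF assms(1)]
proof (intro allI impI)
  fix "is" :: "'a list" and \<theta> assume "length is \<le> r"
  then show "norm (c ^ length is *\<^sub>R dpart is f (c *\<^sub>R \<theta>)) \<le> c ^ r * K"
    using assms(2,3) unfolding bounded_Cr_def
    by (auto intro!: mult_mono power_increasing)
qed

lemma dir_deriv_scale:
  assumes "f differentiable (at (c *\<^sub>R \<theta>))"
  shows "dir_deriv v (\<lambda>\<theta>. f (c *\<^sub>R \<theta>)) \<theta> = dir_deriv (c *\<^sub>R v) f (c *\<^sub>R \<theta>)"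
proof -
  obtain D where D: "(f has_derivative D) (at (c *\<^sub>R \<theta>))" 
    using assms by (auto simp: differentiable_def)
  have "((\<lambda>\<theta>. c *\<^sub>R \<theta>) has_derivative (\<lambda>\<theta>. c *\<^sub>R \<theta>)) (at \<theta>)"
    by (auto intro!: derivative_eq_intros)
  from has_derivative_compose[OF this D] show ?thesis by (simp add: dir_deriv_eq dir_deriv_eq[OF D])
qed

lemma bounded_linear_axis: "bounded_linear (\<lambda>x::'a::real_normed_vector. axis i x :: 'a^'n)"
proof (rule bounded_linear_intro)
  show "norm (axis i x :: 'a^'n) \<le> norm x * 1" for x :: 'a
    by (simp add: norm_vec_def axis_def L2_set_def if_distrib[of norm] if_distrib[of "\<lambda>x. x^2"] cong: if_cong)
qed (auto simp: vec_eq_iff axis_def)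

lemma smooth_vec:
  fixes f :: "real^'d \<Rightarrow> 'a::real_normed_vector^'n"
  assumes "\<And>i. smooth (\<lambda>\<theta>. f \<theta> $ i)"
  shows "smooth f"
proof -
  have eq: "(\<lambda>\<theta>. \<Sum>i\<in>UNIV. axis i (f \<theta> $ i)) = f"
    by (simp add: vec_eq_iff axis_def fun_eq_iff)
  have "smooth (\<lambda>\<theta>. \<Sum>i\<in>UNIV. axis i (f \<theta> $ i) :: 'a^'n)"
    by (intro smooth_sum smooth_linear[OF bounded_linear_axis] assms)
  then show ?thesis unfolding eq .
qed

lemma smooth_nth:
  fixes f :: "real^'d \<Rightarrow> 'a::real_normed_vector^'n"
  shows "smooth f \<Longrightarrow> smooth (\<lambda>\<theta>. f \<theta> $ i)"
  by (rule smooth_linear[OF bounded_linear_vec_nth])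

subsection \<open>Matrix-valued maps\<close>

text \<open>The norm on matrices is the Euclidean norm of the entries (Frobenius norm), so
  Cauchy-Schwarz for each entry of the product suffices.\<close>

lemma norm_matrix_mult:
  fixes A :: "'a::real_normed_field^'m^'n" and B :: "'a^'k^'m"
  shows "norm (A ** B) \<le> norm A * norm B"
proof -
  have n2: "(norm M)\<^sup>2 = (\<Sum>i\<in>UNIV. \<Sum>j\<in>UNIV. (norm (M $ i $ j))\<^sup>2)" for M :: "'a^'p^'q"
    by (simp add: norm_vec_def L2_set_def sum_nonneg)
  have "(norm ((A ** B) $ i $ j))\<^sup>2 \<le> (\<Sum>l\<in>UNIV. (norm (A $ i $ l))\<^sup>2) * (\<Sum>l\<in>UNIV. (norm (B $ l $ j))\<^sup>2)" for i j
  proof -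
    have "norm ((A ** B) $ i $ j) \<le> (\<Sum>l\<in>UNIV. \<bar>norm (A $ i $ l)\<bar> * \<bar>norm (B $ l $ j)\<bar>)"
      unfolding matrix_matrix_mult_def by (auto simp: norm_mult intro!: sum_norm_le)
    also have "\<dots> \<le> L2_set (\<lambda>l. norm (A $ i $ l)) UNIV * L2_set (\<lambda>l. norm (B $ l $ j)) UNIV"
      by (rule L2_set_mult_ineq)
    finally have "(norm ((A ** B) $ i $ j))\<^sup>2 \<le> (L2_set (\<lambda>l. norm (A $ i $ l)) UNIV * L2_set (\<lambda>l. norm (B $ l $ j)) UNIV)\<^sup>2"
      by (rule power_mono) simp
    then show ?thesis by (simp add: L2_set_def sum_nonneg power_mult_distrib)
  qed
  then have "(norm (A ** B))\<^sup>2 \<le> (\<Sum>i\<in>UNIV. \<Sum>j\<in>UNIV. (\<Sum>l\<in>UNIV. (norm (A $ i $ l))\<^sup>2) * (\<Sum>l\<in>UNIV. (norm (B $ l $ j))\<^sup>2))"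
    unfolding n2 by (intro sum_mono)
  also have "\<dots> = (norm A)\<^sup>2 * (norm B)\<^sup>2"
    unfolding n2 sum_distrib_left[symmetric] sum_distrib_right[symmetric]
    by (subst (3) sum.swap) simp
  finally show ?thesis
    by (metis norm_ge_zero mult_nonneg_nonneg power2_le_imp_le power_mult_distrib)
qed

lemma bounded_bilinear_matrix_mult:
  "bounded_bilinear (\<lambda>(A::'a::real_normed_field^'m^'n) (B::'a^'k^'m). A ** B)"
proof
  show "\<exists>K. \<forall>(A::'a^'m^'n) (B::'a^'k^'m). norm (A ** B) \<le> norm A * norm B * K"
    using norm_matrix_mult by (metis mult.right_neutral)
qed (auto simp: vec_eq_iff matrix_matrix_mult_def sum.distrib algebra_simps scaleR_sum_right)

lemmas smooth_matrix_mult = smooth_bilinear[OF bounded_bilinear_matrix_mult]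
lemmas bounded_Cr_matrix_mult = bounded_Cr_bilinear[OF bounded_bilinear_matrix_mult norm_matrix_mult]
lemmas dir_deriv_matrix_mult = dir_deriv_bilinear[OF bounded_bilinear_matrix_mult]

lemma differentiable_prod_field:
  fixes f :: "'i \<Rightarrow> 'b::real_normed_vector \<Rightarrow> 'a::real_normed_field"
  shows "(\<And>i. i \<in> S \<Longrightarrow> f i differentiable (at x)) \<Longrightarrow> (\<lambda>x. \<Prod>i\<in>S. f i x) differentiable (at x)"
  by (induction S rule: infinite_finite_induct) (auto intro: differentiable_mult)

lemma differentiable_det:
  fixes f :: "'b::real_normed_vector \<Rightarrow> 'a::real_normed_field^'n^'n"
  assumes "\<And>i j. (\<lambda>x. f x $ i $ j) differentiable (at x)"
  shows "(\<lambda>x. det (f x)) differentiable (at x)"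
  unfolding det_def
  by (intro differentiable_sum ballI differentiable_mult differentiable_const differentiable_prod_field assms)
    (simp add: finite_permutations)

lemma differentiable_vec:
  fixes f :: "'b::real_normed_vector \<Rightarrow> 'a::real_normed_vector^'n"
  assumes "\<And>i. (\<lambda>x. f x $ i) differentiable (at x)"
  shows "f differentiable (at x)"
proof -
  have eq: "(\<lambda>x. \<Sum>i\<in>UNIV. axis i (f x $ i)) = f"
    by (simp add: vec_eq_iff axis_def fun_eq_iff)
  have "(\<lambda>x. \<Sum>i\<in>UNIV. axis i (f x $ i) :: 'a^'n) differentiable (at x)"
    by (intro differentiable_sum ballI differentiable_bounded_linear[OF bounded_linear_axis] assms) simp
  then show ?thesis unfolding eq .
qed

subsection \<open>Matrix inverses\<close>

lemma matrix_inv_works: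
  fixes M :: "'a::field^'n^'n"
  assumes "invertible M"
  shows "M ** matrix_inv M = mat 1" "matrix_inv M ** M = mat 1"
  using assms unfolding invertible_def matrix_inv_def by (metis (mono_tags, lifting) someI_ex)+

lemma matrix_inv_eqI:
  fixes M :: "'a::field^'n^'n"
  assumes "M ** N = mat 1"
  shows "matrix_inv M = N"
proof -
  have "N ** M = mat 1" using assms matrix_left_right_inverse by blast
  then have "invertible M" using assms by (auto simp: invertible_def)
  then show ?thesis
    by (metis assms matrix_inv_works(2) matrix_mul_assoc matrix_mul_lid matrix_mul_rid)
qed

lemma invertibleI_right:
  fixes M :: "'a::field^'n^'n"
  shows "M ** N = mat 1 \<Longrightarrow> invertible M"
  using matrix_left_right_inverse by (auto simp: invertible_def)

lemma matrix_inv_cramer: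
  fixes M :: "'a::field^'n^'n"
  assumes "invertible M"
  shows "matrix_inv M $ k $ j = det (\<chi> a b. if b = k then axis j 1 $ a else M $ a $ b) / det M"
proof -
  have "M *v column j (matrix_inv M) = axis j 1"
    using matrix_inv_works(1)[OF assms]
    by (simp add: vec_eq_iff matrix_vector_mult_def matrix_matrix_mult_def column_def mat_def axis_def)
  then have "column j (matrix_inv M) = (\<chi> k. det (\<chi> a b. if b = k then axis j 1 $ a else M $ a $ b) / det M)"
    using assms by (subst (asm) cramer) (auto simp: invertible_det_nz)
  then show ?thesis by (simp add: column_def vec_eq_iff)
qed

text \<open>Cramer's rule makes each entry of the inverse a quotient of determinants.
  Differentiability is thus available before the formula for the derivative, whose proof needs
  it.\<close>

lemma differentiable_matrix_inv:
  fixes M :: "real^'d \<Rightarrow> 'a::real_normed_field^'n^'n"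
  assumes "\<And>\<theta>. invertible (M \<theta>)" "M differentiable (at \<theta>)"
  shows "(\<lambda>\<theta>. matrix_inv (M \<theta>)) differentiable (at \<theta>)"
proof (intro differentiable_vec)
  have e: "(\<lambda>\<theta>. M \<theta> $ a $ b) differentiable (at \<theta>)" for a b
    by (rule differentiable_bounded_linear[OF bounded_linear_vec_nth],
        rule differentiable_bounded_linear[OF bounded_linear_vec_nth], rule assms(2))
  have d: "(\<lambda>\<theta>. det (\<chi> a b. if b = k then axis j 1 $ a else M \<theta> $ a $ b)) differentiable (at \<theta>)" for k j
    proof (rule differentiable_det)
    show "(\<lambda>\<theta>. (\<chi> a b. if b = k then axis j 1 $ a else M \<theta> $ a $ b) $ a $ b) differentiable (at \<theta>)" for a b
      by (cases "b = k") (simp_all add: e)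
  qed
  have d': "(\<lambda>\<theta>. det (M \<theta>)) differentiable (at \<theta>)" by (rule differentiable_det) (rule e)
  show "(\<lambda>\<theta>. matrix_inv (M \<theta>) $ k $ j) differentiable (at \<theta>)" for k j
    unfolding matrix_inv_cramer[OF assms(1)]
    using d d' assms(1) by (intro differentiable_divide) (auto simp: invertible_det_nz)
qed

lemma matrix_mult_add_left: "(A + B) ** C = A ** C + B ** (C :: 'a::semiring_1^'k^'m)"
  by (simp add: vec_eq_iff matrix_matrix_mult_def distrib_right sum.distrib)

lemma dir_deriv_matrix_inv:
  fixes M :: "real^'d \<Rightarrow> 'a::real_normed_field^'n^'n"
  assumes inv: "\<And>\<theta>. invertible (M \<theta>)" and d: "M differentiable (at \<theta>)"
  shows "dir_deriv v (\<lambda>\<theta>. matrix_inv (M \<theta>)) \<theta> = - (matrix_inv (M \<theta>) ** dir_deriv v M \<theta> ** matrix_inv (M \<theta>))"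
proof -
  let ?N = "\<lambda>\<theta>. matrix_inv (M \<theta>)"
  have "dir_deriv v (\<lambda>\<theta>. ?N \<theta> ** M \<theta>) \<theta> = ?N \<theta> ** dir_deriv v M \<theta> + dir_deriv v ?N \<theta> ** M \<theta>"
    by (rule dir_deriv_matrix_mult[OF differentiable_matrix_inv[OF inv d] d])
  then have "?N \<theta> ** dir_deriv v M \<theta> + dir_deriv v ?N \<theta> ** M \<theta> = 0"
    by (simp add: matrix_inv_works[OF inv])
  then have "(?N \<theta> ** dir_deriv v M \<theta> + dir_deriv v ?N \<theta> ** M \<theta>) ** ?N \<theta> = 0" by simp
  then have "?N \<theta> ** dir_deriv v M \<theta> ** ?N \<theta> + dir_deriv v ?N \<theta> = 0"
    by (simp add: matrix_mult_add_left matrix_mul_assoc[symmetric] matrix_inv_works[OF inv])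
  then show ?thesis by (simp add: eq_neg_iff_add_eq_0 add.commute)
qed

lemma smooth_upto_neg:
  assumes "smooth_upto n f"
  shows "smooth_upto n (\<lambda>\<theta>. - f \<theta>)"
proof -
  have "bounded_bilinear (\<lambda>(x::real) y. x *\<^sub>R (y::'b))" by (rule bounded_bilinear_scaleR)
  moreover have "smooth_upto n (\<lambda>_. -1 :: real)" using smooth_const unfolding smooth_iff_upto by blast
  ultimately show ?thesis using smooth_upto_bilinear[of "\<lambda>x y. x *\<^sub>R y" n "\<lambda>_. -1" f] assms by simp
qed

text \<open>Bootstrapping: the derivative of the inverse contains only the inverse and a derivative
  of M, so order n of the inverse yields order \<open>Suc n\<close>.\<close>

lemma smooth_matrix_inv:
  fixes M :: "real^'d \<Rightarrow> 'a::real_normed_field^'n^'n"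
  assumes inv: "\<And>\<theta>. invertible (M \<theta>)" and s: "smooth M"
  shows "smooth (\<lambda>\<theta>. matrix_inv (M \<theta>))"
proof -
  let ?N = "\<lambda>\<theta>. matrix_inv (M \<theta>)"
  have d: "?N differentiable (at \<theta>)" for \<theta>
    by (rule differentiable_matrix_inv[OF inv smooth_differentiable[OF s]])
  have "smooth_upto n ?N" for n
  proof (induction n)
    case 0
    then show ?case using d by (auto simp: smooth_upto_def differentiable_on_def)
  next
    case (Suc n)
    have e: "dir_deriv (axis i 1) ?N = (\<lambda>\<theta>. - (?N \<theta> ** dir_deriv (axis i 1) M \<theta> ** ?N \<theta>))" for i
      using dir_deriv_matrix_inv[OF inv smooth_differentiable[OF s]] by blast
    have "smooth_upto n (dir_deriv (axis i 1) M)" for i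
      using s smooth_dir_deriv_axis smooth_iff_upto by blast
    then show ?case
      unfolding smooth_upto_Suc e using d
      by (auto simp: differentiable_on_def
          intro!: smooth_upto_neg smooth_upto_bilinear[OF bounded_bilinear_matrix_mult] Suc.IH)
  qed
  then show ?thesis by (simp add: smooth_iff_upto)
qed

text \<open>One more derivative contains the inverse twice, so a bound b turns into
  \<open>4 ^ r * K * b\<^sup>2\<close>. If b is the power \<open>3 ^ r\<close> of
  \<open>4 ^ r * K\<close>, the new exponent is \<open>1 + 2 * 3 ^ r\<close>, at most
  \<open>3 ^ Suc r\<close>. What matters later is that the result is polynomial in K.\<close>

lemma bounded_Cr_matrix_inv:
  fixes M :: "real^'d \<Rightarrow> 'a::real_normed_field^'n^'n"
  assumes inv: "\<And>\<theta>. invertible (M \<theta>)" and s: "smooth M"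
    and K: "1 \<le> K" "\<And>\<theta>. norm (matrix_inv (M \<theta>)) \<le> K" 
  shows "bounded_Cr r K M \<Longrightarrow> bounded_Cr r ((4 ^ r * K) ^ (3 ^ r)) (\<lambda>\<theta>. matrix_inv (M \<theta>))"
proof (induction r)
  case 0
  then show ?case using K by (simp add: bounded_Cr_0)
next
  case (Suc r)
  let ?N = "\<lambda>\<theta>. matrix_inv (M \<theta>)" and ?b = "(4 ^ r * K) ^ (3 ^ r)"
  have sN: "smooth ?N" by (rule smooth_matrix_inv[OF inv s])
  have IH: "bounded_Cr r ?b ?N" using Suc bounded_Cr_mono[of "Suc r" K M r K] by auto
  have b1: "1 \<le> 4 ^ r * K" using K(1) mult_mono[of 1 "4^r" 1 K] by simp
  have b1': "4 ^ r * K \<le> 4 ^ Suc r * K" using K(1) by simp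
  have "bounded_Cr r (4 ^ r * K * ?b\<^sup>2) (dir_deriv (axis i 1) ?N)" for i
  proof -
    have e: "dir_deriv (axis i 1) ?N = (\<lambda>\<theta>. - (?N \<theta> ** dir_deriv (axis i 1) M \<theta> ** ?N \<theta>))"
      using dir_deriv_matrix_inv[OF inv smooth_differentiable[OF s]] by blast
    have s': "smooth (dir_deriv (axis i 1) M)" using s by (rule smooth_dir_deriv_axis)
    have "bounded_Cr r (2 ^ r * (2 ^ r * (?b * K) * ?b)) (\<lambda>\<theta>. ?N \<theta> ** dir_deriv (axis i 1) M \<theta> ** ?N \<theta>)"
      using Suc.prems IH by (intro bounded_Cr_matrix_mult smooth_matrix_mult sN s') (auto simp: bounded_Cr_Suc)
    moreover have "2 ^ r * (2 ^ r * (b * K) * b) = 4 ^ r * K * b\<^sup>2" for b :: real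
    proof -
      have "(2::real) ^ r * 2 ^ r = 4 ^ r" by (simp flip: power_mult_distrib)
      moreover have "2 ^ r * (2 ^ r * (b * K) * b) = (2 ^ r * 2 ^ r) * K * b\<^sup>2"
        by (simp only: power2_eq_square mult_ac)
      ultimately show ?thesis by simp
    qed
    ultimately have "bounded_Cr r (4 ^ r * K * ?b\<^sup>2) (\<lambda>\<theta>. ?N \<theta> ** dir_deriv (axis i 1) M \<theta> ** ?N \<theta>)"
      by metis
    then show ?thesis
      unfolding e by (intro bounded_Cr_minus smooth_matrix_mult sN s')
  qed
  moreover have "4 ^ r * K * ?b\<^sup>2 \<le> (4 ^ Suc r * K) ^ (3 ^ Suc r)"
  proof -
    have "x * (x ^ n)\<^sup>2 = x ^ (1 + 2 * n)" for x :: real and n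
      by (simp add: power_even_eq)
    then have "4 ^ r * K * ?b\<^sup>2 = (4 ^ r * K) ^ (1 + 2 * 3 ^ r)" .
    also have "\<dots> \<le> (4 ^ r * K) ^ (3 ^ Suc r)"
      by (rule power_increasing[OF _ b1]) (use one_le_power[of "3::nat" r] in simp)
    also have "\<dots> \<le> (4 ^ Suc r * K) ^ (3 ^ Suc r)"
      using b1 b1' by (intro power_mono) auto
    finally show ?thesis .
  qed
  moreover have "K \<le> (4 ^ Suc r * K) ^ (3 ^ Suc r)"
  proof -
    have "K \<le> 4 ^ r * K" using K(1) by simp
    also have "\<dots> \<le> 4 ^ Suc r * K" by (rule b1')
    also have "\<dots> = (4 ^ Suc r * K) ^ 1" by simp
    also have "\<dots> \<le> (4 ^ Suc r * K) ^ (3 ^ Suc r)"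
      using b1 b1' by (intro power_increasing) (auto simp del: power_Suc)
    finally show ?thesis .
  qed
  ultimately show ?case
    unfolding bounded_Cr_Suc using order_trans[OF K(2)] bounded_Cr_mono[OF _ order_refl] by fast
qed

subsection \<open>Periodic maps\<close>

lemma periodic_map_axis_int:
  assumes "periodic_map f"
  shows "f (\<theta> + axis i (of_int k)) = f \<theta>"
proof -
  have n: "f (\<theta> + axis i (of_nat n)) = f \<theta>" for n \<theta>
  proof (induction n)
    case 0 then show ?case by (simp add: axis_def zero_vec_def[symmetric])
  next
    case (Suc n)
    have "\<theta> + axis i (of_nat (Suc n)) = (\<theta> + axis i (of_nat n)) + axis i (1::real)"
      by (simp add: vec_eq_iff axis_def)
    with Suc assms show ?case unfolding periodic_map_def by (metis add.assoc)
  qed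
  show ?thesis
  proof (cases "k \<ge> 0")
    case True
    then show ?thesis using n[of \<theta> "nat k"] by simp
  next
    case False
    then have "\<theta> + axis i (of_int k) + axis i (of_nat (nat (-k))) = \<theta>"
      by (simp add: vec_eq_iff axis_def)
    then show ?thesis using n[of "\<theta> + axis i (of_int k)" "nat (-k)"] by metis
  qed
qed

lemma periodic_map_int:
  assumes "periodic_map f"
  shows "f (\<theta> + (\<chi> i. of_int (k i)) :: real^'d) = f \<theta>"
proof -
  have "f (\<theta> + (\<Sum>i\<in>S. axis i (of_int (k i)))) = f \<theta>" if "finite S" for S
    using that
  proof (induction S)
    case (insert i S)
    then show ?case
      using periodic_map_axis_int[OF assms, of "\<theta> + (\<Sum>i\<in>S. axis i (of_int (k i)))" i "k i"]
      by (simp add: ac_simps)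
  qed simp
  moreover have "(\<Sum>i\<in>UNIV. axis i (of_int (k i))) = ((\<chi> i. of_int (k i)) :: real^'d)"
    by (simp add: vec_eq_iff axis_def)
  ultimately show ?thesis by (metis finite)
qed

lemma periodic_bounded:
  fixes f :: "real^'d \<Rightarrow> 'a::real_normed_vector"
  assumes "periodic_map f" "continuous_on UNIV f"
  shows "\<exists>K. \<forall>\<theta>. norm (f \<theta>) \<le> K"
proof -
  have "continuous_on (cbox 0 1) f" using assms(2) continuous_on_subset by blast
  then have "bounded (f ` cbox 0 1)"
    by (intro compact_imp_bounded compact_continuous_image compact_cbox)
  then obtain K where K: "\<And>x. x \<in> cbox 0 1 \<Longrightarrow> norm (f x) \<le> K"
    unfolding bounded_iff by blast
  have "norm (f \<theta>) \<le> K" for \<theta>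
  proof -
    have "f \<theta> = f (\<theta> + (\<chi> i. of_int (- \<lfloor>\<theta> $ i\<rfloor>)))"
      by (rule periodic_map_int[OF assms(1), symmetric])
    also have "\<theta> + (\<chi> i. of_int (- \<lfloor>\<theta> $ i\<rfloor>)) = ((\<chi> i. frac (\<theta> $ i)) :: real^'d)"
      by (simp add: vec_eq_iff frac_def)
    finally show ?thesis
      using K[of "\<chi> i. frac (\<theta> $ i)"] by (simp add: mem_box_cart less_imp_le[OF frac_lt_1])
  qed
  then show ?thesis by blast
qed

lemma periodic_map_dpart: "periodic_map f \<Longrightarrow> periodic_map (dpart is f)"
proof (induction "is")
  case (Cons i "is")
  then have "dpart is f (\<theta> + axis j 1 + t) = dpart is f (\<theta> + t)" for \<theta> j t
    unfolding periodic_map_def by (metis add.assoc add.commute)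
  then show ?case by (simp add: periodic_map_def dir_deriv_def)
qed simp

lemma smooth_periodic_bounded_Cr:
  assumes "periodic_map f" "smooth f"
  shows "\<exists>K. bounded_Cr r K f"
proof -
  have "\<exists>K. \<forall>\<theta>. norm (dpart is f \<theta>) \<le> K" for "is"
    using assms smooth_continuous_on[OF smooth_dpart] periodic_bounded periodic_map_dpart by metis
  then obtain K where K: "\<And>is \<theta>. norm (dpart is f \<theta>) \<le> K is" by metis
  have fin: "finite {is::'a list. length is \<le> r}" using finite_lists_length_le[of "UNIV :: 'a set" r] by simp
  have "K is \<le> Max (K ` {is. length is \<le> r})" if "length is \<le> r" for "is"
    using that fin by auto
  then show ?thesis unfolding bounded_Cr_def using K by (meson order_trans)
qed

lemma periodic_map_comp: "periodic_map f \<Longrightarrow> periodic_map (\<lambda>\<theta>. h (f \<theta>))"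
  by (simp add: periodic_map_def)

lemma periodic_map_comp2: "periodic_map f \<Longrightarrow> periodic_map g \<Longrightarrow> periodic_map (\<lambda>\<theta>. h (f \<theta>) (g \<theta>))"
  by (simp add: periodic_map_def)

lemma periodic_map_double: "periodic_map f \<Longrightarrow> periodic_map (\<lambda>\<theta>. f (2 *\<^sub>R \<theta>))"
proof -
  assume f: "periodic_map f"
  have "2 *\<^sub>R axis i (1::real) = axis i (of_int 2)" for i :: 'a
    by (simp add: vec_eq_iff axis_def)
  then show ?thesis
    using periodic_map_axis_int[OF f, of _ _ 2] by (simp add: periodic_map_def scaleR_add_right)
qed

subsection \<open>Characters\<close>

definition idot :: "int^'d \<Rightarrow> real^'d \<Rightarrow> real" where
  "idot k \<theta> = (\<Sum>i\<in>UNIV. of_int (k $ i) * \<theta> $ i)"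

definition chr :: "int^'d \<Rightarrow> real^'d \<Rightarrow> complex" where
  "chr k \<theta> = cis (2 * pi * idot k \<theta>)"

lemma idot_add: "idot k (x + y) = idot k x + idot k y"
  by (simp add: idot_def algebra_simps sum.distrib)

lemma idot_scaleR: "idot k (c *\<^sub>R x) = c * idot k x"
  by (simp add: idot_def algebra_simps sum_distrib_left)

lemma idot_add_left: "idot (k + l) x = idot k x + idot l x"
  by (simp add: idot_def algebra_simps sum.distrib)

lemma idot_minus_left: "idot (- k) x = - idot k x"
  by (simp add: idot_def sum_negf)

lemma idot_diff_left: "idot (k - l) x = idot k x - idot l x"
  using idot_add_left[of k "- l" x] by (simp add: idot_minus_left)

lemma idot_zero_left [simp]: "idot 0 x = 0"
  by (simp add: idot_def)

lemma bounded_linear_idot: "bounded_linear (idot k)"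
  by (rule linear_conv_bounded_linear[THEN iffD1], rule linearI) (simp_all add: idot_add idot_scaleR)

lemma norm_chr [simp]: "norm (chr k \<theta>) = 1"
  by (simp add: chr_def)

lemma chr_add: "chr k (x + y) = chr k x * chr k y"
  by (simp add: chr_def idot_add distrib_left cis_mult)

lemma chr_add_left: "chr (k + l) x = chr k x * chr l x"
  by (simp add: chr_def idot_add_left distrib_left cis_mult)

lemma chr_zero [simp]: "chr 0 x = 1" "chr k 0 = 1"
  by (simp_all add: chr_def idot_def)

lemma chr_mult_cnj [simp]: "chr k x * cnj (chr k x) = 1" "cnj (chr k x) * chr k x = 1"
  by (simp_all add: chr_def cis_cnj cis_mult)

lemma idot_axis [simp]: "idot k (axis i c) = of_int (k $ i) * c"
proof -
  have "idot k (axis i c) = (\<Sum>j\<in>UNIV. if j = i then of_int (k $ j) * c else 0)"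
    unfolding idot_def by (rule sum.cong) (auto simp: axis_def)
  then show ?thesis by simp
qed

lemma periodic_map_chr: "periodic_map (chr k)"
  unfolding periodic_map_def chr_add
proof (intro allI)
  fix \<theta> i
  have "chr k (axis i 1) = cis (2 * pi * of_int (k $ i))" by (simp add: chr_def)
  also have "\<dots> = 1" by (rule cis_multiple_2pi) simp
  finally show "chr k \<theta> * chr k (axis i 1) = chr k \<theta>" by simp
qed

lemma chr_double: "chr k (2 *\<^sub>R \<theta>) = chr (k + k) \<theta>"
proof -
  have "2 *\<^sub>R \<theta> = \<theta> + \<theta>" by (simp add: scaleR_2)
  then show ?thesis by (simp only: chr_add chr_add_left)
qed

lemma has_derivative_chr:
  "(chr k has_derivative (\<lambda>v. (2 * pi * idot k v) *\<^sub>R (\<i> * chr k \<theta>))) (at \<theta>)"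
  unfolding chr_def
  by (rule derivative_eq_intros bounded_linear_imp_has_derivative[OF bounded_linear_idot] refl)+
     (simp add: scaleR_conv_of_real algebra_simps)

lemma dir_deriv_chr: "dir_deriv v (chr k) \<theta> = 2 * pi * \<i> * idot k v * chr k \<theta>"
  by (simp add: dir_deriv_eq[OF has_derivative_chr] scaleR_conv_of_real)

lemma dpart_chr: "dpart is (chr k) = (\<lambda>\<theta>. (\<Prod>i\<leftarrow>is. 2 * pi * \<i> * of_int (k $ i)) * chr k \<theta>)"
proof (induction "is")
  case (Cons i "is")
  have "chr k differentiable (at \<theta>)" for \<theta> using has_derivative_chr by (auto simp: differentiable_def)
  then show ?case
    unfolding dpart.simps Cons.IH
    by (subst dir_deriv_linear[OF bounded_linear_mult_right]) (auto simp: dir_deriv_chr fun_eq_iff)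
qed simp

lemma smooth_chr: "smooth (chr k)"
  unfolding smooth_def dpart_chr differentiable_on_def
  using has_derivative_chr differentiable_bounded_linear[OF bounded_linear_mult_right]
  by (metis differentiable_def)

lemma bounded_Cr_chr:
  assumes "\<And>i. 2 * pi * \<bar>of_int (k $ i)\<bar> \<le> X" "1 \<le> X"
  shows "bounded_Cr r (X ^ r) (chr k)"
proof -
  have "norm (\<Prod>i\<leftarrow>is. 2 * pi * \<i> * of_int (k $ i)) \<le> X ^ length is" for "is"
  proof (induction "is")
    case (Cons i "is")
    then show ?case using assms by (auto simp: norm_mult abs_mult intro!: mult_mono)
  qed simp
  moreover have "X ^ length is \<le> X ^ r" if "length is \<le> r" for "is" :: "'a list"
    using assms(2) that by (rule power_increasing[rotated])
  ultimately show ?thesis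
    unfolding bounded_Cr_def dpart_chr by (auto simp: norm_mult intro: order_trans)
qed

subsection \<open>Real and complex matrices\<close>

definition cnjm :: "complex^'n^'m \<Rightarrow> complex^'n^'m" where
  "cnjm M = (\<chi> i j. cnj (M $ i $ j))"

definition Rem :: "complex^'n^'m \<Rightarrow> real^'n^'m" where
  "Rem M = (\<chi> i j. Re (M $ i $ j))"

lemma cnjm_nth [simp]: "cnjm M $ i $ j = cnj (M $ i $ j)"
  and Rem_nth [simp]: "Rem M $ i $ j = Re (M $ i $ j)"
  and cmat_nth [simp]: "cmat R $ i $ j = complex_of_real (R $ i $ j)"
  by (simp_all add: cnjm_def Rem_def cmat_def)

lemma cnjm_mult: "cnjm (A ** B) = cnjm A ** cnjm B"
  by (simp add: vec_eq_iff matrix_matrix_mult_def)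

lemma cnjm_cnjm [simp]: "cnjm (cnjm A) = A"
  and cnjm_cmat [simp]: "cnjm (cmat R) = cmat R"
  and cnjm_add: "cnjm (A + B) = cnjm A + cnjm B"
  and cnjm_diff: "cnjm (A - B) = cnjm A - cnjm B"
  and cnjm_scaleR: "cnjm (c *\<^sub>R A) = c *\<^sub>R cnjm A"
  and cnjm_zero [simp]: "cnjm 0 = 0"
  by (simp_all add: vec_eq_iff)

lemma cnjm_mat [simp]: "cnjm (mat 1) = mat 1"
  by (simp add: vec_eq_iff mat_def)

lemma cmat_mat [simp]: "cmat (mat 1) = mat 1"
  by (simp add: vec_eq_iff mat_def)

lemma Rem_cmat [simp]: "Rem (cmat R) = R"
  and Rem_add: "Rem (A + B) = Rem A + Rem B"
  and Rem_diff: "Rem (A - B) = Rem A - Rem B"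
  and Rem_zero [simp]: "Rem 0 = 0"
  by (simp_all add: vec_eq_iff)

lemma Rem_mult_left: "Rem (cmat R ** B) = R ** Rem B"
  and Rem_mult_right: "Rem (B ** cmat R) = Rem B ** R"
  by (simp_all add: vec_eq_iff matrix_matrix_mult_def)

lemma Rem_mat [simp]: "Rem (mat 1) = mat 1"
  using Rem_cmat[of "mat 1"] by simp

lemma cmat_Rem: "2 *\<^sub>R cmat (Rem A) = A + cnjm A"
  by (simp add: vec_eq_iff complex_add_cnj scaleR_conv_of_real)

lemma bounded_linear_cnjm: "bounded_linear cnjm"
  by (rule linear_conv_bounded_linear[THEN iffD1], rule linearI) (simp_all add: vec_eq_iff)

lemma bounded_linear_Rem: "bounded_linear Rem"
  by (rule linear_conv_bounded_linear[THEN iffD1], rule linearI) (simp_all add: vec_eq_iff)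

lemma norm_cnjm [simp]: "norm (cnjm M) = norm M"
  by (simp add: norm_vec_def)

lemma norm_cmat [simp]: "norm (cmat M) = norm M"
  by (simp add: norm_vec_def)

lemma norm_Rem: "norm (Rem M) \<le> norm M"
  unfolding norm_vec_def
  by (intro L2_set_mono) (auto simp: abs_Re_le_cmod)

lemma smooth_cnjm: "smooth f \<Longrightarrow> smooth (\<lambda>\<theta>. cnjm (f \<theta>))"
  by (rule smooth_linear[OF bounded_linear_cnjm])

lemma smooth_Rem: "smooth f \<Longrightarrow> smooth (\<lambda>\<theta>. Rem (f \<theta>))"
  by (rule smooth_linear[OF bounded_linear_Rem])

lemma bounded_Cr_cnjm: "smooth f \<Longrightarrow> bounded_Cr r K f \<Longrightarrow> bounded_Cr r K (\<lambda>\<theta>. cnjm (f \<theta>))"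
  using bounded_Cr_linear[OF bounded_linear_cnjm, of f r K 1] by simp

lemma bounded_Cr_Rem: "smooth f \<Longrightarrow> bounded_Cr r K f \<Longrightarrow> bounded_Cr r K (\<lambda>\<theta>. Rem (f \<theta>))"
  using bounded_Cr_linear[OF bounded_linear_Rem, of f r K 1] norm_Rem by auto

lemma norm_entry_le: "norm (M $ i $ j) \<le> norm (M :: 'a::real_normed_vector^'n^'m)"
  using Finite_Cartesian_Product.norm_nth_le[of "M $ i" j] Finite_Cartesian_Product.norm_nth_le[of M i] by (rule order_trans)

lemma norm_le_entries:
  fixes M :: "'a::real_normed_vector^'n^'m"
  assumes "\<And>i j. norm (M $ i $ j) \<le> c"
  shows "norm M \<le> real CARD('m) * real CARD('n) * c"
proof -
  have "norm (M $ i) \<le> real CARD('n) * c" for i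
  proof -
    have "norm (M $ i) \<le> (\<Sum>j\<in>UNIV. norm (M $ i $ j))"
      unfolding norm_vec_def[of "M $ i"] by (rule L2_set_le_sum) simp
    also have "\<dots> \<le> real CARD('n) * c" using sum_mono[of UNIV, OF assms[of i]] by simp
    finally show ?thesis .
  qed
  moreover have "norm M \<le> (\<Sum>i\<in>UNIV. norm (M $ i))"
    unfolding norm_vec_def[of M] by (rule L2_set_le_sum) simp
  ultimately have "norm M \<le> (\<Sum>i\<in>(UNIV::'m set). real CARD('n) * c)"
    by (meson order_trans sum_mono)
  then show ?thesis by (simp add: mult.assoc)
qed

subsection \<open>The norms of the statement\<close>

lemma norm_matrix_vector_mult:
  fixes M :: "'a::real_normed_field^'n^'m"
  shows "norm (M *v x) \<le> norm M * norm x"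
proof -
  have c: "norm (\<chi> i. \<chi> j::1. y $ i) = norm y" for y :: "'a^'k"
    by (simp add: norm_vec_def L2_set_def)
  have "(\<chi> i. \<chi> j::1. (M *v x) $ i) = M ** (\<chi> i. \<chi> j::1. x $ i)"
    by (simp add: vec_eq_iff matrix_vector_mult_def matrix_matrix_mult_def)
  then show ?thesis using norm_matrix_mult[of M "\<chi> i. \<chi> j::1. x $ i"] c by metis
qed

lemma bounded_linear_matrix_vector:
  fixes M :: "'a::real_normed_field^'n^'m"
  shows "bounded_linear (\<lambda>x. M *v x)"
proof (rule bounded_linear_intro)
  show "norm (M *v x) \<le> norm x * norm M" for x
    using norm_matrix_vector_mult[of M x] by (simp add: mult.commute)
qed (auto simp: vec_eq_iff matrix_vector_mult_def algebra_simps sum.distrib scaleR_sum_right)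

lemma mat_norm_le_norm: "mat_norm M \<le> norm M"
  unfolding mat_norm_def by (rule onorm_bound) (auto simp: norm_matrix_vector_mult)

lemma mat_norm_nonneg: "0 \<le> mat_norm M"
  unfolding mat_norm_def by (rule onorm_pos_le[OF bounded_linear_matrix_vector])

text \<open>Entries are coordinates of images of unit vectors. All estimates are made in the
  entrywise Euclidean norm; this bound and \<open>mat_norm_le_norm\<close> are the bridge to the
  operator norm of the statement.\<close>

lemma norm_le_mat_norm:
  fixes M :: "'a::real_normed_field^'n^'m"
  shows "norm M \<le> real CARD('m) * real CARD('n) * mat_norm M"
proof (rule norm_le_entries)
  fix i j
  have "M $ i $ j = (M *v axis j 1) $ i"
    by (simp add: matrix_vector_mult_def axis_def if_distrib[of "\<lambda>x. _ * x"] cong: if_cong)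
  then have "norm (M $ i $ j) \<le> norm (M *v axis j 1)" by (metis Finite_Cartesian_Product.norm_nth_le)
  also have "\<dots> \<le> mat_norm M * norm (axis j 1 :: 'a^'n)"
    unfolding mat_norm_def by (rule onorm[OF bounded_linear_matrix_vector])
  also have "norm (axis j 1 :: 'a^'n) = 1"
    by (simp add: norm_vec_def L2_set_def axis_def if_distrib[of norm] if_distrib[of "\<lambda>x. x^2"] cong: if_cong)
  finally show "norm (M $ i $ j) \<le> mat_norm M" by simp
qed

lemma Cr_norm_le:
  assumes "bounded_Cr r K f"
  shows "Cr_norm r f \<le> K"
  unfolding Cr_norm_def
proof (rule cSup_least)
  show "{mat_norm (dpart is f \<theta>) |is \<theta>. length is \<le> r} \<noteq> {}"
    by (metis (mono_tags, lifting) empty_iff le0 list.size(3) mem_Collect_eq)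
qed (use assms mat_norm_le_norm order_trans in \<open>fastforce simp: bounded_Cr_def\<close>)

text \<open>Periodicity makes the set of values bounded, without which its \<open>Sup\<close> says
  nothing. For this reason estimates are carried by the predicate \<open>bounded_Cr\<close> and
  translated to \<open>Cr_norm\<close> only at the two ends of the proof.\<close>

lemma mat_norm_le_Cr_norm:
  assumes "periodic_map f" "smooth f" "length is \<le> r"
  shows "mat_norm (dpart is f \<theta>) \<le> Cr_norm r f"
  unfolding Cr_norm_def
proof (rule cSup_upper)
  obtain K where "bounded_Cr r K f" using smooth_periodic_bounded_Cr assms by blast
  then show "bdd_above {mat_norm (dpart is f \<theta>) |is \<theta>. length is \<le> r}"
    unfolding bounded_Cr_def bdd_above_def using mat_norm_le_norm order_trans by blast
qed (use assms(3) in blast)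

lemma Cr_norm_nonneg:
  assumes "periodic_map f" "smooth f"
  shows "0 \<le> Cr_norm r f"
  using mat_norm_le_Cr_norm[OF assms, of "[]" r 0] mat_norm_nonneg[of "f 0"] by simp

lemma bounded_Cr_Cr_norm:
  fixes f :: "real^'d \<Rightarrow> 'a::real_normed_field^'n^'m"
  assumes "periodic_map f" "smooth f"
  shows "bounded_Cr r (real CARD('m) * real CARD('n) * Cr_norm r f) f"
  unfolding bounded_Cr_def
proof (intro allI impI)
  fix "is" :: "'d list" and \<theta> assume "length is \<le> r"
  then have "real CARD('m) * real CARD('n) * mat_norm (dpart is f \<theta>) \<le> real CARD('m) * real CARD('n) * Cr_norm r f"
    by (intro mult_left_mono mat_norm_le_Cr_norm assms) auto
  then show "norm (dpart is f \<theta>) \<le> real CARD('m) * real CARD('n) * Cr_norm r f"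
    using norm_le_mat_norm order_trans by blast
qed

section \<open>Fourier coefficients on the torus\<close>

text \<open>A weight with finite sum over all integers: coefficients dominated by it have uniformly
  bounded Fourier sums. The maximum takes care of frequency 0.\<close>

definition wt :: "int \<Rightarrow> real" where
  "wt m = 1 / (max 1 (of_int \<bar>m\<bar>))\<^sup>2"

lemma wt_pos: "0 < wt m"
  by (simp add: wt_def)

lemma sum_wt_le:
  assumes "finite S"
  shows "sum wt S \<le> 5"
proof -
  \<comment> \<open>The additional term 2 / n makes the bound telescope, since
    \<open>1 / (n + 1)\<^sup>2\<close> is at most 1 / n - 1 / (n + 1). At n = 1 both sides equal
    3.\<close>
  have b: "sum wt {- int n..int n} \<le> 5 - 2 / real n" if "n \<ge> 1" for n
    using that
  proof (induction n rule: dec_induct)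
    case base
    have "{- int 1..int 1} = {-1, 0, 1}" by auto
    then show ?case by (simp add: wt_def)
  next
    case (step n)
    have e: "{- int (Suc n)..int (Suc n)} = insert (- int (Suc n)) (insert (int (Suc n)) {- int n..int n})"
      by auto
    have w: "wt (int (Suc n)) = 1 / (real n + 1)\<^sup>2" "wt (- int (Suc n)) = 1 / (real n + 1)\<^sup>2"
      by (auto simp: wt_def add.commute max_def)
    have s: "sum wt {- int (Suc n)..int (Suc n)} = wt (- int (Suc n)) + (wt (int (Suc n)) + sum wt {- int n..int n})"
      unfolding e by (subst sum.insert; simp)+
    have "sum wt {- int (Suc n)..int (Suc n)} = 2 / (real n + 1)\<^sup>2 + sum wt {- int n..int n}"
      unfolding s w by simp
    also have "\<dots> \<le> 2 / (real n + 1)\<^sup>2 + (5 - 2 / real n)" using step.IH by simp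
    also have "2 / (real n + 1)\<^sup>2 \<le> 2 / (real n * (real n + 1))"
      using step.hyps by (intro divide_left_mono) (auto simp: power2_eq_square)
    also have "2 / (real n * (real n + 1)) + (5 - 2 / real n) = 5 - 2 / real (Suc n)"
    proof -
      have "2 / (x * (x + 1)) + (5 - 2 / x) = 5 - 2 / (x + 1)" if "x > 0" for x :: real
        using that by (simp add: divide_simps) algebra
      from this[of "real n"] show ?thesis using step.hyps by (simp add: add.commute)
    qed
    finally show ?case by simp
  qed
  obtain n where n: "\<And>m. m \<in> S \<Longrightarrow> \<bar>m\<bar> \<le> int n"
  proof
    fix m assume "m \<in> S"
    then have "nat \<bar>m\<bar> \<le> Max ((\<lambda>m. nat \<bar>m\<bar>) ` S)" using assms by auto
    then show "\<bar>m\<bar> \<le> int (Max ((\<lambda>m. nat \<bar>m\<bar>) ` S))" by linarith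
  qed
  have "sum wt S \<le> sum wt {- int (Suc n)..int (Suc n)}"
    using n less_imp_le[OF wt_pos] by (intro sum_mono2) force+
  also have "\<dots> \<le> 5 - 2 / real (Suc n)" by (rule b) simp
  also have "\<dots> \<le> 5" by simp
  finally show ?thesis .
qed

section \<open>The Fejer kernel and a one-dimensional sup bound from Fourier coefficients\<close>

lemma integral_cis_int:
  "integral {0..1} (\<lambda>s. cis (2 * pi * of_int m * s)) = (if m = 0 then 1 else 0)"
proof (cases "m = 0")
  case False
  let ?c = "2 * pi * real_of_int m"
  have "((\<lambda>s. cis (?c * s) / (\<i> * ?c)) has_vector_derivative cis (?c * s)) (at s within {0..1})" for s
    using False
    by (auto intro!: derivative_eq_intros simp: has_vector_derivative_def scaleR_conv_of_real field_simps)
  then have "((\<lambda>s. cis (?c * s)) has_integral cis (?c * 1) / (\<i> * ?c) - cis (?c * 0) / (\<i> * ?c)) {0..1}"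
    by (intro fundamental_theorem_of_calculus) auto
  moreover have "cis ?c = 1" by (rule cis_multiple_2pi) simp
  ultimately show ?thesis using False by (simp add: integral_unique)
qed simp

text \<open>The Fejer kernel. Being nonnegative of mass 1, it recovers the value of a continuous
  function from its Fourier coefficients without any convergence theorem for Fourier series.\<close>

definition fejer :: "nat \<Rightarrow> real \<Rightarrow> real" where
  "fejer N s = (cmod (\<Sum>m<N. cis (2 * pi * real m * s)))\<^sup>2 / real N"

lemma fejer_nonneg: "0 \<le> fejer N s"
  by (simp add: fejer_def)

lemma fejer_expand:
  "complex_of_real (fejer N s) = (\<Sum>a<N. \<Sum>b<N. cis (2 * pi * of_int (int a - int b) * s)) / N"
proof -
  have "complex_of_real ((cmod (\<Sum>m<N. cis (2 * pi * real m * s)))\<^sup>2)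
      = (\<Sum>m<N. cis (2 * pi * real m * s)) * cnj (\<Sum>m<N. cis (2 * pi * real m * s))"
    by (rule complex_norm_square)
  also have "\<dots> = (\<Sum>a<N. \<Sum>b<N. cis (2 * pi * real a * s) * cis (- (2 * pi * real b * s)))"
    by (simp add: sum_product cis_cnj)
  also have "\<dots> = (\<Sum>a<N. \<Sum>b<N. cis (2 * pi * of_int (int a - int b) * s))"
    by (simp add: cis_mult algebra_simps)
  finally show ?thesis by (simp add: fejer_def)
qed

lemma continuous_fejer: "continuous_on S (fejer N)"
  unfolding fejer_def divide_inverse by (intro continuous_intros)

lemma integral_fejer:
  assumes "N \<ge> 1"
  shows "integral {0..1} (\<lambda>s. complex_of_real (fejer N s)) = 1"
proof -
  have "integral {0..1} (\<lambda>s. complex_of_real (fejer N s)) =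
      (\<Sum>a<N. \<Sum>b<N. integral {0..1} (\<lambda>s. cis (2 * pi * of_int (int a - int b) * s))) / N"
    unfolding fejer_expand
    by (subst integral_divide, subst integral_sum)
      (auto intro!: integrable_continuous_real continuous_intros integral_sum sum.cong)
  also have "\<dots> = (\<Sum>a<N. \<Sum>b<N. if b = a then 1 else 0) / N"
    unfolding integral_cis_int by (auto intro!: arg_cong[of _ _ "\<lambda>x. x / _"] sum.cong)
  also have "\<dots> = 1" using assms by simp
  finally show ?thesis .
qed

text \<open>Multiplying the geometric sum by z - 1 leaves z^N - 1, and |e^(2it) - 1| equals 2 |sin
  t|. So the kernel carries little mass away from the integers, where the sine vanishes.\<close>

lemma sin_fejer_le:
  assumes "N \<ge> 1"
  shows "(sin (pi * s))\<^sup>2 * fejer N s \<le> 1 / N"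
proof -
  let ?z = "cis (2 * pi * s)"
  have h: "(cmod (cis (2 * t) - 1))\<^sup>2 = 4 * (sin t)\<^sup>2" for t
  proof -
    have "(cmod (cis (2 * t) - 1))\<^sup>2 = (cos (2*t) - 1)\<^sup>2 + (sin (2*t))\<^sup>2"
      by (simp add: cmod_power2)
    also have "\<dots> = (2 * (sin t)\<^sup>2)\<^sup>2 + (2 * sin t * cos t)\<^sup>2"
      by (simp add: cos_double_sin sin_double power2_eq_square)
    also have "\<dots> = 4 * (sin t)\<^sup>2 * ((sin t)\<^sup>2 + (cos t)\<^sup>2)" by algebra
    finally show ?thesis by simp
  qed
  have "(?z - 1) * (\<Sum>m<N. ?z ^ m) = ?z ^ N - 1"
    by (simp add: power_diff_1_eq)
  moreover have "?z ^ m = cis (2 * pi * real m * s)" for m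
    by (subst Complex.DeMoivre) (simp add: mult_ac)
  ultimately have "(?z - 1) * (\<Sum>m<N. cis (2 * pi * real m * s)) = cis (2 * (pi * N * s)) - 1"
    by (simp add: mult_ac)
  then have "(cmod (cis (2 * (pi * s)) - 1))\<^sup>2 * (cmod (\<Sum>m<N. cis (2 * pi * real m * s)))\<^sup>2
      = (cmod (cis (2 * (pi * N * s)) - 1))\<^sup>2"
    by (simp flip: norm_mult power_mult_distrib add: mult.assoc)
  then have "(sin (pi * s))\<^sup>2 * (cmod (\<Sum>m<N. cis (2 * pi * real m * s)))\<^sup>2 = (sin (pi * N * s))\<^sup>2"
    unfolding h by simp
  also have "\<dots> \<le> 1" using abs_sin_le_one by (simp add: abs_square_le_1)
  finally show ?thesis using assms by (simp add: fejer_def divide_right_mono)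
qed

text \<open>The value \<open>v 0\<close> is the integral of v against the Fejer kernel, up to an
  error that continuity makes small. The integral is an average of N sums of coefficients at
  distinct frequencies, each at most 5 A by \<open>sum_wt_le\<close>.\<close>

lemma fourier_sup_bound_1d:
  fixes v :: "real \<Rightarrow> complex"
  assumes cont: "continuous_on {0..1} v" and per: "v 1 = v 0"
    and coef: "\<And>m. cmod (integral {0..1} (\<lambda>s. v s * cis (- (2 * pi * of_int m * s)))) \<le> A * wt m"
  shows "cmod (v 0) \<le> 5 * A"
proof (rule field_le_epsilon)
  fix e :: real assume "0 < e"
  define \<epsilon> where "\<epsilon> = e / 2"
  have \<epsilon>: "\<epsilon> > 0" using \<open>0 < e\<close> by (simp add: \<epsilon>_def)
  have A: "0 \<le> A" using coef[of 0] norm_ge_zero order_trans wt_pos[of 0] by (metis zero_le_mult_iff less_le_not_le)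
  \<comment> \<open>Near both endpoints \<open>v s\<close> is within \<epsilon> of
    \<open>v 0\<close>, by continuity and \<open>per\<close>. On the remaining compact set
    \<open>T\<close> the squared sine is bounded below, so a large multiple of it dominates the
    bounded difference. This is the form to which \<open>sin_fejer_le\<close> applies.\<close>
  have "\<exists>C\<ge>0. \<forall>s\<in>{0..1}. cmod (v 0 - v s) \<le> \<epsilon> + C * (sin (pi * s))\<^sup>2"
  proof -
    define T where "T = {0..1} \<inter> (\<lambda>s. cmod (v 0 - v s)) -` {\<epsilon>..}"
    have "closed T" unfolding T_def
      by (intro continuous_closed_preimage continuous_intros cont)
    then have T: "compact T"
      by (simp add: T_def compact_eq_bounded_closed bounded_Int)
    show ?thesis
    proof (cases "T = {}")
      case True
      then show ?thesis by (intro exI[of _ 0]) (auto simp: T_def not_le less_imp_le)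
    next
      case False
      obtain s0 where s0: "s0 \<in> T" "\<And>s. s \<in> T \<Longrightarrow> (sin (pi * s0))\<^sup>2 \<le> (sin (pi * s))\<^sup>2"
      proof -
        have "continuous_on T (\<lambda>s. (sin (pi * s))\<^sup>2)" by (intro continuous_intros)
        from continuous_attains_inf[OF T False this] show ?thesis using that by blast
      qed
      have "s0 \<noteq> 0" "s0 \<noteq> 1" using s0(1) per \<epsilon> by (auto simp: T_def)
      then have "0 < s0" "s0 < 1" using s0(1) by (auto simp: T_def)
      then have "sin (pi * s0) > 0" by (intro sin_gt_zero) auto
      then have c: "(sin (pi * s0))\<^sup>2 > 0" by simp
      have "bounded (v ` {0..1})" using cont by (intro compact_imp_bounded compact_continuous_image) auto
      then obtain V where V: "\<And>s. s \<in> {0..1} \<Longrightarrow> cmod (v s) \<le> V" unfolding bounded_iff by blast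
      have "cmod (v 0) \<le> V" using V[of 0] by simp
      then have V0: "0 \<le> V" using norm_ge_zero[of "v 0"] by linarith
      have "cmod (v 0 - v s) \<le> \<epsilon> + 2 * V / (sin (pi * s0))\<^sup>2 * (sin (pi * s))\<^sup>2" if s: "s \<in> {0..1}" for s
      proof (cases "s \<in> T")
        case True
        have "cmod (v 0 - v s) \<le> 2 * V"
          using V[OF s] V[of 0] norm_triangle_ineq4[of "v 0" "v s"] by simp
        also have "\<dots> = 2 * V / (sin (pi * s0))\<^sup>2 * (sin (pi * s0))\<^sup>2" using c by simp
        also have "\<dots> \<le> 2 * V / (sin (pi * s0))\<^sup>2 * (sin (pi * s))\<^sup>2"
          using s0(2)[OF True] V0 by (intro mult_left_mono) auto
        finally show ?thesis using \<epsilon> by simp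
      next
        case False
        then have "cmod (v 0 - v s) \<le> \<epsilon>" using s by (auto simp: T_def)
        moreover have "0 \<le> 2 * V / (sin (pi * s0))\<^sup>2 * (sin (pi * s))\<^sup>2" using V0 by simp
        ultimately show ?thesis by linarith
      qed
      then show ?thesis using V0 by (intro exI[of _ "2 * V / (sin (pi * s0))\<^sup>2"]) auto
    qed
  qed
  then obtain C where C: "C \<ge> 0" "\<And>s. s \<in> {0..1} \<Longrightarrow> cmod (v 0 - v s) \<le> \<epsilon> + C * (sin (pi * s))\<^sup>2"
    by blast
  obtain N :: nat where N: "N \<ge> 1" "C / N \<le> \<epsilon>"
  proof -
    obtain n :: nat where "C / \<epsilon> < n" using reals_Archimedean2 by blast
    then show ?thesis using that[of "Suc n"] \<epsilon> C(1) by (simp add: field_simps)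
  qed
  let ?F = "\<lambda>s. complex_of_real (fejer N s)"
  have cF: "continuous_on {0..1} ?F" by (intro continuous_intros continuous_fejer)
  have "v 0 = integral {0..1} (\<lambda>s. v 0 * ?F s)" using integral_fejer[OF N(1)] by simp
  also have "\<dots> = integral {0..1} (\<lambda>s. v s * ?F s + (v 0 - v s) * ?F s)" by (simp add: algebra_simps)
  also have "\<dots> = integral {0..1} (\<lambda>s. v s * ?F s) + integral {0..1} (\<lambda>s. (v 0 - v s) * ?F s)"
    by (intro integral_add integrable_continuous_real continuous_intros cont cF)
  finally have split: "v 0 = integral {0..1} (\<lambda>s. v s * ?F s) + integral {0..1} (\<lambda>s. (v 0 - v s) * ?F s)" .
  have "cmod (integral {0..1} (\<lambda>s. (v 0 - v s) * ?F s)) \<le> integral {0..1} (\<lambda>s. \<epsilon> * fejer N s + C / N)"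
  proof (rule integral_norm_bound_integral)
    fix s :: real assume s: "s \<in> {0..1}"
    have "cmod ((v 0 - v s) * ?F s) \<le> (\<epsilon> + C * (sin (pi * s))\<^sup>2) * fejer N s"
      using C(2)[OF s] fejer_nonneg by (simp add: norm_mult mult_right_mono)
    also have "\<dots> = \<epsilon> * fejer N s + C * ((sin (pi * s))\<^sup>2 * fejer N s)" by (simp add: algebra_simps)
    also have "\<dots> \<le> \<epsilon> * fejer N s + C / N"
      using mult_left_mono[OF sin_fejer_le[OF N(1), of s] C(1)] by simp
    finally show "cmod ((v 0 - v s) * ?F s) \<le> \<epsilon> * fejer N s + C / N" .
  qed (intro integrable_continuous_real continuous_intros cont cF continuous_fejer)+
  also have "\<dots> = \<epsilon> * integral {0..1} (fejer N) + C / N"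
    by (subst integral_add) (auto intro!: integrable_continuous_real continuous_intros continuous_fejer)
  also have "integral {0..1} (fejer N) = 1"
  proof -
    have "complex_of_real (integral {0..1} (fejer N)) = integral {0..1} ?F"
      by (metis (no_types, lifting) ext continuous_fejer integrable_continuous_real integral_linear bounded_linear_of_real o_def)
    then show ?thesis using integral_fejer[OF N(1)] by (metis of_real_eq_1_iff)
  qed
  finally have b2: "cmod (integral {0..1} (\<lambda>s. (v 0 - v s) * ?F s)) \<le> e"
    using N(2) \<epsilon>_def by linarith
  have "integral {0..1} (\<lambda>s. v s * ?F s) = integral {0..1} (\<lambda>s. (\<Sum>a<N. \<Sum>b<N. v s * cis (- (2 * pi * of_int (int b - int a) * s))) / N)"
    unfolding fejer_expand by (simp add: sum_distrib_left algebra_simps)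
  also have "\<dots> = (\<Sum>a<N. \<Sum>b<N. integral {0..1} (\<lambda>s. v s * cis (- (2 * pi * of_int (int b - int a) * s)))) / N"
    by (subst integral_divide, subst integral_sum)
      (auto intro!: integrable_continuous_real continuous_intros integral_sum sum.cong cont)
  finally have "cmod (integral {0..1} (\<lambda>s. v s * ?F s)) = 
      cmod (\<Sum>a<N. \<Sum>b<N. integral {0..1} (\<lambda>s. v s * cis (- (2 * pi * of_int (int b - int a) * s)))) / N"
    by (simp add: norm_divide)
  \<comment> \<open>For fixed a the differences b - a are distinct, so their weights add up to at
    most 5. The outer average over a costs nothing.\<close>
  also have "\<dots> \<le> (\<Sum>a<N. 5 * A) / N"
  proof (intro divide_right_mono sum_norm_le)
    fix a
    have "cmod (\<Sum>b<N. integral {0..1} (\<lambda>s. v s * cis (- (2 * pi * of_int (int b - int a) * s)))) \<le> (\<Sum>b<N. A * wt (int b - int a))"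
      by (intro sum_norm_le coef)
    also have "\<dots> = A * sum wt ((\<lambda>b. int b - int a) ` {..<N})"
      by (subst sum.reindex) (auto simp: inj_on_def sum_distrib_left)
    also have "\<dots> \<le> A * 5" by (intro mult_left_mono sum_wt_le A) auto
    finally show "cmod (\<Sum>b<N. integral {0..1} (\<lambda>s. v s * cis (- (2 * pi * of_int (int b - int a) * s)))) \<le> 5 * A" by simp
  qed auto
  also have "\<dots> = 5 * A" using N(1) by simp
  finally show "cmod (v 0) \<le> 5 * A + e"
    using b2 norm_triangle_ineq[of "integral {0..1} (\<lambda>s. v s * ?F s)" "integral {0..1} (\<lambda>s. (v 0 - v s) * ?F s)"]
    unfolding split[symmetric] by linarith
qed

text \<open>The Fourier coefficient of a periodic map is obtained by integrating out one coordinate at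
  a time; \<open>fproj i m\<close> projects on the frequency \<open>m\<close> in the coordinate \<open>i\<close>.\<close>

definition fproj :: "'d \<Rightarrow> int \<Rightarrow> (real^'d \<Rightarrow> complex) \<Rightarrow> real^'d \<Rightarrow> complex" where
  "fproj i m u \<theta> = integral {0..1} (\<lambda>s. u (\<theta> + s *\<^sub>R axis i 1) * cis (- (2 * pi * of_int m * s)))"

fun fprojs :: "'d list \<Rightarrow> int^'d \<Rightarrow> (real^'d \<Rightarrow> complex) \<Rightarrow> real^'d \<Rightarrow> complex" where
  "fprojs [] k u = u"
| "fprojs (i # is) k u = fproj i (k $ i) (fprojs is k u)"

lemma continuous_on_line:
  fixes u :: "real^'d \<Rightarrow> 'a::topological_space"
  assumes "continuous_on UNIV u"
  shows "continuous_on S (\<lambda>s. u (\<theta> + s *\<^sub>R v))"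
  by (rule continuous_on_compose2[OF assms]) (auto intro!: continuous_intros)

lemma fproj_continuous:
  fixes u :: "real^'d \<Rightarrow> complex"
  assumes "continuous_on UNIV u"
  shows "continuous_on UNIV (fproj i m u)"
proof -
  have "continuous_on (UNIV \<times> cbox 0 (1::real)) (\<lambda>(\<theta>, s). u (\<theta> + s *\<^sub>R axis i 1) * cis (- (2 * pi * of_int m * s)))"
    unfolding case_prod_beta
    by (intro continuous_intros continuous_on_compose2[OF assms]) auto
  from integral_continuous_on_param[OF this] show ?thesis
    by (simp add: fproj_def[abs_def])
qed

lemma fproj_integrable:
  fixes u :: "real^'d \<Rightarrow> complex"
  assumes "continuous_on UNIV u"
  shows "(\<lambda>s. u (\<theta> + s *\<^sub>R axis i 1) * cis (- (2 * pi * of_int m * s))) integrable_on {0..1}"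
  by (intro integrable_continuous_real continuous_intros continuous_on_line assms)

lemma fproj_norm_le:
  assumes "continuous_on UNIV u" "\<And>\<theta>. norm (u \<theta>) \<le> B"
  shows "norm (fproj i m u \<theta>) \<le> B"
proof -
  have "norm (fproj i m u \<theta>) \<le> B * (1 - 0)"
    unfolding fproj_def
  proof (rule integral_bound)
    show "continuous_on {0..1} (\<lambda>s. u (\<theta> + s *\<^sub>R axis i 1) * cis (- (2 * pi * of_int m * s)))"
      by (intro continuous_intros continuous_on_line assms(1))
  qed (simp_all add: norm_mult assms(2))
  then show ?thesis by simp
qed

lemma fproj_add:
  assumes "continuous_on UNIV u" "continuous_on UNIV w"
  shows "fproj i m (\<lambda>\<theta>. u \<theta> + w \<theta>) = (\<lambda>\<theta>. fproj i m u \<theta> + fproj i m w \<theta>)"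
  unfolding fproj_def distrib_right
  by (intro ext integral_add fproj_integrable assms)

lemma fproj_cmult: "fproj i m (\<lambda>\<theta>. c * u \<theta>) = (\<lambda>\<theta>. c * fproj i m u \<theta>)"
  unfolding fproj_def mult.assoc by (simp add: integral_mult_right)

lemma fproj_translate: "fproj i m (\<lambda>\<theta>. u (\<theta> + w)) \<theta> = fproj i m u (\<theta> + w)"
  unfolding fproj_def by (simp add: ac_simps)

text \<open>The integral over [x, x + 1] has derivative \<open>g (x + 1) - g x = 0\<close> in x, so
  it is the same for x = t and x = 0.\<close>

lemma integral_periodic_shift:
  fixes g :: "real \<Rightarrow> complex"
  assumes cont: "continuous_on UNIV g" and per: "\<And>s. g (s + 1) = g s"
  shows "integral {0..1} (\<lambda>s. g (t + s)) = integral {0..1} g"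
proof -
  define a where "a = min 0 t - 1"
  define b where "b = max 0 t + 1"
  define I where "I = (\<lambda>x. integral {a..x} g)"
  have c: "continuous_on S g" for S using cont continuous_on_subset by blast
  have I: "integral {x..x+1} g = I (x + 1) - I x" if "x \<in> {a..b}" for x
    using Henstock_Kurzweil_Integration.integral_combine[where a=a and c=x and b="x + 1" and f=g] that
    by (simp add: I_def integrable_continuous_real c algebra_simps)
  have D: "(I has_vector_derivative g x) (at x within S)" if "x \<in> {a..b+1}" "S \<subseteq> {a..b+1}" for x S
    using integral_has_vector_derivative[OF c that(1)] that(2)
    unfolding I_def by (rule has_vector_derivative_within_subset)
  have "((\<lambda>x. I (x + 1) - I x) has_vector_derivative 0) (at x within {a..b})" if "x \<in> {a..b}" for x
  proof -
    have "((\<lambda>x. I (x + 1)) has_vector_derivative g (x + 1)) (at x within {a..b})"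
    proof -
      have "((\<lambda>x. x + 1) has_real_derivative 1) (at x within {a..b})"
        by (auto intro!: derivative_eq_intros)
      moreover have "(I has_vector_derivative g (x + 1)) (at (x + 1) within (\<lambda>x. x + 1) ` {a..b})"
        using that by (intro D) auto
      ultimately show ?thesis
        unfolding has_real_derivative_iff_has_vector_derivative
        using vector_diff_chain_within[of "\<lambda>x. x + 1" 1 x "{a..b}" I] by (simp add: o_def)
    qed
    moreover have "(I has_vector_derivative g x) (at x within {a..b})"
      using that by (intro D) auto
    ultimately show ?thesis using has_vector_derivative_diff per by fastforce
  qed
  then obtain z where z: "\<And>x. x \<in> {a..b} \<Longrightarrow> I (x + 1) - I x = z"
    using has_vector_derivative_zero_constant[of "{a..b}" "\<lambda>x. I (x + 1) - I x"] by auto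
  have "integral {0..1} (\<lambda>s. g (t + s)) = integral {t..t+1} g"
    using integral_shift_Icc_real[of 0 1 g t] by (simp add: o_def add.commute)
  also have "\<dots> = integral {0..1} g"
  proof -
    have "t \<in> {a..b}" "0 \<in> {a..b}" unfolding a_def b_def atLeastAtMost_iff by linarith+
    then show ?thesis using I[of t] I[of 0] z[of t] z[of 0] by simp
  qed
  finally show ?thesis .
qed

text \<open>The translation is absorbed into the integration variable and leaves a phase;
  periodicity then moves the unit interval back.\<close>

lemma fproj_eigen:
  assumes "continuous_on UNIV u" "periodic_map u"
  shows "fproj i m u (\<theta> + t *\<^sub>R axis i 1) = cis (2 * pi * of_int m * t) * fproj i m u \<theta>"
proof -
  define g where "g = (\<lambda>s. u (\<theta> + s *\<^sub>R axis i 1) * cis (- (2 * pi * of_int m * s)))"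
  have per: "g (s + 1) = g s" for s
  proof -
    have "\<theta> + (s + 1) *\<^sub>R axis i 1 = (\<theta> + s *\<^sub>R axis i 1) + axis i 1"
      by (simp add: scaleR_left_distrib)
    then have "u (\<theta> + (s + 1) *\<^sub>R axis i 1) = u (\<theta> + s *\<^sub>R axis i 1)"
      using assms(2) by (simp only: periodic_map_def)
    moreover have "cis (- (2 * pi * of_int m * (s + 1))) = cis (- (2 * pi * of_int m * s)) * cis (2 * pi * of_int (- m))"
      by (simp add: cis_mult algebra_simps)
    moreover have "cis (2 * pi * of_int (- m)) = 1" by (rule cis_multiple_2pi) simp
    ultimately show ?thesis by (simp add: g_def)
  qed
  have cont: "continuous_on UNIV g"
    unfolding g_def by (intro continuous_intros continuous_on_line assms)
  have "fproj i m u (\<theta> + t *\<^sub>R axis i 1) = integral {0..1} (\<lambda>s. cis (2 * pi * of_int m * t) * g (t + s))"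
    unfolding fproj_def g_def
  proof (intro arg_cong[of _ _ "integral {0..1}"] ext)
    fix s
    have "cis (- (2 * pi * of_int m * s)) = cis (2 * pi * of_int m * t) * cis (- (2 * pi * of_int m * (t + s)))"
      by (simp add: cis_mult algebra_simps)
    then show "u (\<theta> + t *\<^sub>R axis i 1 + s *\<^sub>R axis i 1) * cis (- (2 * pi * of_int m * s)) =
        cis (2 * pi * of_int m * t) * (u (\<theta> + (t + s) *\<^sub>R axis i 1) * cis (- (2 * pi * of_int m * (t + s))))"
      by (simp add: scaleR_left_distrib add.assoc mult_ac)
  qed
  also have "\<dots> = cis (2 * pi * of_int m * t) * integral {0..1} g"
    using integral_periodic_shift[OF cont per] by (simp add: integral_mult_right)
  finally show ?thesis by (simp add: g_def fproj_def)
qed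

lemma fproj_periodic: "periodic_map u \<Longrightarrow> periodic_map (fproj i m u)"
proof -
  assume "periodic_map u"
  then have "u (\<theta> + axis j 1 + x) = u (\<theta> + x)" for \<theta> j x
    unfolding periodic_map_def by (metis add.assoc add.commute)
  then show ?thesis by (simp add: periodic_map_def fproj_def)
qed

lemma fproj_chr: "fproj i m (chr l) = (\<lambda>\<theta>. (if m = l $ i then 1 else 0) * chr l \<theta>)"
proof
  fix \<theta>
  have "chr l (\<theta> + s *\<^sub>R axis i 1) * cis (- (2 * pi * of_int m * s)) = chr l \<theta> * cis (2 * pi * of_int (l $ i - m) * s)" for s
  proof -
    have "chr l (s *\<^sub>R axis i 1) = cis (2 * pi * of_int (l $ i) * s)"
      by (simp add: chr_def idot_scaleR mult_ac)
    then show ?thesis by (simp add: chr_add cis_mult algebra_simps)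
  qed
  then show "fproj i m (chr l) \<theta> = (if m = l $ i then 1 else 0) * chr l \<theta>"
    using integral_cis_int[of "l $ i - m"] by (simp add: fproj_def integral_mult_right)
qed

lemma fprojs_continuous:
  "continuous_on UNIV u \<Longrightarrow> continuous_on UNIV (fprojs is k u)"
  by (induction "is") (auto intro: fproj_continuous)

lemma fprojs_periodic: "periodic_map u \<Longrightarrow> periodic_map (fprojs is k u)"
  by (induction "is") (auto intro: fproj_periodic)

lemma fprojs_norm_le:
  assumes "continuous_on UNIV u" "\<And>\<theta>. norm (u \<theta>) \<le> B"
  shows "norm (fprojs is k u \<theta>) \<le> B"
  by (induction "is" arbitrary: \<theta>) (auto intro: fproj_norm_le fprojs_continuous assms)

lemma fprojs_add:
  assumes "continuous_on UNIV u" "continuous_on UNIV w"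
  shows "fprojs is k (\<lambda>\<theta>. u \<theta> + w \<theta>) = (\<lambda>\<theta>. fprojs is k u \<theta> + fprojs is k w \<theta>)"
  by (induction "is") (auto simp: fproj_add fprojs_continuous assms)

lemma fprojs_cmult: "fprojs is k (\<lambda>\<theta>. c * u \<theta>) = (\<lambda>\<theta>. c * fprojs is k u \<theta>)"
  by (induction "is") (auto simp: fproj_cmult)

lemma fprojs_translate: "fprojs is k (\<lambda>\<theta>. u (\<theta> + w)) = (\<lambda>\<theta>. fprojs is k u (\<theta> + w))"
  by (induction "is") (auto simp: fproj_translate)

text \<open>Projections in other coordinates commute with the translation along coordinate i, so the
  eigenvalue created by the projection in coordinate i persists.\<close>

lemma fprojs_eigen:
  assumes "continuous_on UNIV u" "periodic_map u"
  shows "i \<in> set is \<Longrightarrow> fprojs is k u (\<theta> + t *\<^sub>R axis i 1) = cis (2 * pi * of_int (k $ i) * t) * fprojs is k u \<theta>"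
proof (induction "is" arbitrary: \<theta>)
  case (Cons j "is")
  show ?case
  proof (cases "i = j")
    case True
    then show ?thesis using fproj_eigen[OF fprojs_continuous fprojs_periodic] assms by simp
  next
    case False
    then have "fprojs is k u (\<theta> + t *\<^sub>R axis i 1) = cis (2 * pi * of_int (k $ i) * t) * fprojs is k u \<theta>" for \<theta>
      using Cons by auto
    then have "fproj j m (\<lambda>\<theta>. fprojs is k u (\<theta> + t *\<^sub>R axis i 1)) \<theta> = cis (2 * pi * of_int (k $ i) * t) * fproj j m (fprojs is k u) \<theta>" for m
      by (simp add: fproj_cmult)
    then show ?thesis by (simp add: fproj_translate)
  qed
qed simp

lemma fprojs_chr: "fprojs is k (chr l) = (\<lambda>\<theta>. (if \<forall>i\<in>set is. k $ i = l $ i then 1 else 0) * chr l \<theta>)"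
proof (induction "is")
  case (Cons i "is")
  show ?case
    unfolding fprojs.simps Cons.IH fproj_cmult fproj_chr by auto
qed simp

lemma fprojs_cong: "(\<And>i. i \<in> set is \<Longrightarrow> k $ i = l $ i) \<Longrightarrow> fprojs is k u = fprojs is l u"
  by (induction "is") auto

text \<open>Coordinates are reinstated one at a time: with the frequencies in the remaining
  coordinates fixed, the one-dimensional bound in coordinate i trades the weight
  \<open>wt (k $ i)\<close> for a factor 5.\<close>

lemma fprojs_sup_bound:
  assumes u: "continuous_on UNIV u" "periodic_map u" and "distinct is"
    and "\<And>k. norm (fprojs is k u \<theta>) \<le> A * (\<Prod>i\<in>set is. wt (k $ i))"
  shows "norm (u \<theta>) \<le> 5 ^ length is * A"
  using assms(3,4)
proof (induction "is" arbitrary: A)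
  case (Cons i "is")
  have "norm (fprojs is k u \<theta>) \<le> (5 * A) * (\<Prod>i\<in>set is. wt (k $ i))" for k
  proof -
    let ?v = "\<lambda>s. fprojs is k u (\<theta> + s *\<^sub>R axis i 1)" and ?p = "\<Prod>i\<in>set is. wt (k $ i)"
    have "norm (?v 0) \<le> 5 * (A * ?p)"
    proof (rule fourier_sup_bound_1d)
      show "continuous_on {0..1} ?v"
        by (intro continuous_on_line fprojs_continuous u)
      show "?v 1 = ?v 0" using fprojs_periodic[OF u(2), of "is" k] by (simp add: periodic_map_def)
      fix m
      \<comment> \<open>By distinctness i does not occur in the remaining list, so its frequency can
        be set to m without affecting the projections already made.\<close>
      define l where "l = (\<chi> j. if j = i then m else k $ j)"
      have "fprojs is l u = fprojs is k u"
        using Cons.prems(1) by (intro fprojs_cong) (auto simp: l_def)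
      moreover have "(\<Prod>j\<in>set is. wt (l $ j)) = ?p"
        using Cons.prems(1) by (intro prod.cong) (auto simp: l_def)
      ultimately show "cmod (integral {0..1} (\<lambda>s. ?v s * cis (- (2 * pi * of_int m * s)))) \<le> A * ?p * wt m"
        using Cons.prems(2)[of l] Cons.prems(1) by (simp add: l_def fproj_def mult_ac)
    qed
    then show ?thesis by (simp add: mult_ac)
  qed
  from Cons.IH[OF _ this] Cons.prems(1) show ?case by (simp add: mult_ac)
qed simp

section \<open>Fourier coefficients in d variables\<close>

definition coords :: "'d::finite list" where
  "coords = (SOME xs. set xs = UNIV \<and> distinct xs)"

lemma set_coords: "set coords = (UNIV :: 'd::finite set)" and distinct_coords: "distinct (coords :: 'd list)"
  using someI_ex[OF finite_distinct_list[OF finite[of "UNIV :: 'd set"]]] by (simp_all add: coords_def)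

lemma length_coords: "length (coords :: 'd::finite list) = CARD('d)"
  using distinct_card[OF distinct_coords[where 'd='d]] by (simp add: set_coords)

text \<open>For continuous periodic u, projecting in every coordinate leaves a multiple of
  \<open>chr k\<close> (see \<open>fprojs_coords\<close>). Since \<open>chr k 0 = 1\<close>, the
  value at 0 is the multiple, that is, the Fourier coefficient.\<close>

definition fcoef :: "int^'d \<Rightarrow> (real^'d \<Rightarrow> complex) \<Rightarrow> complex" where
  "fcoef k u = fprojs coords k u 0"

lemma fcoef_add:
  "continuous_on UNIV u \<Longrightarrow> continuous_on UNIV w \<Longrightarrow> fcoef k (\<lambda>\<theta>. u \<theta> + w \<theta>) = fcoef k u + fcoef k w"
  by (simp add: fcoef_def fprojs_add)

lemma fcoef_cmult: "fcoef k (\<lambda>\<theta>. c * u \<theta>) = c * fcoef k u"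
  by (simp add: fcoef_def fprojs_cmult)

lemma fcoef_diff:
  "continuous_on UNIV u \<Longrightarrow> continuous_on UNIV w \<Longrightarrow> fcoef k (\<lambda>\<theta>. u \<theta> - w \<theta>) = fcoef k u - fcoef k w"
  using fcoef_add[of u "\<lambda>\<theta>. (-1) * w \<theta>" k] fcoef_cmult[of k "-1" w]
  by (simp add: continuous_on_minus)

lemma fcoef_zero [simp]: "fcoef k (\<lambda>_. 0) = 0"
  using fcoef_cmult[of k 0 "\<lambda>_. 0"] by simp

lemma fcoef_sum:
  "(\<And>i. i \<in> S \<Longrightarrow> continuous_on UNIV (f i)) \<Longrightarrow> fcoef k (\<lambda>\<theta>. \<Sum>i\<in>S. f i \<theta>) = (\<Sum>i\<in>S. fcoef k (f i))"
  by (induction S rule: infinite_finite_induct) (auto simp: fcoef_add continuous_on_sum)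

lemma fcoef_norm_le:
  "continuous_on UNIV u \<Longrightarrow> (\<And>\<theta>. norm (u \<theta>) \<le> B) \<Longrightarrow> norm (fcoef k u) \<le> B"
  by (simp add: fcoef_def fprojs_norm_le)

lemma fcoef_chr: "fcoef k (chr l) = (if k = l then 1 else 0)"
  by (simp add: fcoef_def fprojs_chr set_coords vec_eq_iff)

text \<open>The full projection is an eigenfunction of all coordinate translations, hence determined
  by its value at 0, from which \<theta> is reached along the axes.\<close>

lemma fprojs_coords:
  assumes "continuous_on UNIV u" "periodic_map u"
  shows "fprojs coords k u \<theta> = chr k \<theta> * fcoef k u"
proof -
  have "fprojs coords k u (\<Sum>i\<in>S. (\<theta> $ i) *\<^sub>R axis i 1) = chr k (\<Sum>i\<in>S. (\<theta> $ i) *\<^sub>R axis i 1) * fcoef k u"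
    if "finite S" for S
    using that
  proof (induction S)
    case empty then show ?case by (simp add: fcoef_def)
  next
    case (insert i S)
    have "fprojs coords k u (\<Sum>i\<in>insert i S. (\<theta> $ i) *\<^sub>R axis i 1) = fprojs coords k u ((\<Sum>i\<in>S. (\<theta> $ i) *\<^sub>R axis i 1) + (\<theta> $ i) *\<^sub>R axis i 1)"
      using insert by (simp add: add.commute)
    also have "\<dots> = cis (2 * pi * of_int (k $ i) * \<theta> $ i) * (chr k (\<Sum>i\<in>S. (\<theta> $ i) *\<^sub>R axis i 1) * fcoef k u)"
      by (simp add: fprojs_eigen[OF assms] set_coords insert.IH)
    also have "cis (2 * pi * of_int (k $ i) * \<theta> $ i) = chr k ((\<theta> $ i) *\<^sub>R axis i 1)"
      by (simp add: chr_def idot_scaleR mult_ac)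
    finally show ?case using insert by (simp add: chr_add mult_ac)
  qed
  moreover have "(\<Sum>i\<in>UNIV. (\<theta> $ i) *\<^sub>R axis i 1) = \<theta>"
    by (simp add: vec_eq_iff axis_def if_distrib[of "\<lambda>x. _ * x"] cong: if_cong)
  ultimately show ?thesis using finite[of "UNIV :: 'a set"] by fastforce
qed

lemma fcoef_translate:
  assumes "continuous_on UNIV u" "periodic_map u"
  shows "fcoef k (\<lambda>\<theta>. u (\<theta> + w)) = chr k w * fcoef k u"
  using fprojs_coords[OF assms, of k w] by (simp add: fcoef_def fprojs_translate)

lemma fourier_sup_bound:
  fixes u :: "real^'d \<Rightarrow> complex"
  assumes "continuous_on UNIV u" "periodic_map u"
    and "\<And>k. norm (fcoef k u) \<le> A * (\<Prod>i\<in>UNIV. wt (k $ i))"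
  shows "norm (u \<theta>) \<le> 5 ^ CARD('d) * A"
  using fprojs_sup_bound[OF assms(1,2) distinct_coords, of \<theta> A] assms(3)
  by (simp add: set_coords fprojs_coords[OF assms(1,2)] norm_mult length_coords)

section \<open>Derivatives and decay of Fourier coefficients\<close>

lemma smooth_dir_deriv: 
  assumes "smooth u"
  shows "smooth (dir_deriv v u)"
proof -
  have e: "dir_deriv v u = (\<lambda>\<theta>. \<Sum>i\<in>UNIV. (v $ i) *\<^sub>R dir_deriv (axis i 1) u \<theta>)"
    using dir_deriv_axis_sum[OF smooth_differentiable[OF assms]] by blast
  show ?thesis unfolding e
    by (intro smooth_sum smooth_linear[OF bounded_linear_scaleR_right] smooth_dir_deriv_axis assms)
qed

lemma periodic_map_dir_deriv: "periodic_map u \<Longrightarrow> periodic_map (dir_deriv v u)"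
proof -
  assume "periodic_map u"
  then have "u (\<theta> + axis j 1 + x) = u (\<theta> + x)" for \<theta> j x
    unfolding periodic_map_def by (metis add.assoc add.commute)
  then show ?thesis by (simp add: periodic_map_def dir_deriv_def)
qed

text \<open>The remainder is uniform in \<theta>, so that difference quotients converge in the sup
  norm, in which \<open>fcoef\<close> is continuous by \<open>fcoef_norm_le\<close>.\<close>

lemma taylor2_along:
  fixes u :: "real^'d \<Rightarrow> 'a::real_normed_vector"
  assumes "smooth u" "periodic_map u"
  obtains L where "0 \<le> L" "\<And>\<theta> t. 0 \<le> t \<Longrightarrow> norm (u (\<theta> + t *\<^sub>R v) - u \<theta> - t *\<^sub>R dir_deriv v u \<theta>) \<le> L * t\<^sup>2"
proof -
  let ?g = "dir_deriv v u"
  have sg: "smooth ?g" by (rule smooth_dir_deriv[OF assms(1)])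
  obtain L where L: "\<And>\<theta>. norm (dir_deriv v ?g \<theta>) \<le> L"
    using periodic_bounded[OF periodic_map_dir_deriv[OF periodic_map_dir_deriv[OF assms(2)]]
        smooth_continuous_on[OF smooth_dir_deriv[OF sg]]] by blast
  have L0: "0 \<le> L" using L norm_ge_zero order_trans by blast
  have d: "((\<lambda>t. f (\<theta> + t *\<^sub>R v)) has_vector_derivative dir_deriv v f (\<theta> + s *\<^sub>R v)) (at s within S)" if "smooth f" for f :: "real^'d \<Rightarrow> 'a" and s \<theta> S
    using dir_deriv_along[OF smooth_differentiable[OF that]] has_vector_derivative_at_within by blast
  have lip: "norm (?g (\<theta> + s *\<^sub>R v) - ?g \<theta>) \<le> L * t" if "0 \<le> s" "s \<le> t" for \<theta> s t
  proof -
    have "norm (?g (\<theta> + s *\<^sub>R v) - ?g (\<theta> + 0 *\<^sub>R v)) \<le> L * norm (s - 0)"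
      by (rule differentiable_bound[of "{0..s}" "\<lambda>t. ?g (\<theta> + t *\<^sub>R v)" "\<lambda>x h. h *\<^sub>R dir_deriv v ?g (\<theta> + x *\<^sub>R v)"])
        (use that d[OF sg] L in \<open>auto simp: has_vector_derivative_def onorm_scaleR_left[OF bounded_linear_ident] onorm_id intro!: onorm_le\<close>)
    also have "\<dots> \<le> L * t" using that L0 by (simp add: mult_left_mono)
    finally show ?thesis by simp
  qed
  have "norm (u (\<theta> + t *\<^sub>R v) - u \<theta> - t *\<^sub>R ?g \<theta>) \<le> L * t\<^sup>2" if t: "0 \<le> t" for \<theta> t
  proof -
    have "norm (u (\<theta> + t *\<^sub>R v) - u (\<theta> + 0 *\<^sub>R v) - (t - 0) *\<^sub>R ?g (\<theta> + 0 *\<^sub>R v)) \<le> norm (t - 0) * (L * t)"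
      by (rule vector_differentiable_bound_linearization[of "{0..t}" "\<lambda>t. u (\<theta> + t *\<^sub>R v)" "\<lambda>x. ?g (\<theta> + x *\<^sub>R v)" 0 t 0])
        (use t d[OF assms(1)] lip in \<open>auto simp: closed_segment_eq_real_ivl\<close>)
    then show ?thesis using t by (simp add: power2_eq_square mult_ac)
  qed
  then show thesis using that L0 by blast
qed

text \<open>Translation by \<open>t *\<^sub>R v\<close> multiplies the coefficient by
  \<open>chr k (t *\<^sub>R v)\<close>. Comparing both sides to first order in t gives the formula
  for every direction v, not only along the axes.\<close>

lemma fcoef_dir_deriv:
  fixes u :: "real^'d \<Rightarrow> complex"
  assumes u: "smooth u" "periodic_map u"
  shows "fcoef k (dir_deriv v u) = 2 * pi * \<i> * idot k v * fcoef k u"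
proof -
  let ?g = "dir_deriv v u" and ?D = "2 * pi * \<i> * idot k v" and ?c = "fcoef k u"
  have cu: "continuous_on UNIV u" and cg: "continuous_on UNIV ?g"
    by (auto intro: smooth_continuous_on smooth_dir_deriv u)
  obtain L where L: "0 \<le> L" "\<And>\<theta> t. 0 \<le> t \<Longrightarrow> norm (u (\<theta> + t *\<^sub>R v) - u \<theta> - t *\<^sub>R ?g \<theta>) \<le> L * t\<^sup>2"
    using taylor2_along[OF u] by blast
  obtain L' where L': "0 \<le> L'" "\<And>\<theta> t. 0 \<le> t \<Longrightarrow> norm (chr k (\<theta> + t *\<^sub>R v) - chr k \<theta> - t *\<^sub>R dir_deriv v (chr k) \<theta>) \<le> L' * t\<^sup>2"
    using taylor2_along[OF smooth_chr periodic_map_chr] by blast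
  have main: "norm (fcoef k ?g - ?D * ?c) \<le> (L + L' * norm ?c) * t" if t: "0 < t" for t
  proof -
    have ct: "continuous_on UNIV (\<lambda>\<theta>. u (\<theta> + t *\<^sub>R v))"
      by (rule continuous_on_compose2[OF cu]) (auto intro!: continuous_intros)
    have "fcoef k (\<lambda>\<theta>. u (\<theta> + t *\<^sub>R v) - u \<theta> - of_real t * ?g \<theta>) = chr k (t *\<^sub>R v) * ?c - ?c - of_real t * fcoef k ?g"
      by (simp add: fcoef_diff fcoef_cmult fcoef_translate[OF cu u(2)] ct cu cg continuous_intros)
    moreover have "norm (fcoef k (\<lambda>\<theta>. u (\<theta> + t *\<^sub>R v) - u \<theta> - of_real t * ?g \<theta>)) \<le> L * t\<^sup>2"
      using L(2)[of t] t by (intro fcoef_norm_le continuous_intros ct cu cg) (simp add: scaleR_conv_of_real)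
    ultimately have 1: "norm (chr k (t *\<^sub>R v) * ?c - ?c - of_real t * fcoef k ?g) \<le> L * t\<^sup>2" by simp
    have "norm (chr k (t *\<^sub>R v) - 1 - of_real t * ?D) \<le> L' * t\<^sup>2"
      using L'(2)[of t 0] t by (simp add: dir_deriv_chr scaleR_conv_of_real)
    then have 2: "norm ((chr k (t *\<^sub>R v) - 1 - of_real t * ?D) * ?c) \<le> L' * t\<^sup>2 * norm ?c"
      unfolding norm_mult by (rule mult_right_mono) simp
    have e: "of_real t * (fcoef k ?g - ?D * ?c) = (chr k (t *\<^sub>R v) - 1 - of_real t * ?D) * ?c - (chr k (t *\<^sub>R v) * ?c - ?c - of_real t * fcoef k ?g)"
      by (simp add: algebra_simps)
    have "t * norm (fcoef k ?g - ?D * ?c) = norm (of_real t * (fcoef k ?g - ?D * ?c))"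
      using t by (simp add: norm_mult)
    also have "\<dots> \<le> L' * t\<^sup>2 * norm ?c + L * t\<^sup>2"
      unfolding e using 1 2 norm_triangle_ineq4 add_mono order_trans by meson
    also have "\<dots> = t * ((L + L' * norm ?c) * t)" by (simp add: power2_eq_square algebra_simps)
    finally show ?thesis using t by simp
  qed
  have "norm (fcoef k ?g - ?D * ?c) \<le> 0"
  proof (rule field_le_epsilon)
    fix e :: real assume e: "0 < e"
    define q where "q = L + L' * norm ?c + 1"
    have q: "q \<ge> 1" using L(1) L'(1) by (simp add: q_def)
    have "norm (fcoef k ?g - ?D * ?c) \<le> (q - 1) * (e / q)"
      using main[of "e / q"] e q by (simp add: q_def)
    also have "\<dots> \<le> q * (e / q)" using e q by (intro mult_right_mono) auto
    finally show "norm (fcoef k ?g - ?D * ?c) \<le> 0 + e" using q by simp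
  qed
  then show ?thesis by simp
qed

lemma fcoef_dpart:
  fixes u :: "real^'d \<Rightarrow> complex"
  assumes "smooth u" "periodic_map u"
  shows "fcoef k (dpart is u) = (\<Prod>i\<leftarrow>is. 2 * pi * \<i> * of_int (k $ i)) * fcoef k u"
proof (induction "is")
  case (Cons i "is")
  then show ?case
    by (simp add: fcoef_dir_deriv smooth_dpart periodic_map_dpart assms)
qed simp

text \<open>All r derivatives are taken in the single coordinate i; the resulting factor 2 pi per
  derivative is at least 1 and is dropped.\<close>

lemma fcoef_decay:
  fixes u :: "real^'d \<Rightarrow> complex"
  assumes "smooth u" "periodic_map u" "bounded_Cr r N u"
  shows "\<bar>of_int (k $ i)\<bar> ^ r * norm (fcoef k u) \<le> N"
proof -
  have "norm (fcoef k (dpart (replicate r i) u)) \<le> N"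
    using assms(3) by (intro fcoef_norm_le smooth_continuous_on smooth_dpart assms) (simp add: bounded_Cr_def)
  moreover have "norm (fcoef k (dpart (replicate r i) u)) = (2 * pi * \<bar>of_int (k $ i)\<bar>) ^ r * norm (fcoef k u)"
    unfolding fcoef_dpart[OF assms(1,2)]
    by (simp add: norm_mult norm_power prod_list_replicate abs_mult)
  moreover have "\<bar>of_int (k $ i)\<bar> ^ r \<le> (2 * pi * \<bar>of_int (k $ i)\<bar> :: real) ^ r"
    using pi_ge_two by (intro power_mono mult_right_mono[of 1 "2 * pi", simplified]) auto
  ultimately show ?thesis using mult_right_mono[OF _ norm_ge_zero[of "fcoef k u"]] order_trans by metis
qed

lemma prod_wt_ge:
  fixes k :: "int^'d" and K :: real
  assumes "\<And>i. \<bar>of_int (k $ i)\<bar> \<le> K" "1 \<le> K"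
  shows "1 / K ^ (2 * CARD('d)) \<le> (\<Prod>i\<in>UNIV. wt (k $ i))"
proof -
  have "1 / K\<^sup>2 \<le> wt (k $ i)" for i
    unfolding wt_def using assms(1)[of i] assms(2) by (intro divide_left_mono power_mono) auto
  then have "(\<Prod>i\<in>(UNIV::'d set). 1 / K\<^sup>2) \<le> (\<Prod>i\<in>UNIV. wt (k $ i))"
    by (intro prod_mono) auto
  then show ?thesis by (simp add: power_one_over power_mult)
qed

text \<open>Low frequencies are bounded by a. High ones use the r derivatives: 2 d of them pay for
  the weight, and the other r - 2 d give the power of K in the denominator.\<close>

lemma fcoef_wt_bound:
  fixes u :: "real^'d \<Rightarrow> complex" and K :: real
  assumes u: "smooth u" "periodic_map u" "bounded_Cr r N u" and r: "2 * CARD('d) \<le> r" and K: "1 \<le> K"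
    and a: "0 \<le> a" "(\<And>i. \<bar>of_int (k $ i)\<bar> \<le> K) \<Longrightarrow> norm (fcoef k u) \<le> a"
  shows "norm (fcoef k u) \<le> (a * K ^ (2 * CARD('d)) + N / K ^ (r - 2 * CARD('d))) * (\<Prod>i\<in>UNIV. wt (k $ i))"
proof -
  let ?d = "2 * CARD('d)" and ?w = "\<Prod>i\<in>UNIV. wt (k $ i)"
  have N: "0 \<le> N" using u(3) by (rule bounded_Cr_nonneg)
  have w: "0 \<le> ?w" by (intro prod_nonneg) (simp add: wt_pos less_imp_le)
  have K0: "0 < K" using K by simp
  show ?thesis
  proof (cases "\<forall>i. \<bar>of_int (k $ i)\<bar> \<le> K")
    case True
    then have "norm (fcoef k u) \<le> a * K ^ ?d * (1 / K ^ ?d)" using a(2) K0 by simp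
    also have "\<dots> \<le> a * K ^ ?d * ?w"
      using prod_wt_ge[of k K] True K a(1) by (intro mult_left_mono) auto
    also have "\<dots> \<le> (a * K ^ ?d + N / K ^ (r - ?d)) * ?w"
      using N K0 w by (intro mult_right_mono) auto
    finally show ?thesis .
  next
    case False
    \<comment> \<open>Decay is used in the coordinate whose frequency is largest in absolute value.
      Its size m exceeds K and dominates all other coordinates, so that \<open>prod_wt_ge\<close>
      applies with m as cutoff.\<close>
    define m where "m = Max (range (\<lambda>i. \<bar>k $ i\<bar>))"
    have "m \<in> range (\<lambda>i. \<bar>k $ i\<bar>)" unfolding m_def by (intro Max_in) auto
    then obtain i where i: "m = \<bar>k $ i\<bar>" by auto
    have le: "\<bar>k $ j\<bar> \<le> m" for j unfolding m_def by (intro Max_ge) auto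
    define x where "x = real_of_int m"
    obtain j where "K < \<bar>of_int (k $ j)\<bar>" using False by (auto simp: not_le)
    also have "\<dots> \<le> x" using le[of j] by (simp add: x_def flip: of_int_abs)
    finally have x: "K < x" .
    have "x ^ r * norm (fcoef k u) \<le> N"
      using fcoef_decay[OF u, of k i] by (simp add: x_def i)
    then have "norm (fcoef k u) \<le> N / x ^ r"
      using x K0 by (simp add: field_simps)
    also have "x ^ r = x ^ (r - ?d) * x ^ ?d" using r by (simp flip: power_add)
    also have "N / (x ^ (r - ?d) * x ^ ?d) = N / x ^ (r - ?d) * (1 / x ^ ?d)" by simp
    also have "\<dots> \<le> N / K ^ (r - ?d) * ?w"
    proof (rule mult_mono)
      show "N / x ^ (r - ?d) \<le> N / K ^ (r - ?d)"
        using N x K0 by (intro divide_left_mono power_mono mult_pos_pos) auto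
      show "1 / x ^ ?d \<le> ?w"
        using le x K by (intro prod_wt_ge) (auto simp: x_def simp flip: of_int_abs)
    qed (use N K0 x in auto)
    also have "\<dots> \<le> (a * K ^ ?d + N / K ^ (r - ?d)) * ?w"
      using a(1) K0 w by (intro mult_right_mono) auto
    finally show ?thesis .
  qed
qed

text \<open>A map whose Fourier coefficients of order at most \<open>K\<close> are small, with at most one exception,
  is close to the exceptional mode.\<close>

lemma fourier_remainder_bound:
  fixes u :: "real^'d \<Rightarrow> complex" and K :: real
  assumes u: "smooth u" "periodic_map u" "bounded_Cr r N u" and r: "2 * CARD('d) \<le> r" and K: "1 \<le> K"
    and a: "0 \<le> a" "\<And>k. (\<And>i. \<bar>of_int (k $ i)\<bar> \<le> K) \<Longrightarrow> \<not> (P \<and> k = k0) \<Longrightarrow> norm (fcoef k u) \<le> a"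
  shows "norm (u \<theta> - (if P then fcoef k0 u else 0) * chr k0 \<theta>)
    \<le> 5 ^ CARD('d) * (a * K ^ (2 * CARD('d)) + N / K ^ (r - 2 * CARD('d)))"
proof (rule fourier_sup_bound)
  let ?c = "if P then fcoef k0 u else 0"
  let ?A = "a * K ^ (2 * CARD('d)) + N / K ^ (r - 2 * CARD('d))"
  have cu: "continuous_on UNIV u" and cc: "continuous_on UNIV (chr k0)"
    using u(1) smooth_chr by (auto intro: smooth_continuous_on)
  show "continuous_on UNIV (\<lambda>\<theta>. u \<theta> - ?c * chr k0 \<theta>)"
    by (intro continuous_intros cu cc)
  show "periodic_map (\<lambda>\<theta>. u \<theta> - ?c * chr k0 \<theta>)"
    using u(2) periodic_map_chr[of k0] by (simp add: periodic_map_def)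
  fix k
  have e: "fcoef k (\<lambda>\<theta>. u \<theta> - ?c * chr k0 \<theta>) = fcoef k u - ?c * (if k = k0 then 1 else 0)"
    using fcoef_diff[of u "\<lambda>\<theta>. ?c * chr k0 \<theta>" k] cu continuous_on_mult[OF continuous_on_const cc]
    by (simp add: fcoef_cmult fcoef_chr)
  show "norm (fcoef k (\<lambda>\<theta>. u \<theta> - ?c * chr k0 \<theta>)) \<le> ?A * (\<Prod>i\<in>UNIV. wt (k $ i))"
  proof (cases "P \<and> k = k0")
    case True
    have "0 \<le> ?A * (\<Prod>i\<in>UNIV. wt (k $ i))"
      using a(1) K bounded_Cr_nonneg[OF u(3)]
      by (intro mult_nonneg_nonneg add_nonneg_nonneg prod_nonneg) (auto simp: wt_pos less_imp_le)
    with True show ?thesis unfolding e by simp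
  next
    case False
    then have "fcoef k (\<lambda>\<theta>. u \<theta> - ?c * chr k0 \<theta>) = fcoef k u" unfolding e by auto
    then show ?thesis
      using fcoef_wt_bound[OF u r K a(1), of k] a(2)[of k] False by auto
  qed
qed

section \<open>Removing resonances\<close>

text \<open>Pigeonhole: if each of the first \<open>(card X)\<^sup>2 + 1\<close> inclusions were
  strict, the last set would have more elements than \<open>X \<times> X\<close>.\<close>

lemma stable_scale:
  fixes E :: "nat \<Rightarrow> ('x \<times> 'x) set"
  assumes "finite X" "\<And>s. E s \<subseteq> X \<times> X" "\<And>s. E s \<subseteq> E (Suc s)"
  obtains s where "s \<le> (card X)\<^sup>2" "E (Suc s) = E s"
proof (rule ccontr)
  assume "\<not> thesis"
  then have c: "E (Suc s) \<noteq> E s" if "s \<le> (card X)\<^sup>2" for s using that \<open>\<And>s. s \<le> (card X)\<^sup>2 \<Longrightarrow> E (Suc s) = E s \<Longrightarrow> thesis\<close> by blast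
  have fin: "finite (E s)" for s using assms(1,2) finite_SigmaI finite_subset by meson
  have "s \<le> card (E s)" if "s \<le> Suc ((card X)\<^sup>2)" for s
    using that
  proof (induction s)
    case (Suc s)
    then have "E (Suc s) \<noteq> E s" using c[of s] by simp
    then have "E s \<subset> E (Suc s)" using assms(3)[of s] by auto
    then have "card (E s) < card (E (Suc s))" using fin by (simp add: psubset_card_mono)
    with Suc show ?case by simp
  qed simp
  from this[of "Suc ((card X)\<^sup>2)"] have "Suc ((card X)\<^sup>2) \<le> card (E (Suc ((card X)\<^sup>2)))" by simp
  also have "\<dots> \<le> card (X \<times> X)" using assms(1,2) by (intro card_mono) auto
  finally show False by (simp add: power2_eq_square card_cartesian_product)
qed

text \<open>The finite-scale content of the Diophantine condition, and the form in which the
  resonance argument uses it: a frequency within the cutoff K whose divisor is at most \<eta> must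
  be 0.\<close>

definition sep :: "real^'d \<Rightarrow> real \<Rightarrow> real \<Rightarrow> bool" where
  "sep \<omega> K \<eta> \<longleftrightarrow> (\<forall>k::int^'d. (\<forall>i. \<bar>real_of_int (k $ i)\<bar> \<le> K) \<longrightarrow> k \<noteq> 0 \<longrightarrow> \<eta> < \<bar>2 * pi * idot k \<omega>\<bar>)"

text \<open>If \<open>b\<close> takes finitely many values, then on a suitable scale ``differing by a small frequency
  up to a small error'' is an equivalence relation, because the relation cannot grow with the
  scale more than \<open>card X\<^sup>2\<close> times.\<close>

lemma resonance_potential:
  fixes b :: "'x \<Rightarrow> real" and \<omega> :: "real^'d"
  assumes fin: "finite (UNIV :: 'x set)" and K: "0 \<le> K" and \<eta>: "0 \<le> \<eta>" 
    and sep: "sep \<omega> (3 * (2 ^ CARD('x)\<^sup>2 * K)) (3 * (2 ^ CARD('x)\<^sup>2 * \<eta>))"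
  obtains \<mu> :: "'x \<Rightarrow> int^'d" where
    "\<And>x i. \<bar>real_of_int (\<mu> x $ i)\<bar> \<le> 2 ^ CARD('x)\<^sup>2 * K"
    "\<And>x y m. (\<And>i. \<bar>real_of_int (m $ i)\<bar> \<le> K) \<Longrightarrow> \<bar>b y - b x - 2 * pi * idot m \<omega>\<bar> \<le> \<eta> \<Longrightarrow> \<mu> y = \<mu> x + m"
proof -
  \<comment> \<open>Level s allows frequencies and errors up to 2^s times the original ones, so
    composing two relations of level s gives one of level s + 1. Once the relation stops growing it
    is therefore transitive at its own level.\<close>
  define R where "R = (\<lambda>s x y m. (\<forall>i. \<bar>real_of_int (m $ i)\<bar> \<le> 2 ^ s * K) \<and> \<bar>b y - b x - 2 * pi * idot m \<omega>\<bar> \<le> 2 ^ s * \<eta>)"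
  define E where "E = (\<lambda>s. {(x, y). \<exists>m. R s x y m})"
  have R_mono: "R s' x y m" if "R s x y m" "s \<le> s'" for s s' x y m
  proof -
    have "(2::real) ^ s \<le> 2 ^ s'" using that(2) by (intro power_increasing) auto
    then have "2 ^ s * K \<le> 2 ^ s' * K" "2 ^ s * \<eta> \<le> 2 ^ s' * \<eta>" using K \<eta> by (auto intro: mult_right_mono)
    then show ?thesis using that(1) unfolding R_def by (meson order_trans)
  qed
  have R_refl: "R s x x 0" for s x using K \<eta> by (simp add: R_def)
  have R_sym: "R s y x (- m)" if "R s x y m" for s x y m
  proof -
    have "b x - b y - 2 * pi * idot (- m) \<omega> = - (b y - b x - 2 * pi * idot m \<omega>)"
      by (simp add: idot_minus_left)
    then show ?thesis using that unfolding R_def by (simp only: abs_minus_cancel) simp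
  qed
  have R_trans: "R (Suc s) x z (m + n)" if "R s x y m" "R s y z n" for s x y z m n
  proof -
    have "\<bar>real_of_int ((m + n) $ i)\<bar> \<le> 2 ^ Suc s * K" for i
    proof -
      have "\<bar>real_of_int (m $ i)\<bar> \<le> 2 ^ s * K" "\<bar>real_of_int (n $ i)\<bar> \<le> 2 ^ s * K"
        using that unfolding R_def by auto
      then show ?thesis by (simp add: abs_le_iff)
    qed
    moreover have "b z - b x - 2 * pi * idot (m + n) \<omega> = (b y - b x - 2 * pi * idot m \<omega>) + (b z - b y - 2 * pi * idot n \<omega>)"
      by (simp add: idot_add_left algebra_simps)
    then have "\<bar>b z - b x - 2 * pi * idot (m + n) \<omega>\<bar> \<le> 2 ^ Suc s * \<eta>"
      using that unfolding R_def by (simp add: abs_le_iff)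
    ultimately show ?thesis by (simp add: R_def)
  qed
  obtain s where s: "s \<le> CARD('x)\<^sup>2" "E (Suc s) = E s"
  proof (rule stable_scale[of UNIV E])
    show "E s \<subseteq> E (Suc s)" for s using R_mono[of s _ _ _ "Suc s"] by (auto simp: E_def)
  qed (use fin in auto)
  have trans: "(x, z) \<in> E s" if "(x, y) \<in> E s" "(y, z) \<in> E s" for x y z
    using that R_trans s(2) by (fastforce simp: E_def)
  have sym: "(y, x) \<in> E s" if "(x, y) \<in> E s" for x y using that R_sym by (fastforce simp: E_def)
  have refl: "(x, x) \<in> E s" for x using R_refl by (auto simp: E_def)
  define rep where "rep = (\<lambda>x. SOME y. (y, x) \<in> E s)"
  have rep: "(rep x, x) \<in> E s" for x unfolding rep_def using refl by (rule someI)
  have rep_eq: "rep x = rep y" if "(x, y) \<in> E s" for x y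
  proof -
    have "(\<lambda>z. (z, x) \<in> E s) = (\<lambda>z. (z, y) \<in> E s)" using that trans sym by blast
    then show ?thesis by (simp add: rep_def)
  qed
  \<comment> \<open>Each x receives a frequency that links it to the representative of its
    class.\<close>
  obtain \<mu> where \<mu>: "\<And>x. R s (rep x) x (\<mu> x)" using rep unfolding E_def by (auto; metis)
  have le: "2 ^ s * K \<le> 2 ^ CARD('x)\<^sup>2 * K" "2 ^ s * \<eta> \<le> 2 ^ CARD('x)\<^sup>2 * \<eta>"
    using s(1) K \<eta> by (auto intro!: mult_right_mono power_increasing)
  show thesis
  proof
    show "\<bar>real_of_int (\<mu> x $ i)\<bar> \<le> 2 ^ CARD('x)\<^sup>2 * K" for x i
      using \<mu>[of x] le(1) unfolding R_def by (meson order_trans)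
    fix x y m assume m: "\<And>i. \<bar>real_of_int (m $ i)\<bar> \<le> K" "\<bar>b y - b x - 2 * pi * idot m \<omega>\<bar> \<le> \<eta>"
    then have "R 0 x y m" by (simp add: R_def)
    then have r: "R s x y m" using R_mono by blast
    then have e: "rep x = rep y" by (intro rep_eq) (auto simp: E_def)
    \<comment> \<open>Going from the common representative to x, along m to y and back closes a loop
      of three relations of level s. Its divisor is at most three times the error of one relation,
      so \<open>sep\<close> forces the total frequency to be 0.\<close>
    let ?n = "\<mu> x + m - \<mu> y"
    have "\<bar>real_of_int (?n $ i)\<bar> \<le> 3 * (2 ^ CARD('x)\<^sup>2 * K)" for i
    proof -
      have "\<bar>real_of_int (\<mu> x $ i)\<bar> \<le> 2 ^ s * K" "\<bar>real_of_int (\<mu> y $ i)\<bar> \<le> 2 ^ s * K" "\<bar>real_of_int (m $ i)\<bar> \<le> 2 ^ s * K"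
        using \<mu> r unfolding R_def by auto
      then show ?thesis using le(1) by (simp add: abs_le_iff)
    qed
    moreover have "\<bar>2 * pi * idot ?n \<omega>\<bar> \<le> 3 * (2 ^ CARD('x)\<^sup>2 * \<eta>)"
    proof -
      have "2 * pi * idot ?n \<omega> = (b y - b (rep y) - 2 * pi * idot (\<mu> y) \<omega>) - (b x - b (rep x) - 2 * pi * idot (\<mu> x) \<omega>) - (b y - b x - 2 * pi * idot m \<omega>)"
        by (simp add: e idot_add_left idot_diff_left algebra_simps)
      moreover have "\<bar>b y - b (rep y) - 2 * pi * idot (\<mu> y) \<omega>\<bar> \<le> 2 ^ s * \<eta>"
        "\<bar>b x - b (rep x) - 2 * pi * idot (\<mu> x) \<omega>\<bar> \<le> 2 ^ s * \<eta>" "\<bar>b y - b x - 2 * pi * idot m \<omega>\<bar> \<le> 2 ^ s * \<eta>"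
        using \<mu> r unfolding R_def by auto
      ultimately show ?thesis using le(2) by linarith
    qed
    ultimately have "?n = 0" using sep unfolding sep_def by (meson not_le)
    then show "\<mu> y = \<mu> x + m" by simp
  qed
qed

text \<open>The potential on signed indices turns the resonance condition into an antisymmetric shift
  \<open>k i = \<mu> (i, +) - \<mu> (i, -)\<close>, whose parity is automatically the right one.\<close>

lemma resonance_shift:
  fixes \<beta> :: "'n::finite \<Rightarrow> real" and \<omega> :: "real^'d"
  defines "c \<equiv> 2 ^ CARD('n \<times> bool)\<^sup>2"
  assumes K: "0 \<le> K" and \<eta>: "0 \<le> \<eta>" and sep: "sep \<omega> (3 * (c * K)) (3 * (c * \<eta>))"
  obtains \<kappa> :: "'n \<Rightarrow> int^'d" where
    "\<And>i l. \<bar>real_of_int (\<kappa> i $ l)\<bar> \<le> 2 * (c * K)"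
    "\<And>i j. \<bar>\<beta> i - \<beta> j\<bar> \<le> \<eta> \<Longrightarrow> \<kappa> i = \<kappa> j"
    "\<And>i j k. (\<And>l. \<bar>real_of_int (k $ l)\<bar> \<le> K) \<Longrightarrow> \<bar>\<beta> i + \<beta> j + 2 * pi * idot k \<omega>\<bar> \<le> \<eta> \<Longrightarrow> k + k + \<kappa> i + \<kappa> j = 0"
proof -
  \<comment> \<open>With signed values, a resonance of \<open>\<beta> i + \<beta> j\<close> with k
    becomes a difference: k leads from (i, True) to (j, False).\<close>
  define b where "b = (\<lambda>(i, p). if p then \<beta> i else - \<beta> i)"
  obtain \<mu> where \<mu>1: "\<And>x l. \<bar>real_of_int (\<mu> x $ l)\<bar> \<le> c * K"
    and \<mu>2: "\<And>x y m. (\<And>l. \<bar>real_of_int (m $ l)\<bar> \<le> K) \<Longrightarrow> \<bar>b y - b x - 2 * pi * idot m \<omega>\<bar> \<le> \<eta> \<Longrightarrow> \<mu> y = \<mu> x + m"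
    using resonance_potential[OF finite K \<eta> sep[unfolded c_def], of b] unfolding c_def by metis
  show thesis
  proof
    fix i j l
    show "\<bar>real_of_int ((\<mu> (i, True) - \<mu> (i, False)) $ l)\<bar> \<le> 2 * (c * K)"
      using \<mu>1[of "(i, True)" l] \<mu>1[of "(i, False)" l] by (simp add: abs_le_iff)
    show "\<mu> (i, True) - \<mu> (i, False) = \<mu> (j, True) - \<mu> (j, False)" if "\<bar>\<beta> i - \<beta> j\<bar> \<le> \<eta>"
      using \<mu>2[of 0 "(j, True)" "(i, True)"] \<mu>2[of 0 "(j, False)" "(i, False)"] that K
      by (simp add: b_def abs_minus_commute)
    fix k :: "int^'d" assume k: "\<And>l. \<bar>real_of_int (k $ l)\<bar> \<le> K" "\<bar>\<beta> i + \<beta> j + 2 * pi * idot k \<omega>\<bar> \<le> \<eta>"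
    have "\<mu> (j, False) = \<mu> (i, True) + k"
      using k by (intro \<mu>2) (auto simp: b_def abs_le_iff)
    \<comment> \<open>By symmetry of the resonance the same k also leads from (j, True) to (i,
      False). Adding both relations makes k appear twice, which is the parity needed on the doubled
      torus.\<close>
    moreover have "\<mu> (i, False) = \<mu> (j, True) + k"
      using k by (intro \<mu>2) (auto simp: b_def abs_le_iff)
    ultimately show "k + k + (\<mu> (i, True) - \<mu> (i, False)) + (\<mu> (j, True) - \<mu> (j, False)) = 0"
      by simp
  qed
qed

lemma diophantine_sep:
  fixes \<omega> :: "real^'d"
  assumes dio: "diophantine \<kappa> \<tau> \<omega>" and \<kappa>: "0 < \<kappa>" and \<tau>: "0 \<le> \<tau>"
    and \<eta>: "\<eta> < 2 * pi * \<kappa> * (real CARD('d) * K) powr (- \<tau>)"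
  shows "sep \<omega> K \<eta>"
  unfolding sep_def
proof (intro allI impI)
  fix k :: "int^'d" assume k: "\<forall>i. \<bar>real_of_int (k $ i)\<bar> \<le> K" "k \<noteq> 0"
  let ?s = "real_of_int (\<Sum>i\<in>UNIV. \<bar>k $ i\<bar>)"
  obtain i where i: "k $ i \<noteq> 0" using k(2) by (auto simp: vec_eq_iff)
  have "\<bar>k $ i\<bar> \<le> (\<Sum>i\<in>UNIV. \<bar>k $ i\<bar>)" by (rule member_le_sum) auto
  then have s: "0 < ?s" using i by linarith
  have "?s = (\<Sum>i\<in>UNIV. \<bar>real_of_int (k $ i)\<bar>)" by simp
  also have "\<dots> \<le> (\<Sum>i\<in>(UNIV::'d set). K)" using k(1) by (intro sum_mono) auto
  finally have "?s \<le> real CARD('d) * K" by simp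
  then have "(real CARD('d) * K) powr (- \<tau>) \<le> ?s powr (- \<tau>)"
    using s \<tau> by (intro powr_mono2') auto
  then have "\<kappa> * (real CARD('d) * K) powr (- \<tau>) \<le> \<kappa> * ?s powr (- \<tau>)" using \<kappa> by simp
  also have "\<dots> \<le> \<bar>idot k \<omega>\<bar>" using dio k(2) unfolding diophantine_def idot_def by blast
  finally have "2 * pi * (\<kappa> * (real CARD('d) * K) powr (- \<tau>)) \<le> 2 * pi * \<bar>idot k \<omega>\<bar>" by simp
  then have "\<eta> < 2 * pi * \<bar>idot k \<omega>\<bar>" using \<eta> by (simp only: mult.assoc)
  then show "\<eta> < \<bar>2 * pi * idot k \<omega>\<bar>" by (simp add: abs_mult)
qed

section \<open>Linear algebra\<close>

subsection \<open>Triangularization with bounded change of basis\<close>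

text \<open>The vector p(L) x. L is a bare function because it will be the compression of a matrix
  to a block of coordinates, considered inside the full space so that the type stays fixed.\<close>

definition poly_act :: "(complex^'n \<Rightarrow> complex^'n) \<Rightarrow> complex poly \<Rightarrow> complex^'n \<Rightarrow> complex^'n" where
  "poly_act L p x = (\<Sum>m\<le>degree p. coeff p m *s (L ^^ m) x)"

lemma poly_act_extend:
  assumes "degree p \<le> N"
  shows "poly_act L p x = (\<Sum>m\<le>N. coeff p m *s (L ^^ m) x)"
  unfolding poly_act_def using assms
  by (intro sum.mono_neutral_left) (auto simp: coeff_eq_0)

lemma poly_act_linear_factor:
  assumes L: "\<And>x y. L (x + y) = L x + L y" "\<And>c x. L (c *s x) = c *s L x"
  shows "poly_act L ([:- z, 1:] * q) x = poly_act L q (L x - z *s x)"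
proof -
  let ?N = "degree q"
  have Lm: "(L ^^ m) (L x - z *s x) = (L ^^ Suc m) x - z *s (L ^^ m) x" for m
  proof (induction m)
    case (Suc m)
    have "L (y - z *s w) = L y - z *s L w" for y w
      using L(1)[of y "(- z) *s w"] L(2)[of "- z" w] by simp
    with Suc show ?case by simp
  qed simp
  have "degree ([:- z, 1:] * q) \<le> Suc ?N"
    using degree_mult_le[of "[:- z, 1:]" q] by simp
  then have "poly_act L ([:- z, 1:] * q) x = (\<Sum>m\<le>Suc ?N. coeff ([:- z, 1:] * q) m *s (L ^^ m) x)"
    by (rule poly_act_extend)
  also have "\<dots> = (\<Sum>m\<le>Suc ?N. coeff (pCons 0 q) m *s (L ^^ m) x) - (\<Sum>m\<le>Suc ?N. (z * coeff q m) *s (L ^^ m) x)"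
    unfolding sum_subtractf[symmetric]
    by (intro sum.cong refl) (simp add: vec_eq_iff algebra_simps)
  also have "(\<Sum>m\<le>Suc ?N. coeff (pCons 0 q) m *s (L ^^ m) x) = (\<Sum>m\<le>?N. coeff q m *s (L ^^ Suc m) x)"
    by (subst sum.atMost_Suc_shift) (simp add: vec_eq_iff)
  also have "(\<Sum>m\<le>Suc ?N. (z * coeff q m) *s (L ^^ m) x) = (\<Sum>m\<le>?N. (z * coeff q m) *s (L ^^ m) x)"
    by (simp add: coeff_eq_0 vec_eq_iff)
  also have "(\<Sum>m\<le>?N. coeff q m *s (L ^^ Suc m) x) - (\<Sum>m\<le>?N. (z * coeff q m) *s (L ^^ m) x) = poly_act L q (L x - z *s x)"
    unfolding poly_act_def Lm sum_subtractf[symmetric]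
    by (intro sum.cong refl) (simp add: vec_eq_iff algebra_simps)
  finally show ?thesis .
qed

text \<open>A root z of p splits off a linear factor. Either \<open>L x - z *s x\<close> is 0 and x
  is an eigenvector, or it is a nonzero vector of V annihilated by the quotient, which has lower
  degree.\<close>

lemma eigenvector_of_annihilator:
  assumes L: "\<And>x y. L (x + y) = L x + L y" "\<And>c x. L (c *s x) = c *s L x"
    and inv: "\<And>x. x \<in> V \<Longrightarrow> L x \<in> V" "\<And>x y c. x \<in> V \<Longrightarrow> y \<in> V \<Longrightarrow> x - c *s y \<in> V"
  shows "p \<noteq> 0 \<Longrightarrow> x \<noteq> 0 \<Longrightarrow> x \<in> V \<Longrightarrow> poly_act L p x = 0 \<Longrightarrow> \<exists>v z. v \<noteq> 0 \<and> v \<in> V \<and> L v = z *s v"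
proof (induction "degree p" arbitrary: p x)
  case 0
  then have "coeff p 0 *s x = 0" by (simp add: poly_act_def)
  moreover have "coeff p 0 \<noteq> 0" using 0 by (metis leading_coeff_0_iff)
  ultimately show ?case using 0 by (simp add: vec_eq_iff)
next
  case (Suc N)
  have "\<not> constant (poly p)" using Suc(2) by (simp add: constant_degree)
  then obtain z where "poly p z = 0" using fundamental_theorem_of_algebra by blast
  then obtain q where q: "p = [:- z, 1:] * q" by (auto simp: poly_eq_0_iff_dvd)
  with Suc.prems have q0: "q \<noteq> 0" by auto
  then have deg: "N = degree q" using Suc(2) unfolding q by (subst (asm) degree_mult_eq) auto
  let ?w = "L x - z *s x"
  have "poly_act L q ?w = 0" using Suc.prems(4) unfolding q poly_act_linear_factor[OF L] .
  show ?case
  proof (cases "?w = 0")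
    case True
    then show ?thesis using Suc.prems by auto
  next
    case False
    then show ?thesis
      using Suc(1)[OF deg q0 False] inv Suc.prems(3) \<open>poly_act L q ?w = 0\<close> by blast
  qed
qed

text \<open>One iterate more than the real dimension forces a linear relation. If two iterates
  coincide, their set is too small for the dimension count, and a difference of monomials
  annihilates x directly.\<close>

lemma annihilator_exists: "\<exists>p. p \<noteq> 0 \<and> poly_act L p (x :: complex^'n) = 0"
proof (cases "inj_on (\<lambda>m. (L ^^ m) x) {..DIM(complex^'n)}")
  case False
  then obtain a b where ab: "a < b" "(L ^^ a) x = (L ^^ b) x"
    unfolding inj_on_def by (metis linorder_neqE_nat)
  let ?p = "monom 1 b - monom 1 a :: complex poly"
  have "coeff ?p b = 1" using ab by simp
  then have "?p \<noteq> 0" by (metis coeff_0 zero_neq_one)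
  moreover have "poly_act L ?p x = 0"
  proof -
    have "degree ?p \<le> b" using ab by (intro degree_diff_le) (auto simp: degree_monom_eq)
    then have "poly_act L ?p x = (\<Sum>m\<le>b. coeff ?p m *s (L ^^ m) x)" by (rule poly_act_extend)
    also have "\<dots> = (\<Sum>m\<le>b. (if m = b then (L ^^ b) x else 0) - (if m = a then (L ^^ a) x else 0))"
      using ab by (intro sum.cong) auto
    also have "\<dots> = 0" using ab by (simp add: sum_subtractf)
    finally show ?thesis .
  qed
  ultimately show ?thesis by blast
next
  case True
  let ?N = "DIM(complex^'n)" and ?y = "\<lambda>m. (L ^^ m) x"
  have "card (?y ` {..?N}) > ?N" using True by (simp add: card_image)
  then have "dependent (?y ` {..?N})" by (intro dependent_biggerset) auto
  then obtain u where u: "\<exists>v\<in>?y ` {..?N}. u v \<noteq> 0" "(\<Sum>v\<in>?y ` {..?N}. u v *\<^sub>R v) = 0"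
    using dependent_finite[of "?y ` {..?N}"] by auto
  then obtain k where k: "k \<le> ?N" "u (?y k) \<noteq> 0" by auto
  let ?p = "\<Sum>m\<le>?N. monom (complex_of_real (u (?y m))) m"
  have c: "coeff ?p m = of_real (u (?y m))" if "m \<le> ?N" for m
    using that by (simp add: coeff_sum)
  have "degree ?p \<le> ?N"
    by (intro degree_sum_le) (auto intro: order_trans[OF degree_monom_le])
  then have "poly_act L ?p x = (\<Sum>m\<le>?N. coeff ?p m *s ?y m)" by (rule poly_act_extend)
  also have "\<dots> = (\<Sum>m\<le>?N. u (?y m) *\<^sub>R ?y m)"
    by (intro sum.cong refl, subst c) (auto simp: vec_eq_iff scaleR_conv_of_real[where 'a=complex])
  also have "\<dots> = 0" using u(2) True by (simp add: sum.reindex)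
  finally have "poly_act L ?p x = 0" .
  moreover have "?p \<noteq> 0" using c[OF k(1)] k(2) by (metis coeff_0 of_real_eq_0_iff)
  ultimately show ?thesis by blast
qed

text \<open>The eigenvector belongs to the compression of T to the coordinates in S. When the other
  coordinates span an invariant subspace, this compression is the map induced on the
  quotient.\<close>

lemma block_eigenvector:
  fixes T :: "complex^'n^'n"
  assumes "S \<noteq> {}"
  obtains v z where "v \<noteq> 0" "\<And>i. i \<notin> S \<Longrightarrow> v $ i = 0" "\<And>i. i \<in> S \<Longrightarrow> (T *v v) $ i = z * v $ i"
proof -
  define L where "L = (\<lambda>x. \<chi> i. if i \<in> S then (T *v x) $ i else 0)"
  define V where "V = {x :: complex^'n. \<forall>i. i \<notin> S \<longrightarrow> x $ i = 0}"
  obtain s where s: "s \<in> S" using assms by blast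
  have lin: "L (x + y) = L x + L y" "L (c *s x) = c *s L x" for x y c
    by (simp_all add: L_def vec_eq_iff matrix_vector_mult_def algebra_simps sum.distrib sum_distrib_left)
  have 1: "(axis s 1 :: complex^'n) \<noteq> 0" by (simp add: axis_eq_0_iff)
  have 2: "(axis s 1 :: complex^'n) \<in> V" using s by (auto simp: V_def axis_def)
  obtain p where "p \<noteq> 0" "poly_act L p (axis s 1) = 0" using annihilator_exists by blast
  from eigenvector_of_annihilator[where V=V, OF lin _ _ this(1) 1 2 this(2)]
  obtain v z where "v \<noteq> 0" "v \<in> V" "L v = z *s v" by (auto simp: V_def L_def)
  moreover have "(T *v v) $ i = z * v $ i" if "i \<in> S" for i
    using \<open>L v = z *s v\<close> that by (auto simp: L_def vec_eq_iff dest!: spec[of _ i])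
  ultimately show thesis using that[of v z] by (simp add: V_def)
qed

lemma matrix_entry_mult: "(A ** B) $ i $ j = (\<Sum>l\<in>UNIV. A $ i $ l * B $ l $ j)"
  by (simp add: matrix_matrix_mult_def)

lemma mat_nth: "mat c $ i $ j = (if i = j then c else 0)"
  by (simp add: mat_def)

text \<open>The coordinates in U span a subspace invariant under T, on which T is triangular for the
  order f. An eigenvector of the quotient, scaled to be 1 at its largest entry p, replaces the basis
  vector at p. The entries of the change of basis and of its inverse then have modulus at most 1,
  which gives a norm bound independent of T.\<close>

lemma triangularization_step:
  fixes T :: "complex^'n^'n"
  assumes U: "U \<noteq> UNIV" "f ` U \<subseteq> {..<card U}" "inj_on f U"
    and tri: "\<And>i j. j \<in> U \<Longrightarrow> T $ i $ j \<noteq> 0 \<Longrightarrow> i \<in> U \<and> f i \<le> f j"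
  obtains p g E E' where "p \<notin> U" "g ` insert p U \<subseteq> {..<card (insert p U)}" "inj_on g (insert p U)"
    "E ** E' = mat 1" "E' ** E = mat 1" "norm E \<le> CARD('n)\<^sup>2" "norm E' \<le> CARD('n)\<^sup>2"
    "\<And>i j. j \<in> insert p U \<Longrightarrow> (E' ** T ** E) $ i $ j \<noteq> 0 \<Longrightarrow> i \<in> insert p U \<and> g i \<le> g j"
proof -
  have "- U \<noteq> {}" using U by auto
  then obtain w z where w: "w \<noteq> 0" "\<And>i. i \<in> U \<Longrightarrow> w $ i = 0" "\<And>i. i \<notin> U \<Longrightarrow> (T *v w) $ i = z * w $ i"
    using block_eigenvector[of "- U" T] by (metis ComplI ComplD)
  have "Max (range (\<lambda>i. norm (w $ i))) \<in> range (\<lambda>i. norm (w $ i))" by (intro Max_in) auto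
  then obtain p where p: "Max (range (\<lambda>i. norm (w $ i))) = norm (w $ p)" by (rule rangeE)
  have pmax: "norm (w $ i) \<le> norm (w $ p)" for i unfolding p[symmetric] by (intro Max_ge) auto
  have wp: "w $ p \<noteq> 0"
  proof
    assume "w $ p = 0"
    then have "w = 0" using pmax by (simp add: vec_eq_iff)
    with w(1) show False ..
  qed
  have pU: "p \<notin> U" using wp w(2) by auto
  define v where "v = (\<chi> i. w $ i / w $ p)"
  have vp: "v $ p = 1" using wp by (simp add: v_def)
  have v1: "norm (v $ i) \<le> 1" for i using pmax[of i] wp by (simp add: v_def norm_divide divide_le_eq_1)
  have vU: "v $ i = 0" if "i \<in> U" for i using w(2)[OF that] by (simp add: v_def)
  have Tv: "(\<Sum>l\<in>UNIV. T $ i $ l * v $ l) = z * v $ i" if "i \<notin> U" for i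
    using w(3)[OF that] by (simp add: v_def matrix_vector_mult_def sum_divide_distrib[symmetric])
  define E where "E = (\<chi> i j. if j = p then v $ i else if i = j then 1 else 0)"
  define E' where "E' = (\<chi> i j. if j = p then (if i = p then 1 else - v $ i) else if i = j then 1 else 0)"
  have AE: "(A ** E) $ i $ j = (if j = p then (\<Sum>l\<in>UNIV. A $ i $ l * v $ l) else A $ i $ j)" for A i j
    by (simp add: matrix_entry_mult E_def if_distrib[of "\<lambda>x. _ * x"] cong: if_cong)
  have EA: "(E' ** A) $ i $ j = (if i = p then A $ p $ j else A $ i $ j - v $ i * A $ p $ j)" for A i j
  proof -
    have "(E' ** A) $ i $ j = (\<Sum>l\<in>UNIV. (if l = p then (if i = p then 0 else - v $ i) * A $ p $ j else 0) + (if l = i then A $ i $ j else 0))"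
      unfolding matrix_entry_mult E'_def by (rule sum.cong) auto
    then show ?thesis by (simp add: sum.distrib)
  qed
  have EE: "E' ** E = mat 1"
  proof -
    have "(E' ** E) $ i $ j = mat 1 $ i $ j" for i j
      unfolding EA by (auto simp: E_def mat_nth vp)
    then show ?thesis by (simp add: vec_eq_iff)
  qed
  have b: "norm E \<le> CARD('n)\<^sup>2" "norm E' \<le> CARD('n)\<^sup>2"
    using norm_le_entries[of E 1] norm_le_entries[of E' 1] v1
    by (auto simp: E_def E'_def power2_eq_square)
  \<comment> \<open>The pivot is dictated by the eigenvector, so the order in which indices are
    taken has to be recorded: p comes last.\<close>
  define g where "g = f(p := card U)"
  have gU: "g i = f i" if "i \<in> U" for i using that pU by (auto simp: g_def)
  have c: "card (insert p U) = Suc (card U)" using pU by simp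
  have lt: "f i < card U" if "i \<in> U" for i using U(2) that by auto
  show thesis
  proof (rule that[OF pU _ _ matrix_left_right_inverse[THEN iffD1, OF EE] EE b])
    show "g ` insert p U \<subseteq> {..<card (insert p U)}" 
      unfolding c using lt gU by (auto simp: g_def less_Suc_eq)
    show "inj_on g (insert p U)"
    proof -
      have "inj_on g U" using U(3) gU by (simp cong: inj_on_cong)
      moreover have "g p \<notin> g ` (U - {p})"
      proof
        assume "g p \<in> g ` (U - {p})"
        then obtain u where "u \<in> U" "g p = g u" by blast
        with lt[of u] gU[of u] show False by (simp add: g_def)
      qed
      ultimately show ?thesis by (simp add: inj_on_insert)
    qed
    fix i j assume j: "j \<in> insert p U" and nz: "(E' ** T ** E) $ i $ j \<noteq> 0"
    show "i \<in> insert p U \<and> g i \<le> g j"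
    proof (cases "j = p")
      case False
      then have jU: "j \<in> U" using j by simp
      have "T $ p $ j = 0" using tri[OF jU] pU by blast
      then have "T $ i $ j \<noteq> 0" using nz False unfolding AE by (auto simp: EA split: if_splits)
      then show ?thesis using tri[OF jU, of i] gU jU by auto
    next
      case True
      show ?thesis
      proof (rule ccontr)
        assume n: "\<not> (i \<in> insert p U \<and> g i \<le> g j)"
        have "i \<notin> U" using n True lt[of i] gU[of i] by (auto simp: g_def)
        moreover have "i \<noteq> p" using n True by auto
        \<comment> \<open>The entry is coordinate i of T v minus v i times coordinate p of T v. It
          vanishes because v is an eigenvector off U with \<open>v $ p = 1\<close>.\<close>
        ultimately have "(E' ** T ** E) $ i $ j = (\<Sum>l\<in>UNIV. (T $ i $ l - v $ i * T $ p $ l) * v $ l)"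
          using True unfolding AE by (simp add: EA)
        also have "\<dots> = (\<Sum>l\<in>UNIV. T $ i $ l * v $ l) - v $ i * (\<Sum>l\<in>UNIV. T $ p $ l * v $ l)"
          by (simp add: algebra_simps sum_subtractf sum_distrib_left)
        also have "\<dots> = 0" using Tv[OF \<open>i \<notin> U\<close>] Tv[OF pU] vp by simp
        finally show False using nz by simp
      qed
    qed
  qed
qed

lemma triangularization_upto:
  "k \<le> CARD('n) \<Longrightarrow> \<exists>c\<ge>1. \<forall>B :: complex^'n^'n. \<exists>(U :: 'n set) f Q Q'. card U = k \<and> f ` U \<subseteq> {..<k} \<and> inj_on f U \<and>
     Q ** Q' = mat 1 \<and> Q' ** Q = mat 1 \<and> norm Q \<le> c \<and> norm Q' \<le> c \<and>
     (\<forall>i j. j \<in> U \<longrightarrow> (Q' ** B ** Q) $ i $ j \<noteq> 0 \<longrightarrow> i \<in> U \<and> f i \<le> f j)"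
proof (induction k)
  case 0
  have "\<exists>(U :: 'n set) f Q Q'. card U = 0 \<and> f ` U \<subseteq> {..<0::nat} \<and> inj_on f U \<and>
     Q ** Q' = mat 1 \<and> Q' ** Q = mat 1 \<and> norm Q \<le> norm (mat 1 :: complex^'n^'n) + 1 \<and> norm Q' \<le> norm (mat 1 :: complex^'n^'n) + 1 \<and>
     (\<forall>i j. j \<in> U \<longrightarrow> (Q' ** B ** Q) $ i $ j \<noteq> 0 \<longrightarrow> i \<in> U \<and> f i \<le> f j)" for B :: "complex^'n^'n"
    by (rule exI[of _ "{} :: 'n set"], rule exI[of _ "\<lambda>_. 0"], rule exI[of _ "mat 1 :: complex^'n^'n"],
        rule exI[of _ "mat 1 :: complex^'n^'n"]) simp
  then show ?case by (intro exI[of _ "norm (mat 1 :: complex^'n^'n) + 1"]) simp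
next
  case (Suc k)
  then obtain c where c: "c \<ge> 1" and IH: "\<And>B :: complex^'n^'n. \<exists>(U :: 'n set) f Q Q'. card U = k \<and> f ` U \<subseteq> {..<k} \<and> inj_on f U \<and>
     Q ** Q' = mat 1 \<and> Q' ** Q = mat 1 \<and> norm Q \<le> c \<and> norm Q' \<le> c \<and>
     (\<forall>i j. j \<in> U \<longrightarrow> (Q' ** B ** Q) $ i $ j \<noteq> 0 \<longrightarrow> i \<in> U \<and> f i \<le> f j)" by auto
  let ?n = "real (CARD('n)\<^sup>2)"
  have "\<exists>(U :: 'n set) f Q Q'. card U = Suc k \<and> f ` U \<subseteq> {..<Suc k} \<and> inj_on f U \<and>
     Q ** Q' = mat 1 \<and> Q' ** Q = mat 1 \<and> norm Q \<le> c * ?n \<and> norm Q' \<le> c * ?n \<and>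
     (\<forall>i j. j \<in> U \<longrightarrow> (Q' ** B ** Q) $ i $ j \<noteq> 0 \<longrightarrow> i \<in> U \<and> f i \<le> f j)" for B :: "complex^'n^'n"
  proof -
    obtain U :: "'n set" and f and Q Q' :: "complex^'n^'n" where h: "card U = k" "f ` U \<subseteq> {..<k}" "inj_on f U"
      "Q ** Q' = mat 1" "Q' ** Q = mat 1" "norm Q \<le> c" "norm Q' \<le> c"
      "\<And>i j. j \<in> U \<Longrightarrow> (Q' ** B ** Q) $ i $ j \<noteq> 0 \<Longrightarrow> i \<in> U \<and> f i \<le> f j"
      using IH[of B] by blast
    have "U \<noteq> UNIV" using h(1) Suc.prems by auto
    then obtain p g E E' where e: "p \<notin> U" "g ` insert p U \<subseteq> {..<card (insert p U)}" "inj_on g (insert p U)"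
      "E ** E' = mat 1" "E' ** E = mat 1" "norm E \<le> ?n" "norm E' \<le> ?n"
      "\<And>i j. j \<in> insert p U \<Longrightarrow> (E' ** (Q' ** B ** Q) ** E) $ i $ j \<noteq> 0 \<Longrightarrow> i \<in> insert p U \<and> g i \<le> g j"
    proof (rule triangularization_step[of U f "Q' ** B ** Q"])
      show "f ` U \<subseteq> {..<card U}" using h(1,2) by simp
      show "i \<in> U \<and> f i \<le> f j" if "j \<in> U" "(Q' ** B ** Q) $ i $ j \<noteq> 0" for i j
        using h(8) that by blast
    qed (use h(3) that in simp_all)
    have card: "card (insert p U) = Suc k" using e(1) h(1) by simp
    have "(Q ** E) ** (E' ** Q') = Q ** (E ** E') ** Q'" by (simp add: matrix_mul_assoc)
    then have 1: "(Q ** E) ** (E' ** Q') = mat 1" by (simp add: e h)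
    have 2: "(E' ** Q') ** (Q ** E) = mat 1" using 1 matrix_left_right_inverse by blast
    have 3: "norm (Q ** E) \<le> c * ?n" "norm (E' ** Q') \<le> c * ?n"
      using norm_matrix_mult[of Q E] norm_matrix_mult[of E' Q'] h(6,7) e(6,7) c
        mult_mono[of "norm Q" c "norm E" ?n] mult_mono[of "norm E'" ?n "norm Q'" c]
      by (auto simp: mult.commute)
    have "(E' ** Q') ** B ** (Q ** E) = E' ** (Q' ** B ** Q) ** E" by (simp add: matrix_mul_assoc)
    then show ?thesis
      using card e 1 2 3 by (intro exI[of _ "insert p U"] exI[of _ g] exI[of _ "Q ** E"] exI[of _ "E' ** Q'"]) simp
  qed
  moreover have "1 \<le> c * ?n" using c mult_mono[of 1 c 1 ?n] by simp
  ultimately show ?case by blast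
qed

text \<open>The injection f orders the index type, which carries no order of its own. The point is
  that c depends on the dimension only, whatever the position of the eigenvalues of B.\<close>

lemma triangularization:
  obtains c where "c \<ge> 1" "\<And>B :: complex^'n^'n. \<exists>f (Q :: complex^'n^'n) Q'. inj f \<and> range f \<subseteq> {..<CARD('n)} \<and>
     Q ** Q' = mat 1 \<and> Q' ** Q = mat 1 \<and> norm Q \<le> c \<and> norm Q' \<le> c \<and>
     (\<forall>i j. (Q' ** B ** Q) $ i $ j \<noteq> 0 \<longrightarrow> f i \<le> f j)"
proof -
  obtain c where c: "c \<ge> 1" and h: "\<And>B :: complex^'n^'n. \<exists>(U :: 'n set) f Q Q'. card U = CARD('n) \<and> f ` U \<subseteq> {..<CARD('n)} \<and> inj_on f U \<and>
     Q ** Q' = mat 1 \<and> Q' ** Q = mat 1 \<and> norm Q \<le> c \<and> norm Q' \<le> c \<and>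
     (\<forall>i j. j \<in> U \<longrightarrow> (Q' ** B ** Q) $ i $ j \<noteq> 0 \<longrightarrow> i \<in> U \<and> f i \<le> f j)"
    using triangularization_upto[where 'n='n, OF order_refl] by blast
  have "\<exists>f (Q :: complex^'n^'n) Q'. inj f \<and> range f \<subseteq> {..<CARD('n)} \<and>
     Q ** Q' = mat 1 \<and> Q' ** Q = mat 1 \<and> norm Q \<le> c \<and> norm Q' \<le> c \<and>
     (\<forall>i j. (Q' ** B ** Q) $ i $ j \<noteq> 0 \<longrightarrow> f i \<le> f j)" for B :: "complex^'n^'n"
  proof -
    obtain U :: "'n set" and f and Q Q' :: "complex^'n^'n" where hh: "card U = CARD('n) \<and> f ` U \<subseteq> {..<CARD('n)} \<and> inj_on f U \<and>
     Q ** Q' = mat 1 \<and> Q' ** Q = mat 1 \<and> norm Q \<le> c \<and> norm Q' \<le> c \<and>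
     (\<forall>i j. j \<in> U \<longrightarrow> (Q' ** B ** Q) $ i $ j \<noteq> 0 \<longrightarrow> i \<in> U \<and> f i \<le> f j)"
      using h[of B] by (elim exE) (rule that)
    have "U = UNIV" using hh by (simp add: card_eq_UNIV_imp_eq_UNIV)
    with hh show ?thesis
      by (intro exI[of _ f] exI[of _ Q] exI[of _ Q']) simp
  qed
  with c show thesis by (rule that)
qed

subsection \<open>Decoupling of separated eigenvalues\<close>

lemmas mm_add_left = bounded_bilinear.add_left[OF bounded_bilinear_matrix_mult]
  and mm_add_right = bounded_bilinear.add_right[OF bounded_bilinear_matrix_mult]
  and mm_diff_left = bounded_bilinear.diff_left[OF bounded_bilinear_matrix_mult]
  and mm_diff_right = bounded_bilinear.diff_right[OF bounded_bilinear_matrix_mult]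
  and mm_scaleR_left = bounded_bilinear.scaleR_left[OF bounded_bilinear_matrix_mult]
  and mm_scaleR_right = bounded_bilinear.scaleR_right[OF bounded_bilinear_matrix_mult]
  and mm_minus_left = bounded_bilinear.minus_left[OF bounded_bilinear_matrix_mult]
  and mm_minus_right = bounded_bilinear.minus_right[OF bounded_bilinear_matrix_mult]

lemmas mm_simps = mm_add_left mm_add_right mm_diff_left mm_diff_right mm_scaleR_left mm_scaleR_right
  mm_minus_left mm_minus_right matrix_mul_assoc[symmetric]

lemma norm_axis_le: "norm (axis i x :: 'a::real_normed_vector^'n) \<le> norm x"
  by (simp add: norm_vec_def axis_def L2_set_def if_distrib[of norm] if_distrib[of "\<lambda>x. x^2"] cong: if_cong)

definition uptri :: "('n \<Rightarrow> nat) \<Rightarrow> complex^'n^'n \<Rightarrow> bool" where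
  "uptri f T \<longleftrightarrow> (\<forall>i j. T $ i $ j \<noteq> 0 \<longrightarrow> f i \<le> f j)"

text \<open>Conjugating with \<open>1 + x E\<^bsub>ij\<^esub>\<close> only changes the entries to the right of \<open>(i, j)\<close> in row \<open>i\<close>
  and above it in column \<open>j\<close>.\<close>

lemma eliminate_entry:
  fixes T :: "complex^'n^'n"
  assumes f: "inj f" and T: "uptri f T" and ij: "f i < f j"
  defines "N \<equiv> \<lambda>x. (\<chi> a b. if a = i \<and> b = j then x else 0) :: complex^'n^'n"
  shows "((mat 1 - N x) ** T ** (mat 1 + N x)) $ a $ b =
      T $ a $ b + (if b = j then x * T $ a $ i else 0) - (if a = i then x * T $ j $ b else 0)"
    and "(mat 1 + N x) ** (mat 1 - N x) = mat 1"
proof -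
  have "T $ j $ i = 0" using T ij unfolding uptri_def by (meson not_le)
  have AN: "(A ** N x) $ a $ b = (if b = j then x * A $ a $ i else 0)" for A a b
  proof -
    have "(A ** N x) $ a $ b = (\<Sum>l\<in>UNIV. if l = i then (if b = j then x * A $ a $ i else 0) else 0)"
      unfolding matrix_entry_mult N_def by (rule sum.cong) auto
    then show ?thesis by simp
  qed
  have NA: "(N x ** A) $ a $ b = (if a = i then x * A $ j $ b else 0)" for A a b
  proof -
    have "(N x ** A) $ a $ b = (\<Sum>l\<in>UNIV. if l = j then (if a = i then x * A $ j $ b else 0) else 0)"
      unfolding matrix_entry_mult N_def by (rule sum.cong) auto
    then show ?thesis by simp
  qed
  have "(mat 1 - N x) ** T ** (mat 1 + N x) = T + T ** N x - N x ** T - (N x ** T) ** N x"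
    by (simp add: mm_simps)
  then show "((mat 1 - N x) ** T ** (mat 1 + N x)) $ a $ b =
      T $ a $ b + (if b = j then x * T $ a $ i else 0) - (if a = i then x * T $ j $ b else 0)"
    using \<open>T $ j $ i = 0\<close> by (simp add: AN NA)
  have "N x ** N x = 0" using ij by (auto simp: vec_eq_iff AN) (auto simp: N_def)
  then show "(mat 1 + N x) ** (mat 1 - N x) = mat 1" by (simp add: mm_simps)
qed

text \<open>Couplings of separated eigenvalues are removed one by one, ordered by the distance f j -
  f i from the diagonal and then by row; s bounds this code. A removal disturbs only entries farther
  from the diagonal, so earlier zeros persist. The exponent p grows with s but is independent of
  T.\<close>

lemma decoupling_upto:
  "\<exists>p. \<forall>M \<eta> f. \<forall>T :: complex^'n^'n. 2 + norm (mat 1 :: complex^'n^'n) \<le> M \<longrightarrow> norm T \<le> M \<longrightarrow> 0 < \<eta> \<longrightarrow> 1 / \<eta> \<le> M \<longrightarrow>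
     inj f \<longrightarrow> range f \<subseteq> {..<CARD('n)} \<longrightarrow> uptri f T \<longrightarrow>
     (\<exists>S S' T'. S ** S' = mat 1 \<and> T ** S = S ** T' \<and> norm S \<le> M ^ p \<and> norm S' \<le> M ^ p \<and> norm T' \<le> M ^ p \<and>
        uptri f T' \<and> (\<forall>i. T' $ i $ i = T $ i $ i) \<and>
        (\<forall>i j. f i < f j \<longrightarrow> \<eta> < norm (T $ i $ i - T $ j $ j) \<longrightarrow> (f j - f i) * CARD('n) + f i < s \<longrightarrow> T' $ i $ j = 0))"
proof (induction s)
  case 0
  show ?case
  proof (rule exI[of _ "1::nat"], intro allI impI)
    fix M \<eta> and f :: "'n \<Rightarrow> nat" and T :: "complex^'n^'n"
    assume h: "2 + norm (mat 1 :: complex^'n^'n) \<le> M" "norm T \<le> M" "uptri f T"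
    show "\<exists>S S' T'. S ** S' = mat 1 \<and> T ** S = S ** T' \<and> norm S \<le> M ^ 1 \<and> norm S' \<le> M ^ 1 \<and> norm T' \<le> M ^ 1 \<and>
        uptri f T' \<and> (\<forall>i. T' $ i $ i = T $ i $ i) \<and>
        (\<forall>i j. f i < f j \<longrightarrow> \<eta> < norm (T $ i $ i - T $ j $ j) \<longrightarrow> (f j - f i) * CARD('n) + f i < 0 \<longrightarrow> T' $ i $ j = 0)"
      using h by (intro exI[of _ "mat 1 :: complex^'n^'n"] exI[of _ T]) simp
  qed
next
  case (Suc s)
  then obtain p where IH: "\<And>M \<eta> f. \<And>T :: complex^'n^'n. 2 + norm (mat 1 :: complex^'n^'n) \<le> M \<Longrightarrow> norm T \<le> M \<Longrightarrow> 0 < \<eta> \<Longrightarrow> 1 / \<eta> \<le> M \<Longrightarrow>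
     inj f \<Longrightarrow> range f \<subseteq> {..<CARD('n)} \<Longrightarrow> uptri f T \<Longrightarrow>
     (\<exists>S S' T'. S ** S' = mat 1 \<and> T ** S = S ** T' \<and> norm S \<le> M ^ p \<and> norm S' \<le> M ^ p \<and> norm T' \<le> M ^ p \<and>
        uptri f T' \<and> (\<forall>i. T' $ i $ i = T $ i $ i) \<and>
        (\<forall>i j. f i < f j \<longrightarrow> \<eta> < norm (T $ i $ i - T $ j $ j) \<longrightarrow> (f j - f i) * CARD('n) + f i < s \<longrightarrow> T' $ i $ j = 0))"
    by metis
  show ?case
  \<comment> \<open>The new triangular form is a product of matrices bounded by
    \<open>M ^ (p + 2)\<close>, \<open>M ^ p\<close> and \<open>M ^ (p + 2)\<close>.\<close>
  proof (intro exI[of _ "3 * p + 4"] allI impI)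
    fix M \<eta> f and T :: "complex^'n^'n"
    assume M: "2 + norm (mat 1 :: complex^'n^'n) \<le> M" and TM: "norm T \<le> M" and \<eta>: "0 < \<eta>" "1 / \<eta> \<le> M"
      and f: "inj f" "range f \<subseteq> {..<CARD('n)}" and tri: "uptri f T"
    let ?g = "\<lambda>i j. (f j - f i) * CARD('n) + f i"
    let ?P = "\<lambda>s p T'. \<exists>S S'. S ** S' = mat 1 \<and> T ** S = S ** T' \<and> norm S \<le> M ^ p \<and> norm S' \<le> M ^ p \<and> norm T' \<le> M ^ p \<and>
        uptri f T' \<and> (\<forall>i. T' $ i $ i = T $ i $ i) \<and>
        (\<forall>i j. f i < f j \<longrightarrow> \<eta> < norm (T $ i $ i - T $ j $ j) \<longrightarrow> ?g i j < s \<longrightarrow> T' $ i $ j = 0)"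
    have M1: "1 \<le> M" using M norm_ge_zero[of "mat 1 :: complex^'n^'n"] by linarith
    have pm: "M ^ a \<le> M ^ b" if "a \<le> b" for a b using M1 that by (simp add: power_increasing)
    obtain S S' T' where h: "S ** S' = mat 1" "T ** S = S ** T'" "norm S \<le> M ^ p" "norm S' \<le> M ^ p" "norm T' \<le> M ^ p"
        "uptri f T'" "\<And>i. T' $ i $ i = T $ i $ i"
        "\<And>i j. f i < f j \<Longrightarrow> \<eta> < norm (T $ i $ i - T $ j $ j) \<Longrightarrow> ?g i j < s \<Longrightarrow> T' $ i $ j = 0"
      using IH[OF M TM \<eta> f tri] by blast
    have pp: "M ^ p \<le> M ^ (3 * p + 4)" by (rule pm) simp
    show "\<exists>S S' T'. S ** S' = mat 1 \<and> T ** S = S ** T' \<and> norm S \<le> M ^ (3 * p + 4) \<and> norm S' \<le> M ^ (3 * p + 4) \<and> norm T' \<le> M ^ (3 * p + 4) \<and>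
        uptri f T' \<and> (\<forall>i. T' $ i $ i = T $ i $ i) \<and>
        (\<forall>i j. f i < f j \<longrightarrow> \<eta> < norm (T $ i $ i - T $ j $ j) \<longrightarrow> ?g i j < Suc s \<longrightarrow> T' $ i $ j = 0)"
    proof (cases "\<exists>i j. f i < f j \<and> \<eta> < norm (T $ i $ i - T $ j $ j) \<and> ?g i j = s")
      case False
      then have "T' $ i $ j = 0" if "f i < f j" "\<eta> < norm (T $ i $ i - T $ j $ j)" "?g i j < Suc s" for i j
        using h(8)[OF that(1,2)] that by (metis less_SucE)
      then show ?thesis
        using h pp by (intro exI[of _ S] exI[of _ S'] exI[of _ T']) (auto intro: order_trans[OF _ pp])
    next
      case True
      then obtain i j where ij: "f i < f j" "\<eta> < norm (T $ i $ i - T $ j $ j)" "?g i j = s" by blast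
      \<comment> \<open>The solution of
        \<open>T' $ i $ j + x * T $ i $ i - x * T $ j $ j = 0\<close>, the condition that the new
        entry (i, j) vanishes. The gap \<eta> bounds it by \<open>M ^ (p + 1)\<close>.\<close>
      define x where "x = T' $ i $ j / (T $ j $ j - T $ i $ i)"
      define N where "N = ((\<chi> a b. if a = i \<and> b = j then x else 0) :: complex^'n^'n)"
      define T'' where "T'' = (mat 1 - N) ** T' ** (mat 1 + N)"
      note el = eliminate_entry[OF f(1) h(6) ij(1), of x, folded N_def]
      have entry: "T'' $ a $ b = T' $ a $ b + (if b = j then x * T' $ a $ i else 0) - (if a = i then x * T' $ j $ b else 0)" for a b
        unfolding T''_def by (rule el(1))
      have zero: "T' $ a $ b = 0" if "f b < f a" for a b
        using h(6) that unfolding uptri_def by (meson not_le)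
      have diag: "T'' $ a $ a = T $ a $ a" for a
        unfolding entry using zero[OF ij(1)] h(7) by auto
      have tri'': "uptri f T''"
        unfolding uptri_def
      proof (intro allI impI, rule ccontr)
        fix a b assume nz: "T'' $ a $ b \<noteq> 0" and "\<not> f a \<le> f b"
        then have ab: "f b < f a" by simp
        have "b = j \<Longrightarrow> T' $ a $ i = 0" using ij(1) ab by (intro zero) simp
        moreover have "a = i \<Longrightarrow> T' $ j $ b = 0" using ij(1) ab by (intro zero) simp
        ultimately show False using nz zero[OF ab] unfolding entry by (auto split: if_splits)
      qed
      have fn: "f a < CARD('n)" for a using f(2) by auto
      \<comment> \<open>The values of f are below \<open>CARD('n)\<close>, so the code is
        lexicographic and the distance from the diagonal decides first.\<close>
      have grow: "?g a b < ?g a' b'" if "f b - f a < f b' - f a'" for a b a' b'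
      proof -
        have "?g a b < (f b - f a) * CARD('n) + CARD('n)" using fn[of a] by simp
        also have "\<dots> = Suc (f b - f a) * CARD('n)" by simp
        also have "\<dots> \<le> (f b' - f a') * CARD('n)" using that by (intro mult_right_mono) auto
        finally show ?thesis by simp
      qed
      have killed: "T'' $ a $ b = 0" if ab: "f a < f b" "\<eta> < norm (T $ a $ a - T $ b $ b)" "?g a b < Suc s" for a b
      proof (cases "a = i \<and> b = j")
        case True
        have "T $ j $ j \<noteq> T $ i $ i" using ij(2) \<eta>(1) by auto
        then have "T' $ i $ j + x * T $ i $ i - x * T $ j $ j = 0"
          unfolding x_def by (simp add: field_simps)
        then show ?thesis unfolding entry using True h(7) by simp
      next
        case False
        have 1: "T' $ a $ i = 0" if "b = j" "a \<noteq> i"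
        proof (rule zero, rule ccontr)
          assume "\<not> f i < f a"
          then have "f a < f i" using that(2) f(1) by (metis injD linorder_neqE_nat)
          then have "?g i j < ?g a j" using ij(1) by (intro grow) linarith
          then show False using ij(3) ab(3) that(1) by simp
        qed
        have 2: "T' $ j $ b = 0" if "a = i" "b \<noteq> j"
        proof (rule zero, rule ccontr)
          assume "\<not> f b < f j"
          then have "f j < f b" using that(2) f(1) by (metis injD linorder_neqE_nat)
          then have "?g i j < ?g i b" using ij(1) by (intro grow) linarith
          then show False using ij(3) ab(3) that(1) by simp
        qed
        have "?g a b \<noteq> s"
        proof
          assume s: "?g a b = s"
          have "f b - f a = f j - f i"
            using grow[of b a j i] grow[of j i b a] s ij(3) by (metis less_irrefl linorder_neqE_nat)
          then have "f a = f i" using s ij(3) by simp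
          moreover from this have "f b = f j" using \<open>f b - f a = f j - f i\<close> ab(1) ij(1) by linarith
          ultimately show False using False f(1) by (metis injD)
        qed
        then have "T' $ a $ b = 0" using h(8)[OF ab(1,2)] ab(3) by simp
        then show ?thesis unfolding entry using 1 2 False by auto
      qed
      have xb: "norm x \<le> M ^ (p + 1)"
      proof -
        have "norm x = norm (T' $ i $ j) / norm (T $ i $ i - T $ j $ j)" by (simp add: x_def norm_divide norm_minus_commute)
        also have "\<dots> \<le> M ^ p / \<eta>"
          using ij(2) \<eta>(1) h(5) norm_entry_le[of T' i j] M1 by (intro frac_le) auto
        also have "\<dots> = M ^ p * (1 / \<eta>)" by simp
        also have "\<dots> \<le> M ^ p * M" using \<eta>(2) M1 by (intro mult_left_mono) auto
        finally show ?thesis by (simp add: mult.commute)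
      qed
      have "N = axis i (axis j x)" by (simp add: N_def vec_eq_iff axis_def)
      then have Nn: "norm N \<le> norm x" using norm_axis_le by (metis order_trans)
      have nb: "norm (mat 1 + N) \<le> M ^ (p + 2)" "norm (mat 1 - N) \<le> M ^ (p + 2)"
      proof -
        have "norm (mat 1 :: complex^'n^'n) + norm N \<le> (M - 2) + M ^ (p + 1)" using M Nn xb by linarith
        also have "\<dots> \<le> M ^ (p + 1) + M ^ (p + 1)" using pm[of 1 "p + 1"] by simp
        also have "\<dots> = 2 * M ^ (p + 1)" by simp
        also have "\<dots> \<le> M * M ^ (p + 1)" using M M1 norm_ge_zero[of "mat 1 :: complex^'n^'n"] by (intro mult_right_mono) (linarith, use M1 in simp)
        finally have *: "norm (mat 1 :: complex^'n^'n) + norm N \<le> M ^ (p + 2)" by simp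
        show "norm (mat 1 + N) \<le> M ^ (p + 2)" "norm (mat 1 - N) \<le> M ^ (p + 2)"
          using * norm_triangle_ineq[of "mat 1" N] norm_triangle_ineq4[of "mat 1" N] by linarith+
      qed
      have mb: "norm (A ** B) \<le> M ^ (a + b)" if "norm A \<le> M ^ a" "norm B \<le> M ^ b" for A B :: "complex^'n^'n" and a b
        using norm_matrix_mult[of A B] mult_mono[OF that] M1 unfolding power_add by (auto intro: order_trans)
      have Sb: "norm (S ** (mat 1 + N)) \<le> M ^ (3 * p + 4)" "norm ((mat 1 - N) ** S') \<le> M ^ (3 * p + 4)" "norm T'' \<le> M ^ (3 * p + 4)"
      proof -
        have "M ^ (p + (p + 2)) \<le> M ^ (3 * p + 4)" "M ^ ((p + 2) + p) \<le> M ^ (3 * p + 4)" by (rule pm, simp)+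
        then show "norm (S ** (mat 1 + N)) \<le> M ^ (3 * p + 4)" "norm ((mat 1 - N) ** S') \<le> M ^ (3 * p + 4)"
          using mb[OF h(3) nb(1)] mb[OF nb(2) h(4)] by linarith+
        have "(p + 2) + p + (p + 2) = 3 * p + 4" by simp
        then show "norm T'' \<le> M ^ (3 * p + 4)"
          unfolding T''_def using mb[OF mb[OF nb(2) h(5)] nb(1)] by metis
      qed
      have c1: "(S ** (mat 1 + N)) ** ((mat 1 - N) ** S') = mat 1"
      proof -
        have "(S ** (mat 1 + N)) ** ((mat 1 - N) ** S') = S ** ((mat 1 + N) ** (mat 1 - N)) ** S'"
          by (simp only: matrix_mul_assoc)
        then show ?thesis by (simp add: el(2) h(1))
      qed
      have c2: "T ** (S ** (mat 1 + N)) = (S ** (mat 1 + N)) ** T''"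
      proof -
        have "(S ** (mat 1 + N)) ** T'' = S ** ((mat 1 + N) ** (mat 1 - N)) ** T' ** (mat 1 + N)"
          unfolding T''_def by (simp only: matrix_mul_assoc)
        also have "\<dots> = (S ** T') ** (mat 1 + N)" by (simp add: el(2) matrix_mul_assoc)
        also have "\<dots> = T ** (S ** (mat 1 + N))" by (simp only: h(2)[symmetric] matrix_mul_assoc)
        finally show ?thesis by simp
      qed
      show ?thesis
        using c1 c2 Sb tri'' diag killed
        by (intro exI[of _ "S ** (mat 1 + N)"] exI[of _ "(mat 1 - N) ** S'"] exI[of _ T'']) blast
    qed
  qed
qed

text \<open>Lets constants depending only on the dimension disappear into powers of M.\<close>

lemma power_bound_exists:
  fixes c :: real
  shows "\<exists>q. \<forall>M\<ge>2. c \<le> M ^ q"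
proof -
  obtain q where "c < 2 ^ q" using real_arch_pow[of 2 c] by auto
  then have "c \<le> M ^ q" if "M \<ge> 2" for M using power_mono[of 2 M q] that by simp
  then show ?thesis by blast
qed

text \<open>Closeness of eigenvalues is not transitive, so no block structure is asked for. What
  counts is that every surviving coupling joins nearly equal eigenvalues: a diagonal matrix that is
  constant along such couplings then commutes with T.\<close>

lemma cluster_triangularization:
  "\<exists>p. \<forall>M \<eta>. \<forall>B :: complex^'n^'n. 2 + norm (mat 1 :: complex^'n^'n) \<le> M \<longrightarrow> norm B \<le> M \<longrightarrow> 0 < \<eta> \<longrightarrow> 1 / \<eta> \<le> M \<longrightarrow>
     (\<exists>f (Q :: complex^'n^'n) Q' T. inj f \<and> range f \<subseteq> {..<CARD('n)} \<and> Q ** Q' = mat 1 \<and> Q' ** Q = mat 1 \<and> B ** Q = Q ** T \<and>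
        norm Q \<le> M ^ p \<and> norm Q' \<le> M ^ p \<and> norm T \<le> M ^ p \<and>
        (\<forall>i j. T $ i $ j \<noteq> 0 \<longrightarrow> f i \<le> f j \<and> norm (T $ i $ i - T $ j $ j) \<le> \<eta>))"
proof -
  obtain c where c: "c \<ge> 1" and tri: "\<And>B :: complex^'n^'n. \<exists>f (Q :: complex^'n^'n) Q'. inj f \<and> range f \<subseteq> {..<CARD('n)} \<and>
     Q ** Q' = mat 1 \<and> Q' ** Q = mat 1 \<and> norm Q \<le> c \<and> norm Q' \<le> c \<and>
     (\<forall>i j. (Q' ** B ** Q) $ i $ j \<noteq> 0 \<longrightarrow> f i \<le> f j)"
    using triangularization[where 'n='n] by blast
  obtain q where q: "\<And>M. M \<ge> 2 \<Longrightarrow> c \<le> M ^ q" using power_bound_exists by blast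
  \<comment> \<open>Exceeds every code \<open>(f j - f i) * CARD('n) + f i\<close>, so that all
    separated couplings are removed.\<close>
  define s where "s = Suc (CARD('n) * CARD('n) + CARD('n))"
  obtain p where p: "\<And>M \<eta> f. \<And>T :: complex^'n^'n. 2 + norm (mat 1 :: complex^'n^'n) \<le> M \<Longrightarrow> norm T \<le> M \<Longrightarrow> 0 < \<eta> \<Longrightarrow> 1 / \<eta> \<le> M \<Longrightarrow>
     inj f \<Longrightarrow> range f \<subseteq> {..<CARD('n)} \<Longrightarrow> uptri f T \<Longrightarrow>
     (\<exists>S S' T'. S ** S' = mat 1 \<and> T ** S = S ** T' \<and> norm S \<le> M ^ p \<and> norm S' \<le> M ^ p \<and> norm T' \<le> M ^ p \<and>
        uptri f T' \<and> (\<forall>i. T' $ i $ i = T $ i $ i) \<and>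
        (\<forall>i j. f i < f j \<longrightarrow> \<eta> < norm (T $ i $ i - T $ j $ j) \<longrightarrow> (f j - f i) * CARD('n) + f i < s \<longrightarrow> T' $ i $ j = 0))"
    using decoupling_upto[where 'n='n, of s] by metis
  define P where "P = q + (2 * q + 1) * p"
  show ?thesis
  proof (intro exI[of _ P] allI impI)
    fix M \<eta> and B :: "complex^'n^'n"
    assume M: "2 + norm (mat 1 :: complex^'n^'n) \<le> M" "norm B \<le> M" and \<eta>: "0 < \<eta>" "1 / \<eta> \<le> M"
    have M2: "2 \<le> M" using M(1) norm_ge_zero[of "mat 1 :: complex^'n^'n"] by linarith
    obtain f and Q Q' :: "complex^'n^'n" where h0: "inj f \<and> range f \<subseteq> {..<CARD('n)} \<and>
     Q ** Q' = mat 1 \<and> Q' ** Q = mat 1 \<and> norm Q \<le> c \<and> norm Q' \<le> c \<and>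
     (\<forall>i j. (Q' ** B ** Q) $ i $ j \<noteq> 0 \<longrightarrow> f i \<le> f j)"
      using tri[of B] by (elim exE) (rule that)
    then have h: "inj f" "range f \<subseteq> {..<CARD('n)}"
     "Q ** Q' = mat 1" "Q' ** Q = mat 1" "norm Q \<le> c" "norm Q' \<le> c"
     "\<And>i j. (Q' ** B ** Q) $ i $ j \<noteq> 0 \<Longrightarrow> f i \<le> f j"
      by simp_all
    have Q: "norm Q \<le> M ^ q" "norm Q' \<le> M ^ q" using h(5,6) q[OF M2] by auto
    define M' where "M' = M ^ (2 * q + 1)"
    have MM': "M \<le> M'" using M2 power_increasing[of 1 "2 * q + 1" M] by (simp add: M'_def)
    have mb: "norm (A ** C) \<le> M ^ (a + b)" if "norm A \<le> M ^ a" "norm C \<le> M ^ b" for A C :: "complex^'n^'n" and a b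
      using norm_matrix_mult[of A C] mult_mono[OF that] M2 unfolding power_add by (auto intro: order_trans)
    have "norm (Q' ** B ** Q) \<le> M ^ (q + 1 + q)"
      using mb[OF mb[OF Q(2), of B 1] Q(1)] M(2) by simp
    also have "q + 1 + q = 2 * q + 1" by simp
    finally have T0: "norm (Q' ** B ** Q) \<le> M'" by (simp add: M'_def)
    obtain S S' T' where s: "S ** S' = mat 1" "(Q' ** B ** Q) ** S = S ** T'" "norm S \<le> M' ^ p" "norm S' \<le> M' ^ p" "norm T' \<le> M' ^ p"
        "uptri f T'" "\<And>i. T' $ i $ i = (Q' ** B ** Q) $ i $ i"
        "\<And>i j. f i < f j \<Longrightarrow> \<eta> < norm ((Q' ** B ** Q) $ i $ i - (Q' ** B ** Q) $ j $ j) \<Longrightarrow> (f j - f i) * CARD('n) + f i < s \<Longrightarrow> T' $ i $ j = 0"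
    proof -
      have "uptri f (Q' ** B ** Q)" using h(7) by (simp add: uptri_def)
      from p[OF _ T0 \<eta>(1) _ h(1,2) this] show ?thesis using that M(1) \<eta>(2) MM' by force
    qed
    have fn: "f a < CARD('n)" for a using h(2) by auto
    have M'p: "M' ^ p = M ^ ((2 * q + 1) * p)" by (simp only: M'_def power_mult)
    have "B ** (Q ** S) = (Q ** Q') ** B ** (Q ** S)" by (simp add: h(3))
    also have "\<dots> = Q ** ((Q' ** B ** Q) ** S)" by (simp only: matrix_mul_assoc)
    also have "\<dots> = (Q ** S) ** T'" by (simp only: s(2) matrix_mul_assoc)
    finally have conj: "B ** (Q ** S) = (Q ** S) ** T'" .
    have "(Q ** S) ** (S' ** Q') = Q ** (S ** S') ** Q'" by (simp only: matrix_mul_assoc)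
    then have inv: "(Q ** S) ** (S' ** Q') = mat 1" by (simp add: s(1) h(3))
    have bounds: "norm (Q ** S) \<le> M ^ P" "norm (S' ** Q') \<le> M ^ P" "norm T' \<le> M ^ P"
      using mb[OF Q(1), of S "(2 * q + 1) * p"] mb[OF _ Q(2), of S' "(2 * q + 1) * p"] s(3,4,5)
        power_increasing[of "(2 * q + 1) * p" P M] M2
      unfolding M'p P_def by (auto simp: add.commute intro: order_trans)
    have cl: "f i \<le> f j \<and> norm (T' $ i $ i - T' $ j $ j) \<le> \<eta>" if nz: "T' $ i $ j \<noteq> 0" for i j
    proof -
      have le: "f i \<le> f j" using s(6) nz by (auto simp: uptri_def)
      show ?thesis
      proof (cases "f i = f j")
        case True
        then have "i = j" using h(1) by (simp add: inj_eq)
        then show ?thesis using \<eta>(1) by simp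
      next
        case False
        then have "f i < f j" using le by simp
        moreover have "(f j - f i) * CARD('n) + f i < s"
        proof -
          have "(f j - f i) * CARD('n) \<le> CARD('n) * CARD('n)" using fn[of j] by (intro mult_right_mono) auto
          then show ?thesis using fn[of i] unfolding s_def by linarith
        qed
        ultimately have "\<not> \<eta> < norm (T' $ i $ i - T' $ j $ j)" using s(7,8) nz by metis
        then show ?thesis using le by simp
      qed
    qed
    show "\<exists>f (Q :: complex^'n^'n) Q' T. inj f \<and> range f \<subseteq> {..<CARD('n)} \<and> Q ** Q' = mat 1 \<and> Q' ** Q = mat 1 \<and> B ** Q = Q ** T \<and>
        norm Q \<le> M ^ P \<and> norm Q' \<le> M ^ P \<and> norm T \<le> M ^ P \<and>
        (\<forall>i j. T $ i $ j \<noteq> 0 \<longrightarrow> f i \<le> f j \<and> norm (T $ i $ i - T $ j $ j) \<le> \<eta>)"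
      by (intro exI[of _ f] exI[of _ "Q ** S"] exI[of _ "S' ** Q'"] exI[of _ T'] conjI h(1,2) conj inv
          matrix_left_right_inverse[THEN iffD1, OF inv] bounds allI impI cl[THEN conjunct1] cl[THEN conjunct2])
  qed
qed

subsection \<open>Bounded inverses\<close>

text \<open>The columns of the inverse are the preimages of the unit vectors, so the lower bound on
  M controls each of them.\<close>

lemma bounded_below_inverse:
  fixes M :: "complex^'n^'n"
  assumes "\<And>x. norm x \<le> c * norm (M *v x)"
  obtains N where "M ** N = mat 1" "N ** M = mat 1" "norm N \<le> (real CARD('n))\<^sup>2 * c"
proof -
  have "inj ((*v) M)"
  proof (rule injI)
    fix x y assume "M *v x = M *v y"
    then have "M *v (x - y) = 0" by (simp add: matrix_vector_mult_diff_distrib)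
    then show "x = y" using assms[of "x - y"] by simp
  qed
  then obtain N where N: "N ** M = mat 1" using matrix_left_invertible_injective by blast
  then have N': "M ** N = mat 1" using matrix_left_right_inverse by blast
  have "norm (N $ i $ j) \<le> c" for i j
  proof -
    have ax: "N *v axis j 1 = column j N"
      by (simp add: vec_eq_iff matrix_vector_mult_def column_def axis_def if_distrib[of "\<lambda>x. _ * x"] cong: if_cong)
    have "M *v (N *v axis j 1) = axis j 1" by (simp add: matrix_vector_mul_assoc N')
    then have "norm (N *v axis j 1) \<le> c * norm (axis j 1 :: complex^'n)" using assms[of "N *v axis j 1"] by simp
    then have "norm (N *v axis j 1) \<le> c" by (simp add: norm_axis_1)
    moreover have "norm (N $ i $ j) \<le> norm (column j N)"
      using Finite_Cartesian_Product.norm_nth_le[of "column j N" i] by (simp add: column_def)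
    ultimately show ?thesis unfolding ax by linarith
  qed
  from norm_le_entries[of N, OF this] show thesis
    using that[OF N' N] by (simp add: power2_eq_square)
qed

text \<open>The 2 comes from adding a map to its conjugate when both are close to the same
  invertible matrix.\<close>

lemma inverse_near_two:
  fixes E :: "complex^'n^'n"
  assumes "norm E \<le> 1"
  obtains N where "(2 *\<^sub>R mat 1 + E) ** N = mat 1" "norm N \<le> (real CARD('n))\<^sup>2"
proof -
  have "norm x \<le> 1 * norm ((2 *\<^sub>R mat 1 + E) *v x)" for x
  proof -
    have e: "(2 *\<^sub>R mat 1 + E) *v x = 2 *\<^sub>R x + E *v x"
    proof -
      have "((2 *\<^sub>R mat 1 :: complex^'n^'n) *v x) = 2 *\<^sub>R x"
        by (simp add: vec_eq_iff matrix_vector_mult_def mat_nth if_distrib[of "\<lambda>y. 2 *\<^sub>R y"]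
            if_distrib[of "\<lambda>y. y * _"] cong: if_cong)
      then show ?thesis by (simp add: matrix_vector_mult_add_rdistrib)
    qed
    have "norm (E *v x) \<le> 1 * norm x"
      using norm_matrix_vector_mult[of E x] assms mult_right_mono[of "norm E" 1 "norm x"] by simp
    then show ?thesis unfolding e using norm_diff_ineq[of "2 *\<^sub>R x" "E *v x"] by simp
  qed
  from bounded_below_inverse[OF this] show thesis using that by (metis mult.right_neutral)
qed

subsection \<open>Approximate real structures\<close>

text \<open>A matrix with \<open>cnjm C ** C\<close> close to the identity is corrected to an exact real structure
  by the inverse square root of \<open>cnjm C ** C\<close>, found as a fixed point. Any (approximate) intertwining
  relation survives, since it is a closed condition preserved by the iteration.\<close>

lemma real_structure_correction:
  fixes C Bt :: "complex^'n^'n"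
  assumes D: "norm (mat 1 - cnjm C ** C) \<le> 1 / 16" and e: "norm (cnjm Bt ** C - C ** Bt) \<le> e"
  obtains C' where "cnjm C' ** C' = mat 1" "norm (C' - C) \<le> norm C * norm (mat 1 - cnjm C ** C)"
    "norm (cnjm Bt ** C' - C' ** Bt) \<le> (2 + 4 * (norm C)\<^sup>2) * e"
proof -
  define D where "D = mat 1 - cnjm C ** C"
  have D16: "norm D \<le> 1 / 16" using D by (simp add: D_def)
  have e0: "0 \<le> e" using e norm_ge_zero order_trans by blast
  define e1 where "e1 = 2 * norm C * e"
  have e10: "0 \<le> e1" using e0 by (simp add: e1_def)
  \<comment> \<open>The commutator with \<open>Bt\<close> is a derivation, so it can be followed
    through products in the iteration.\<close>
  define K where "K = (\<lambda>X. Bt ** X - X ** Bt)"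
  have Kmult: "K (X ** Y) = K X ** Y + X ** K Y" for X Y by (simp add: K_def mm_simps)
  have Kadd: "K (X + Y) = K X + K Y" "K (X - Y) = K X - K Y" "K (c *\<^sub>R X) = c *\<^sub>R K X" for X Y c
    by (simp_all add: K_def mm_simps scaleR_diff_right)
  have K1: "K (mat 1) = 0" by (simp add: K_def)
  have KD: "norm (K D) \<le> e1"
  proof -
    \<comment> \<open>The relation is used once for C and once for its conjugate, since
      \<open>cnjm C ** C\<close> approximately intertwines \<open>Bt\<close> with itself.\<close>
    have "K D = cnjm (cnjm Bt ** C - C ** Bt) ** (- C) - cnjm C ** (cnjm Bt ** C - C ** Bt)"
      unfolding D_def Kadd K1 by (simp add: K_def cnjm_diff cnjm_mult mm_simps)
    then have "norm (K D) \<le> norm (cnjm (cnjm Bt ** C - C ** Bt) ** (- C)) + norm (cnjm C ** (cnjm Bt ** C - C ** Bt))"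
      using norm_triangle_ineq4 by metis
    also have "\<dots> \<le> norm C * e + norm C * e"
    proof (rule add_mono)
      have "norm (cnjm (cnjm Bt ** C - C ** Bt) ** (- C)) \<le> norm (cnjm Bt ** C - C ** Bt) * norm C"
        using norm_matrix_mult[of "cnjm (cnjm Bt ** C - C ** Bt)" "- C"] by simp
      also have "\<dots> = norm C * norm (cnjm Bt ** C - C ** Bt)" by (rule mult.commute)
      also have "\<dots> \<le> norm C * e" by (rule mult_left_mono[OF e norm_ge_zero])
      finally show "norm (cnjm (cnjm Bt ** C - C ** Bt) ** (- C)) \<le> norm C * e" .
      show "norm (cnjm C ** (cnjm Bt ** C - C ** Bt)) \<le> norm C * e"
        using norm_matrix_mult[of "cnjm C" "cnjm Bt ** C - C ** Bt"] mult_left_mono[OF e norm_ge_zero[of C]]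
        unfolding norm_cnjm by (rule order_trans)
    qed
    finally show ?thesis by (simp add: e1_def mult_ac)
  qed
  \<comment> \<open>Fixed points solve (1 - D) (1 + X)^2 = 1. If
    \<open>C ** X = cnjm X ** C\<close>, then \<open>C' = C + C ** X\<close> satisfies cnj C' C' =
    cnj C C (1 + X)^2, and \<open>cnjm C ** C\<close> is 1 - D.\<close>
  define F where "F = (\<lambda>X. (1/2) *\<^sub>R (D + 2 *\<^sub>R (D ** X) + D ** (X ** X) - X ** X))"
  \<comment> \<open>Size, compatibility with C and near commutation with \<open>Bt\<close> are
    closed conditions that F preserves. The radius 1 / 4 matches the bound 1 / 16 on D: F maps the
    ball into itself and contracts it.\<close>
  define s where "s = {X. norm X \<le> 1 / 4 \<and> C ** X = cnjm X ** C \<and> norm (K X) \<le> 2 * e1}"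
  have CD: "C ** D = cnjm D ** C" by (simp add: D_def cnjm_diff cnjm_mult mm_simps)
  have n2: "norm (X ** Y) \<le> a * b" if "norm X \<le> a" "norm Y \<le> b" for X Y :: "complex^'n^'n" and a b
    using norm_matrix_mult[of X Y] mult_mono[OF that] order_trans[OF norm_ge_zero that(1)] by (auto intro: order_trans)
  have maps: "F X \<in> s" if X: "X \<in> s" for X
  proof -
    have x: "norm X \<le> 1 / 4" "C ** X = cnjm X ** C" "norm (K X) \<le> 2 * e1" using X by (auto simp: s_def)
    have "norm (F X) = norm (D + 2 *\<^sub>R (D ** X) + D ** (X ** X) - X ** X) / 2" by (simp add: F_def)
    also have "norm (D + 2 *\<^sub>R (D ** X) + D ** (X ** X) - X ** X) \<le> norm D + 2 * norm (D ** X) + norm (D ** (X ** X)) + norm (X ** X)"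
      by (intro norm_triangle_le norm_triangle_le_diff add_mono) simp_all
    also have "\<dots> \<le> 1/16 + 2 * (1/16 * (1/4)) + 1/16 * (1/4 * (1/4)) + 1/4 * (1/4)"
      by (intro add_mono mult_left_mono n2 D16 x) simp
    finally have 1: "norm (F X) \<le> 1 / 4" by simp
    have CXX: "C ** (X ** X) = cnjm (X ** X) ** C"
      by (metis cnjm_mult matrix_mul_assoc x(2))
    have CDX: "C ** (D ** Y) = cnjm (D ** Y) ** C" if "C ** Y = cnjm Y ** C" for Y
      by (metis cnjm_mult matrix_mul_assoc that CD)
    have 2: "C ** F X = cnjm (F X) ** C"
      using CD CDX[OF x(2)] CDX[OF CXX] CXX by (simp add: F_def cnjm_diff cnjm_add cnjm_scaleR mm_simps del: cnjm_mult)
    have kx: "norm (K (X ** X)) \<le> e1"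
      unfolding Kmult using n2[OF x(3) x(1)] n2[OF x(1) x(3)] norm_triangle_ineq[of "K X ** X" "X ** K X"] by linarith
    have kdx: "norm (K (D ** X)) \<le> e1 * (1/4) + 1/16 * (2 * e1)"
      unfolding Kmult using n2[OF KD x(1)] n2[OF D16 x(3)] norm_triangle_ineq[of "K D ** X" "D ** K X"] by linarith
    have kdxx: "norm (K (D ** (X ** X))) \<le> e1 * (1/4 * (1/4)) + 1/16 * e1"
      unfolding Kmult[of D] using n2[OF KD n2[OF x(1) x(1)]] n2[OF D16 kx] norm_triangle_ineq[of "K D ** (X ** X)" "D ** K (X ** X)"] by linarith
    have A: "norm (K (F X)) = norm (K D + 2 *\<^sub>R K (D ** X) + K (D ** (X ** X)) - K (X ** X)) / 2" by (simp add: F_def Kadd)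
    have B: "norm (K D + 2 *\<^sub>R K (D ** X) + K (D ** (X ** X)) - K (X ** X)) \<le> norm (K D) + 2 * norm (K (D ** X)) + norm (K (D ** (X ** X))) + norm (K (X ** X))"
      by (intro norm_triangle_le norm_triangle_le_diff add_mono) simp_all
    have 3: "norm (K (F X)) \<le> 2 * e1" using A B KD kx kdx kdxx e10 by linarith
    show ?thesis using 1 2 3 by (simp add: s_def)
  qed
  have contr: "dist (F X) (F Y) \<le> (1/2) * dist X Y" if "X \<in> s" "Y \<in> s" for X Y
  proof -
    have x: "norm X \<le> 1 / 4" "norm Y \<le> 1 / 4" using that by (auto simp: s_def)
    define Z where "Z = X - Y"
    have z: "norm (X ** X - Y ** Y) \<le> 1 / 2 * norm Z"
    proof -
      have xy: "X ** X - Y ** Y = X ** Z + Z ** Y" by (simp add: Z_def mm_simps)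
      show ?thesis unfolding xy
        using n2[OF x(1) order_refl[of "norm Z"]] n2[OF order_refl[of "norm Z"] x(2)] norm_triangle_ineq[of "X ** Z" "Z ** Y"] by linarith
    qed
    have "F X - F Y = (1/2) *\<^sub>R (2 *\<^sub>R (D ** Z) + D ** (X ** X - Y ** Y) - (X ** X - Y ** Y))"
      by (simp add: F_def Z_def mm_simps algebra_simps)
    then have "norm (F X - F Y) \<le> (2 * norm (D ** Z) + norm (D ** (X ** X - Y ** Y)) + norm (X ** X - Y ** Y)) / 2"
      using norm_triangle_ineq4[of "2 *\<^sub>R (D ** Z) + D ** (X ** X - Y ** Y)" "X ** X - Y ** Y"]
        norm_triangle_ineq[of "2 *\<^sub>R (D ** Z)" "D ** (X ** X - Y ** Y)"] by simp
    also have "\<dots> \<le> (1 / 2) * norm Z"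
    proof -
      have "a \<le> 1 / 16 * t \<Longrightarrow> b \<le> 1 / 16 * (1 / 2 * t) \<Longrightarrow> c \<le> 1 / 2 * t \<Longrightarrow> 0 \<le> t \<Longrightarrow> (2 * a + b + c) / 2 \<le> (1 / 2) * t" for a b c t :: real
        by (simp add: field_simps)
      from this[OF n2[OF D16 order_refl[of "norm Z"]] n2[OF D16 z] z norm_ge_zero[of Z]] show ?thesis .
    qed
    finally show ?thesis by (simp add: dist_norm Z_def)
  qed
  have cont: "continuous_on UNIV (\<lambda>X. A ** X)" "continuous_on UNIV (\<lambda>X. X ** A)" "continuous_on UNIV (cnjm :: complex^'n^'n \<Rightarrow> _)" for A :: "complex^'n^'n"
    by (intro linear_continuous_on bounded_bilinear.bounded_linear_right[OF bounded_bilinear_matrix_mult]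
        bounded_bilinear.bounded_linear_left[OF bounded_bilinear_matrix_mult] bounded_linear_cnjm)+
  have "closed s"
    unfolding s_def K_def
    by (intro closed_Collect_conj closed_Collect_le closed_Collect_eq continuous_intros cont
        continuous_on_compose2[OF cont(2) cont(3)]) auto
  then have "complete s" by (simp add: complete_eq_closed)
  moreover have "0 \<in> s" using e10 by (simp add: s_def K_def)
  ultimately obtain X where X: "X \<in> s" "F X = X"
  proof -
    assume s: "complete s" "0 \<in> s" and X: "\<And>X. X \<in> s \<Longrightarrow> F X = X \<Longrightarrow> thesis"
    have "F ` s \<subseteq> s" using maps by blast
    moreover have "s \<noteq> {}" using s(2) by blast
    ultimately have "\<exists>!X. X \<in> s \<and> F X = X" using contr by (intro Banach_fix[OF s(1), of "1/2" F]) auto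
    then show thesis using X by blast
  qed
  have x: "norm X \<le> 1 / 4" "C ** X = cnjm X ** C" "norm (K X) \<le> 2 * e1" using X(1) by (auto simp: s_def)
  have eq: "D + 2 *\<^sub>R (D ** X) + D ** (X ** X) - X ** X = 2 *\<^sub>R X"
  proof -
    have "2 *\<^sub>R F X = D + 2 *\<^sub>R (D ** X) + D ** (X ** X) - X ** X" by (simp add: F_def)
    then show ?thesis using X(2) by simp
  qed
  have xD: "norm X \<le> norm D"
  proof -
    have "2 * norm X = norm (D + 2 *\<^sub>R (D ** X) + D ** (X ** X) - X ** X)" unfolding eq by simp
    also have "\<dots> \<le> norm D + 2 * norm (D ** X) + norm (D ** (X ** X)) + norm (X ** X)"
      by (intro norm_triangle_le norm_triangle_le_diff add_mono) simp_all
    also have "\<dots> \<le> norm D + 2 * (norm D * (1/4)) + norm D * (1/4 * (1/4)) + norm X * (1/4)"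
      by (intro add_mono mult_left_mono n2 x) simp_all
    finally show ?thesis using norm_ge_zero[of D] by linarith
  qed
  define C' where "C' = C + C ** X"
  show thesis
  proof
    have "cnjm C' ** C' = cnjm C ** (C + C ** X) + cnjm C ** cnjm X ** (C + C ** X)"
      by (simp add: C'_def cnjm_add cnjm_mult mm_simps)
    also have "cnjm C ** cnjm X ** (C + C ** X) = cnjm C ** (C ** X) + cnjm C ** (C ** (X ** X))"
    proof -
      have "cnjm C ** cnjm X ** C = cnjm C ** (C ** X)" by (simp only: x(2) matrix_mul_assoc)
      moreover have "cnjm C ** cnjm X ** (C ** X) = cnjm C ** (cnjm X ** C) ** X" by (simp only: matrix_mul_assoc)
      moreover have "cnjm C ** (C ** X) ** X = cnjm C ** (C ** (X ** X))" by (simp only: matrix_mul_assoc)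
      ultimately show ?thesis by (simp only: mm_add_right x(2)[symmetric])
    qed
    also have "cnjm C ** (C + C ** X) + \<dots> = cnjm C ** C ** (mat 1 + 2 *\<^sub>R X + X ** X)"
      by (simp only: mm_add_right mm_scaleR_right scaleR_2 matrix_mul_rid matrix_mul_assoc ac_simps)
    also have "cnjm C ** C = mat 1 - D" by (simp add: D_def)
    also have "(mat 1 - D) ** (mat 1 + 2 *\<^sub>R X + X ** X) = mat 1 + 2 *\<^sub>R X - (D + 2 *\<^sub>R (D ** X) + D ** (X ** X) - X ** X)"
      by (simp add: mm_simps scaleR_diff_right)
    finally show "cnjm C' ** C' = mat 1" unfolding eq by simp
    show "norm (C' - C) \<le> norm C * norm (mat 1 - cnjm C ** C)"
      using n2[OF order_refl xD, of C] by (simp add: C'_def D_def)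
    have "cnjm Bt ** C' - C' ** Bt = (cnjm Bt ** C - C ** Bt) + (cnjm Bt ** C - C ** Bt) ** X + C ** K X"
      by (simp add: C'_def K_def mm_simps)
    then have "norm (cnjm Bt ** C' - C' ** Bt) \<le> norm (cnjm Bt ** C - C ** Bt) + norm ((cnjm Bt ** C - C ** Bt) ** X) + norm (C ** K X)"
      using norm_triangle_ineq[of "(cnjm Bt ** C - C ** Bt) + (cnjm Bt ** C - C ** Bt) ** X" "C ** K X"]
        norm_triangle_ineq[of "cnjm Bt ** C - C ** Bt" "(cnjm Bt ** C - C ** Bt) ** X"] by simp
    also have "\<dots> \<le> e + e * (1/4) + norm C * (2 * e1)"
      by (intro add_mono e n2 x order_refl)
    also have "\<dots> \<le> (2 + 4 * (norm C)\<^sup>2) * e"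
      using e0 by (simp add: e1_def power2_eq_square algebra_simps)
    finally show "norm (cnjm Bt ** C' - C' ** Bt) \<le> (2 + 4 * (norm C)\<^sup>2) * e" .
  qed
qed

text \<open>An exact real structure \<open>x \<mapsto> cnj (C x)\<close> is diagonalized by an orthonormal basis of the real
  subspace of its fixed vectors.\<close>

lemma real_structure_basis:
  fixes C :: "complex^'n^'n"
  assumes C: "cnjm C ** C = mat 1"
  obtains P P' :: "complex^'n^'n" where "P ** P' = mat 1" "P' ** P = mat 1" "C ** P = cnjm P" 
    "norm P \<le> (real CARD('n))\<^sup>2" "norm P' \<le> (real CARD('n))\<^sup>2 * (1 + norm C)"
proof -
  define cv where "cv = (\<lambda>x::complex^'n. \<chi> i. cnj (x $ i))"
  define J where "J = (\<lambda>x. cnjm C *v cv x)"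
  have cv_mult: "cv (A *v x) = cnjm A *v cv x" for A x
    by (simp add: cv_def vec_eq_iff matrix_vector_mult_def)
  have cv_cv: "cv (cv x) = x" and norm_cv: "norm (cv x) = norm x" for x
    by (simp_all add: cv_def vec_eq_iff norm_vec_def)
  have cv_lin: "cv (x + y) = cv x + cv y" "cv (r *\<^sub>R x) = r *\<^sub>R cv x" "cv (c *s x) = cnj c *s cv x" for x y r c
    by (simp_all add: cv_def vec_eq_iff)
  have J_add: "J (x + y) = J x + J y" and J_scaleR: "J (r *\<^sub>R x) = r *\<^sub>R J x" and J_scale: "J (c *s x) = cnj c *s J x" for x y r c
    by (simp_all add: J_def cv_lin matrix_vector_right_distrib vector_scalar_commute)
      (simp_all add: vec_eq_iff matrix_vector_mult_def scaleR_sum_right)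
  have JJ: "J (J x) = x" for x
    by (simp add: J_def cv_mult cv_cv matrix_vector_mul_assoc C)
  have norm_J: "norm (J x) \<le> norm C * norm x" for x
    unfolding J_def using norm_matrix_vector_mult[of "cnjm C" "cv x"] by (simp add: norm_cv)
  have linJ: "linear J" by (rule linearI) (simp_all add: J_add J_scaleR)
  have lini: "linear (\<lambda>x::complex^'n. \<i> *s x)"
    by (rule linearI) (simp_all add: vec_eq_iff algebra_simps)
  define V where "V = {x. J x = x}"
  define W where "W = (\<lambda>x. \<i> *s x) ` V"
  have sV: "subspace V"
    unfolding V_def subspace_def using linear_0[OF linJ] by (auto simp: J_add J_scaleR)
  have sW: "subspace W" unfolding W_def by (rule linear_subspace_image[OF lini sV])
  have ii: "\<i> *s (\<i> *s x) = - x" for x :: "complex^'n" by (simp add: vec_eq_iff)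
  \<comment> \<open>V and its multiple by \<i> are the eigenspaces of J for 1 and -1, hence
    complementary real subspaces of the same dimension. So V has real dimension n.\<close>
  have "V \<inter> W = {0}"
  proof -
    have "x = 0" if x: "x \<in> V" "x \<in> W" for x
    proof -
      obtain y where y: "J y = y" "x = \<i> *s y" using x(2) by (auto simp: W_def V_def)
      have "J x = - x" unfolding y(2) J_scale y(1) by (simp add: vec_eq_iff)
      then have "x = - x" using x(1) by (simp add: V_def)
      then show ?thesis by (simp add: vec_eq_iff)
    qed
    then show ?thesis using subspace_0[OF sV] subspace_0[OF sW] by auto
  qed
  moreover have "{x + y | x y. x \<in> V \<and> y \<in> W} = UNIV"
  proof -
    have "\<exists>x y. z = x + y \<and> x \<in> V \<and> y \<in> W" for z
    proof (intro exI conjI)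
      let ?x = "(1/2) *\<^sub>R (z + J z)" and ?y = "(1/2) *\<^sub>R (z - J z)"
      show "z = ?x + ?y" by (simp add: vec_eq_iff complex_eq_iff field_simps)
      show "?x \<in> V" by (simp add: V_def J_scaleR J_add JJ add.commute)
      have "J (- (\<i> *s ?y)) = - (\<i> *s ?y)"
      proof -
        have "J (- x) = - J x" for x using J_scaleR[of "-1" x] by simp
        moreover have "J ?y = - ?y" by (simp add: linear_diff[OF linJ] J_scaleR JJ scaleR_diff_right)
        ultimately show ?thesis by (simp only: J_scale) (simp add: vec_eq_iff)
      qed
      moreover have "?y = \<i> *s (- (\<i> *s ?y))" using ii[of ?y] by (simp add: vec_eq_iff)
      ultimately show "?y \<in> W" unfolding W_def V_def by blast
    qed
    then show ?thesis by blast
  qed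
  moreover have "dim W = dim V"
    unfolding W_def
    by (rule dim_image_eq[OF lini]) (auto simp: inj_on_def vec_eq_iff)
  moreover have "dim {x + y | x y. x \<in> V \<and> y \<in> W} + dim (V \<inter> W) = dim V + dim W"
    by (rule dim_sums_Int[OF sV sW])
  ultimately have "DIM(complex^'n) = 2 * dim V" by simp
  then have dimV: "dim V = CARD('n)" by simp
  obtain Bs where Bs: "Bs \<subseteq> V" "pairwise orthogonal Bs" "\<And>x. x \<in> Bs \<Longrightarrow> norm x = 1" "independent Bs" "card Bs = CARD('n)"
    using orthonormal_basis_subspace[OF sV] dimV by metis
  have fB: "finite Bs" using Bs(4) by (rule independent_imp_finite)
  obtain b where b: "bij_betw b (UNIV :: 'n set) Bs"
    using finite_same_card_bij[OF finite fB] Bs(5) by metis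
  have bV: "J (b j) = b j" and nb: "norm (b j) = 1" for j
    using b Bs by (auto simp: bij_betw_def V_def)
  have inner_b: "b i \<bullet> b j = (if i = j then 1 else 0)" for i j
  proof (cases "i = j")
    case True
    then show ?thesis using nb[of j] by (simp add: dot_square_norm)
  next
    case False
    then have "b i \<noteq> b j" using b by (auto simp: bij_betw_def inj_eq)
    moreover have "b i \<in> Bs" "b j \<in> Bs" using b by (auto simp: bij_betw_def)
    ultimately show ?thesis using Bs(2) False by (auto simp: pairwise_def orthogonal_def)
  qed
  define P where "P = (\<chi> i j. b j $ i)"
  have Pv: "P *v x = (\<Sum>j\<in>UNIV. x $ j *s b j)" for x
    by (simp add: P_def vec_eq_iff matrix_vector_mult_def mult.commute)
  have cvb: "C *v b j = cv (b j)" for j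
  proof -
    have "cv (b j) = cv (J (b j))" by (simp add: bV)
    also have "\<dots> = C *v b j" by (simp add: J_def cv_mult cv_cv)
    finally show ?thesis by simp
  qed
  have CP: "C ** P = cnjm P"
  proof -
    have "(C ** P) $ i $ j = (C *v b j) $ i" for i j
      by (simp add: P_def matrix_entry_mult matrix_vector_mult_def)
    then show ?thesis by (simp add: vec_eq_iff cvb cv_def P_def)
  qed
  have normP: "norm P \<le> (real CARD('n))\<^sup>2"
  proof -
    have "norm (P $ i $ j) \<le> 1" for i j
      using Finite_Cartesian_Product.norm_nth_le[of "b j" i] by (simp add: P_def nb)
    from norm_le_entries[of P, OF this] show ?thesis by (simp add: power2_eq_square)
  qed
  \<comment> \<open>Orthonormality holds for the real inner product only, so P is known to be
    isometric on real coefficient vectors, not on complex ones.\<close>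
  have iso: "norm (P *v (\<chi> j. of_real (a $ j))) = norm a" for a :: "real^'n"
  proof -
    have e: "P *v (\<chi> j. of_real (a $ j)) = (\<Sum>j\<in>UNIV. (a $ j) *\<^sub>R b j)"
      unfolding Pv by (intro sum.cong refl) (simp add: vec_eq_iff, simp add: scaleR_conv_of_real)
    have "(norm (\<Sum>j\<in>UNIV. (a $ j) *\<^sub>R b j))\<^sup>2 = (\<Sum>j\<in>UNIV. a $ j * a $ j)"
      unfolding power2_norm_eq_inner inner_sum_left inner_sum_right inner_scaleR_left inner_scaleR_right inner_b
      by (simp add: if_distrib[of "\<lambda>x. _ * x"] cong: if_cong)
    also have "\<dots> = (norm a)\<^sup>2" by (simp add: power2_norm_eq_inner inner_vec_def)
    finally show ?thesis unfolding e by simp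
  qed
  \<comment> \<open>The real and imaginary parts of x are treated separately by \<open>iso\<close>:
    their images under P are, up to the factors 2 and \<i>, the sum and the difference of y and
    \<open>J y\<close>. This costs the factor \<open>1 + norm C\<close>.\<close>
  have below: "norm x \<le> (1 + norm C) * norm (P *v x)" for x
  proof -
    define y where "y = P *v x"
    define a where "a = (\<chi> j. Re (x $ j))"
    define c where "c = (\<chi> j. Im (x $ j))"
    have Jy: "J y = P *v cv x"
    proof -
      have "J y = cnjm (C ** P) *v cv x" by (simp add: y_def J_def cv_mult matrix_vector_mul_assoc cnjm_mult)
      then show ?thesis by (simp add: CP)
    qed
    have pa: "2 *\<^sub>R (P *v (\<chi> j. of_real (a $ j))) = y + J y"
    proof -
      have "x + cv x = 2 *\<^sub>R (\<chi> j. of_real (a $ j))" by (simp add: vec_eq_iff cv_def a_def complex_eq_iff)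
      then have "P *v (x + cv x) = 2 *\<^sub>R (P *v (\<chi> j. of_real (a $ j)))"
        using linear_scale[OF matrix_vector_mul_linear] by metis
      then show ?thesis unfolding Jy unfolding y_def by (simp add: matrix_vector_right_distrib)
    qed
    have pc: "2 *\<^sub>R (\<i> *s (P *v (\<chi> j. of_real (c $ j)))) = y - J y"
    proof -
      have "x - cv x = 2 *\<^sub>R (\<i> *s (\<chi> j. of_real (c $ j)))"
        by (simp add: vec_eq_iff cv_def c_def complex_diff_cnj complex_eq_iff)
      then have "P *v (x - cv x) = 2 *\<^sub>R (P *v (\<i> *s (\<chi> j. of_real (c $ j))))"
        using linear_scale[OF matrix_vector_mul_linear] by metis
      then show ?thesis unfolding Jy unfolding y_def
        by (simp add: matrix_vector_mult_diff_distrib vector_scalar_commute)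
    qed
    have ni: "norm (\<i> *s v) = norm v" for v :: "complex^'n"
      by (simp add: norm_vec_def norm_mult)
    have "2 * norm a \<le> (1 + norm C) * norm y"
    proof -
      have "2 * norm a = norm (y + J y)" unfolding pa[symmetric] by (simp add: iso)
      also have "\<dots> \<le> norm y + norm C * norm y" using norm_triangle_ineq[of y "J y"] norm_J[of y] by linarith
      finally show ?thesis by (simp add: algebra_simps)
    qed
    moreover have "2 * norm c \<le> (1 + norm C) * norm y"
    proof -
      have "2 * norm c = norm (y - J y)" unfolding pc[symmetric] by (simp add: iso ni)
      also have "\<dots> \<le> norm y + norm C * norm y" using norm_triangle_ineq4[of y "J y"] norm_J[of y] by linarith
      finally show ?thesis by (simp add: algebra_simps)
    qed
    moreover have "norm x \<le> norm a + norm c"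
    proof -
      have "x = (\<chi> j. of_real (a $ j)) + \<i> *s (\<chi> j. of_real (c $ j))"
        by (simp add: vec_eq_iff a_def c_def complex_eq)
      moreover have "norm ((\<chi> j. of_real (r $ j)) :: complex^'n) = norm r" for r :: "real^'n"
        by (simp add: norm_vec_def)
      ultimately show ?thesis using norm_triangle_ineq ni by metis
    qed
    ultimately show ?thesis unfolding y_def by linarith
  qed
  obtain P' where "P ** P' = mat 1" "P' ** P = mat 1" "norm P' \<le> (real CARD('n))\<^sup>2 * (1 + norm C)"
    using bounded_below_inverse[OF below] .
  from that[OF this(1,2) CP normP this(3)] show thesis .
qed

section \<open>The intertwiner between a solution and its conjugate\<close>

definition csol :: "real^'d \<Rightarrow> (real^'d \<Rightarrow> real^'n^'n) \<Rightarrow> (real^'d \<Rightarrow> complex^'n^'n) \<Rightarrow>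
    (real^'d \<Rightarrow> complex^'n^'n) \<Rightarrow> complex^'n^'n \<Rightarrow> bool" where
  "csol \<omega> A Z F B \<longleftrightarrow> periodic_map Z \<and> smooth Z \<and> (\<forall>\<theta>. invertible (Z \<theta>)) \<and> periodic_map F \<and> smooth F \<and>
     (\<forall>\<theta>. dir_deriv \<omega> Z \<theta> = cmat (A \<theta>) ** Z \<theta> - Z \<theta> ** (B + F \<theta>))"

lemma csolD:
  assumes "csol \<omega> A Z F B"
  shows "periodic_map Z" "smooth Z" "invertible (Z \<theta>)" "periodic_map F" "smooth F"
    "dir_deriv \<omega> Z \<theta> = cmat (A \<theta>) ** Z \<theta> - Z \<theta> ** (B + F \<theta>)"
  using assms by (auto simp: csol_def)

lemma dir_deriv_mult_const:
  fixes Z :: "real^'d \<Rightarrow> 'a::real_normed_field^'n^'m"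
  assumes "Z differentiable (at \<theta>)"
  shows "dir_deriv v (\<lambda>\<theta>. Z \<theta> ** Q) \<theta> = dir_deriv v Z \<theta> ** Q"
  using dir_deriv_matrix_mult[OF assms differentiable_const, of v Q] by simp

lemma csol_change_basis:
  assumes sol: "csol \<omega> A Z F B" and Q: "Q ** Q' = mat 1" and BQ: "B ** Q = Q ** T"
  shows "csol \<omega> A (\<lambda>\<theta>. Z \<theta> ** Q) (\<lambda>\<theta>. Q' ** F \<theta> ** Q) T"
    and "matrix_inv (Z \<theta> ** Q) = Q' ** matrix_inv (Z \<theta>)"
proof -
  have inv: "(Z \<theta> ** Q) ** (Q' ** matrix_inv (Z \<theta>)) = mat 1" for \<theta>
  proof -
    have "(Z \<theta> ** Q) ** (Q' ** matrix_inv (Z \<theta>)) = Z \<theta> ** (Q ** Q') ** matrix_inv (Z \<theta>)"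
      by (simp only: matrix_mul_assoc)
    then show ?thesis by (simp add: Q matrix_inv_works csolD[OF sol])
  qed
  then show "matrix_inv (Z \<theta> ** Q) = Q' ** matrix_inv (Z \<theta>)" by (rule matrix_inv_eqI)
  have eq: "dir_deriv \<omega> (\<lambda>\<theta>. Z \<theta> ** Q) \<theta> = cmat (A \<theta>) ** (Z \<theta> ** Q) - Z \<theta> ** Q ** (T + Q' ** F \<theta> ** Q)" for \<theta>
  proof -
    have "Z \<theta> ** Q ** (T + Q' ** F \<theta> ** Q) = Z \<theta> ** (Q ** T) + Z \<theta> ** (Q ** Q') ** F \<theta> ** Q"
      by (simp only: mm_add_right matrix_mul_assoc)
    also have "\<dots> = Z \<theta> ** (B + F \<theta>) ** Q"
      by (simp add: Q BQ[symmetric] mm_add_right mm_add_left matrix_mul_assoc)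
    finally show ?thesis
      by (simp add: dir_deriv_mult_const[OF smooth_differentiable] csolD[OF sol] mm_diff_left matrix_mul_assoc)
  qed
  show "csol \<omega> A (\<lambda>\<theta>. Z \<theta> ** Q) (\<lambda>\<theta>. Q' ** F \<theta> ** Q) T"
    unfolding csol_def
    using periodic_map_comp[OF csolD(1)[OF sol], of "\<lambda>z. z ** Q"] periodic_map_comp[OF csolD(4)[OF sol], of "\<lambda>z. Q' ** z ** Q"] inv eq
    by (auto intro!: smooth_matrix_mult csolD(2,5)[OF sol] invertibleI_right)
qed

definition intertwiner :: "(real^'d \<Rightarrow> complex^'n^'n) \<Rightarrow> real^'d \<Rightarrow> complex^'n^'n" where
  "intertwiner Z \<theta> = cnjm (matrix_inv (Z \<theta>)) ** Z \<theta>"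

lemma intertwiner_conj:
  assumes "\<And>\<theta>. invertible (Z \<theta>)"
  shows "cnjm (Z \<theta>) ** intertwiner Z \<theta> = Z \<theta>" and "cnjm (intertwiner Z \<theta>) ** intertwiner Z \<theta> = mat 1"
proof -
  have "cnjm (Z \<theta>) ** cnjm (matrix_inv (Z \<theta>)) = mat 1"
    by (simp add: matrix_inv_works assms flip: cnjm_mult)
  then show 1: "cnjm (Z \<theta>) ** intertwiner Z \<theta> = Z \<theta>" by (simp add: intertwiner_def matrix_mul_assoc)
  have "cnjm (intertwiner Z \<theta>) ** intertwiner Z \<theta> = matrix_inv (Z \<theta>) ** (cnjm (Z \<theta>) ** intertwiner Z \<theta>)"
    by (simp add: intertwiner_def cnjm_mult matrix_mul_assoc)
  then show "cnjm (intertwiner Z \<theta>) ** intertwiner Z \<theta> = mat 1" by (simp add: 1 matrix_inv_works assms)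
qed

lemma intertwiner_smooth:
  assumes "csol \<omega> A Z F T"
  shows "smooth (intertwiner Z)" "periodic_map (intertwiner Z)"
  unfolding intertwiner_def[abs_def]
  using csolD[OF assms] periodic_map_comp[OF csolD(1)[OF assms], of "\<lambda>z. cnjm (matrix_inv z) ** z"]
  by (auto intro!: smooth_matrix_mult smooth_cnjm smooth_matrix_inv)

text \<open>Since \<open>cmat (A \<theta>)\<close> is its own conjugate, its contributions from Z
  and from the conjugate of the inverse cancel. Only the constant matrix and the error
  survive.\<close>

lemma intertwiner_equation:
  assumes sol: "csol \<omega> A Z F T"
  shows "dir_deriv \<omega> (intertwiner Z) \<theta> = cnjm T ** intertwiner Z \<theta> - intertwiner Z \<theta> ** T
    + (cnjm (F \<theta>) ** intertwiner Z \<theta> - intertwiner Z \<theta> ** F \<theta>)"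
proof -
  note s = csolD[OF sol]
  let ?I = "matrix_inv (Z \<theta>)"
  have si: "smooth (\<lambda>\<theta>. matrix_inv (Z \<theta>))" by (intro smooth_matrix_inv s)
  have "dir_deriv \<omega> (\<lambda>\<theta>. matrix_inv (Z \<theta>)) \<theta> = - (?I ** (cmat (A \<theta>) ** Z \<theta> - Z \<theta> ** (T + F \<theta>)) ** ?I)"
    by (simp add: dir_deriv_matrix_inv[OF s(3) smooth_differentiable[OF s(2)]] s(6))
  also have "\<dots> = (?I ** Z \<theta>) ** (T + F \<theta>) ** ?I - ?I ** cmat (A \<theta>) ** (Z \<theta> ** ?I)"
    by (simp add: mm_diff_left mm_diff_right matrix_mul_assoc)
  also have "\<dots> = (T + F \<theta>) ** ?I - ?I ** cmat (A \<theta>)" by (simp add: matrix_inv_works s(3))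
  finally have dI: "dir_deriv \<omega> (\<lambda>\<theta>. cnjm (matrix_inv (Z \<theta>))) \<theta> = (cnjm T + cnjm (F \<theta>)) ** cnjm ?I - cnjm ?I ** cmat (A \<theta>)"
    by (simp add: dir_deriv_linear[OF bounded_linear_cnjm smooth_differentiable[OF si]] cnjm_diff cnjm_mult cnjm_add)
  have "dir_deriv \<omega> (intertwiner Z) \<theta> = cnjm ?I ** (cmat (A \<theta>) ** Z \<theta> - Z \<theta> ** (T + F \<theta>)) +
      ((cnjm T + cnjm (F \<theta>)) ** cnjm ?I - cnjm ?I ** cmat (A \<theta>)) ** Z \<theta>"
    unfolding intertwiner_def[abs_def]
    by (subst dir_deriv_matrix_mult[OF smooth_differentiable[OF smooth_cnjm[OF si]] smooth_differentiable[OF s(2)]])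
      (simp only: dI s(6))
  also have "\<dots> = cnjm T ** intertwiner Z \<theta> - intertwiner Z \<theta> ** T
    + (cnjm (F \<theta>) ** intertwiner Z \<theta> - intertwiner Z \<theta> ** F \<theta>)"
    by (simp add: intertwiner_def mm_simps)
  finally show ?thesis .
qed

subsection \<open>Fourier coefficients of the intertwiner\<close>

text \<open>The equation for (i, j) involves \<open>c l j\<close> with l after i and
  \<open>c i l\<close> with l before j, and both pairs have a smaller value of (n - f i) + f j. Each
  step divides by the gap and costs a factor X, at most 2 n times in all. The nonresonant pairs G
  must be closed under these couplings for the induction to stay within them.\<close>

lemma triangular_solution_bound:
  fixes T :: "complex^'n^'n" and c g :: "'n \<Rightarrow> 'n \<Rightarrow> complex"
  assumes f: "inj f" "range f \<subseteq> {..<CARD('n)}" and tri: "\<And>i j. T $ i $ j \<noteq> 0 \<Longrightarrow> f i \<le> f j"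
    and eq: "\<And>i j. D * c i j = (\<Sum>l\<in>UNIV. cnj (T $ i $ l) * c l j) - (\<Sum>l\<in>UNIV. c i l * T $ l $ j) + g i j"
    and g: "\<And>i j. norm (g i j) \<le> \<epsilon>" and T: "\<And>i j. norm (T $ i $ j) \<le> L"
    and gap: "\<And>i j. G i j \<Longrightarrow> \<eta> \<le> norm (D - cnj (T $ i $ i) + T $ j $ j)"
    and G: "\<And>i j l. G i j \<Longrightarrow> T $ i $ l \<noteq> 0 \<Longrightarrow> G l j" "\<And>i j l. G i j \<Longrightarrow> T $ l $ j \<noteq> 0 \<Longrightarrow> G i l"
    and \<eta>: "0 < \<eta>" and X: "(2 * real CARD('n) * L + 1) / \<eta> \<le> X" "1 \<le> X" and ij: "G i j"
  shows "norm (c i j) \<le> X ^ (2 * CARD('n)) * \<epsilon>"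
proof -
  have \<epsilon>0: "0 \<le> \<epsilon>" using g[of i j] norm_ge_zero order_trans by blast
  have L0: "0 \<le> L" using T[of i j] norm_ge_zero order_trans by blast
  have fn: "f a < CARD('n)" for a using f(2) by auto
  have "norm (c i j) \<le> X ^ ((CARD('n) - f i) + f j) * \<epsilon>"
    using ij
  proof (induction "(CARD('n) - f i) + f j" arbitrary: i j rule: less_induct)
    case less
    let ?m = "(CARD('n) - f i) + f j"
    have pos: "1 \<le> ?m" using fn[of i] by linarith
    define Y where "Y = X ^ (?m - 1) * \<epsilon>"
    have Y\<epsilon>: "\<epsilon> \<le> Y" using X(2) \<epsilon>0 mult_right_mono[of 1 "X ^ (?m - 1)" \<epsilon>] by (simp add: Y_def one_le_power)
    have Y0: "0 \<le> Y" using Y\<epsilon> \<epsilon>0 by simp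
    have step: "norm (c a b) \<le> Y" if "(CARD('n) - f a) + f b < ?m" "G a b" for a b
    proof -
      have "norm (c a b) \<le> X ^ ((CARD('n) - f a) + f b) * \<epsilon>" by (rule less.hyps[OF that])
      also have "\<dots> \<le> Y" unfolding Y_def
        using that(1) X(2) \<epsilon>0 by (intro mult_right_mono power_increasing) auto
      finally show ?thesis .
    qed
    have s1: "norm (if l = i then 0 else cnj (T $ i $ l) * c l j) \<le> L * Y" for l
    proof (cases "l = i \<or> T $ i $ l = 0")
      case True then show ?thesis using L0 Y0 by auto
    next
      case False
      then have "f i < f l" using tri[of i l] f(1) by (metis injD order_le_imp_less_or_eq)
      then have "norm (c l j) \<le> Y" using False less.prems G(1) fn[of l] by (intro step) auto
      then show ?thesis using False T[of i l] L0 by (auto simp: norm_mult intro!: mult_mono)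
    qed
    have s2: "norm (if l = j then 0 else c i l * T $ l $ j) \<le> L * Y" for l
    proof (cases "l = j \<or> T $ l $ j = 0")
      case True then show ?thesis using L0 Y0 by auto
    next
      case False
      then have "f l < f j" using tri[of l j] f(1) by (metis injD order_le_imp_less_or_eq)
      then have "norm (c i l) \<le> Y" using False less.prems G(2) by (intro step) auto
      then show ?thesis using False T[of l j] Y0 by (auto simp: norm_mult mult.commute[of L] intro!: mult_mono)
    qed
    have r1: "(\<Sum>l\<in>UNIV. cnj (T $ i $ l) * c l j) = cnj (T $ i $ i) * c i j + (\<Sum>l\<in>UNIV. if l = i then 0 else cnj (T $ i $ l) * c l j)"
    proof -
      have "(\<Sum>l\<in>UNIV. cnj (T $ i $ l) * c l j) = (\<Sum>l\<in>UNIV. (if l = i then cnj (T $ i $ i) * c i j else 0) + (if l = i then 0 else cnj (T $ i $ l) * c l j))"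
        by (intro sum.cong) auto
      then show ?thesis by (simp add: sum.distrib)
    qed
    have r2: "(\<Sum>l\<in>UNIV. c i l * T $ l $ j) = c i j * T $ j $ j + (\<Sum>l\<in>UNIV. if l = j then 0 else c i l * T $ l $ j)"
    proof -
      have "(\<Sum>l\<in>UNIV. c i l * T $ l $ j) = (\<Sum>l\<in>UNIV. (if l = j then c i j * T $ j $ j else 0) + (if l = j then 0 else c i l * T $ l $ j))"
        by (intro sum.cong) auto
      then show ?thesis by (simp add: sum.distrib)
    qed
    have "(D - cnj (T $ i $ i) + T $ j $ j) * c i j =
        (\<Sum>l\<in>UNIV. if l = i then 0 else cnj (T $ i $ l) * c l j) - (\<Sum>l\<in>UNIV. if l = j then 0 else c i l * T $ l $ j) + g i j"
      using eq[of i j] unfolding r1 r2 by (simp add: algebra_simps)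
    then have "norm (D - cnj (T $ i $ i) + T $ j $ j) * norm (c i j) =
        norm ((\<Sum>l\<in>UNIV. if l = i then 0 else cnj (T $ i $ l) * c l j) - (\<Sum>l\<in>UNIV. if l = j then 0 else c i l * T $ l $ j) + g i j)"
      by (simp flip: norm_mult)
    also have "\<dots> \<le> real CARD('n) * (L * Y) + real CARD('n) * (L * Y) + \<epsilon>"
      using sum_norm_le[of UNIV, OF s1] sum_norm_le[of UNIV, OF s2] g[of i j]
      by (intro norm_triangle_le norm_triangle_le_diff add_mono) auto
    also have "\<dots> \<le> (2 * real CARD('n) * L + 1) * Y" using Y\<epsilon> by (simp add: algebra_simps)
    finally have "\<eta> * norm (c i j) \<le> (2 * real CARD('n) * L + 1) * Y"
      using gap[OF less.prems] by (meson mult_right_mono norm_ge_zero order_trans)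
    then have "norm (c i j) \<le> (2 * real CARD('n) * L + 1) / \<eta> * Y"
      using \<eta> by (simp add: field_simps)
    also have "\<dots> \<le> X * Y" using X(1) Y0 by (rule mult_right_mono)
    also have "\<dots> = X ^ ?m * \<epsilon>"
    proof -
      have "X * (X ^ (m - 1) * \<epsilon>) = X ^ m * \<epsilon>" if "1 \<le> m" for m using that by (cases m) auto
      from this[OF pos] show ?thesis by (simp only: Y_def)
    qed
    finally show ?case .
  qed
  also have "\<dots> \<le> X ^ (2 * CARD('n)) * \<epsilon>"
    using X(2) \<epsilon>0 fn[of j] by (intro mult_right_mono power_increasing) auto
  finally show ?thesis .
qed

definition diagm :: "('n \<Rightarrow> complex) \<Rightarrow> complex^'n^'n" where
  "diagm v = (\<chi> i j. if i = j then v i else 0)"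

lemma diagm_nth [simp]: "diagm v $ i $ j = (if i = j then v i else 0)"
  by (simp add: diagm_def)

lemma diagm_mult_left [simp]: "(diagm v ** A) $ i $ j = v i * A $ i $ j"
proof -
  have "(diagm v ** A) $ i $ j = (\<Sum>l\<in>UNIV. if l = i then v i * A $ i $ j else 0)"
    unfolding matrix_entry_mult by (rule sum.cong) auto
  then show ?thesis by simp
qed

lemma diagm_mult_right [simp]: "(A ** diagm v) $ i $ j = A $ i $ j * v j"
proof -
  have "(A ** diagm v) $ i $ j = (\<Sum>l\<in>UNIV. if l = j then A $ i $ j * v j else 0)"
    unfolding matrix_entry_mult by (rule sum.cong) auto
  then show ?thesis by simp
qed

text \<open>\<open>Phi\<close> is the diagonal change of variables of the doubled torus that removes the resonances.\<close>

definition Phi :: "('n \<Rightarrow> int^'d) \<Rightarrow> real^'d \<Rightarrow> complex^'n^'n" where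
  "Phi \<kappa> \<theta> = diagm (\<lambda>i. chr (\<kappa> i) \<theta>)"

text \<open>The logarithmic derivative of \<open>Phi\<close> along half of \<omega>: halving the
  direction turns the usual 2 pi into pi.\<close>

definition freqs :: "real^'d \<Rightarrow> ('n \<Rightarrow> int^'d) \<Rightarrow> complex^'n^'n" where
  "freqs \<omega> \<kappa> = diagm (\<lambda>i. pi * \<i> * idot (\<kappa> i) \<omega>)"

lemma double_injective:
  fixes k k' :: "int^'d"
  shows "k + k = k' + k' \<Longrightarrow> k = k'"
  by (simp add: vec_eq_iff)

text \<open>C collects the resonant coefficients of W. On the doubled torus, mode k of entry (i, j)
  between the two diagonal factors has frequency 2 k + \<kappa> i + \<kappa> j, which is 0 exactly
  for the mode kept. The second conclusion is the equation of that mode, where only the coefficient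
  of G is left over.\<close>

lemma intertwiner_almost_constant:
  fixes W G :: "real^'d \<Rightarrow> complex^'n^'n" and T :: "complex^'n^'n" and K L X \<epsilon> \<eta> N :: real
  assumes W: "smooth W" "periodic_map W" "bounded_Cr r N W" and Gs: "smooth G" "\<And>\<theta>. norm (G \<theta>) \<le> \<epsilon>"
    and eq: "\<And>\<theta>. dir_deriv \<omega> W \<theta> = cnjm T ** W \<theta> - W \<theta> ** T + G \<theta>"
    and f: "inj f" "range f \<subseteq> {..<CARD('n)}"
    and T: "\<And>i j. T $ i $ j \<noteq> 0 \<Longrightarrow> f i \<le> f j" "\<And>i j. T $ i $ j \<noteq> 0 \<Longrightarrow> \<kappa> i = \<kappa> j" "norm T \<le> L"
    and \<kappa>: "\<And>i j k. (\<And>l. \<bar>real_of_int (k $ l)\<bar> \<le> K) \<Longrightarrow>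
        \<bar>Im (T $ i $ i) + Im (T $ j $ j) + 2 * pi * idot k \<omega>\<bar> \<le> \<eta> \<Longrightarrow> k + k + \<kappa> i + \<kappa> j = 0"
    and \<eta>: "0 < \<eta>" and X: "(2 * real CARD('n) * L + 1) / \<eta> \<le> X" "1 \<le> X" and r: "2 * CARD('d) \<le> r" and K: "1 \<le> K"
  obtains C where
    "\<And>\<theta>. norm (Phi \<kappa> \<theta> ** W (2 *\<^sub>R \<theta>) ** Phi \<kappa> \<theta> - C) \<le> real CARD('n) * real CARD('n) *
       (5 ^ CARD('d) * (X ^ (2 * CARD('n)) * \<epsilon> * K ^ (2 * CARD('d)) + N / K ^ (r - 2 * CARD('d))))"
    "norm (cnjm (T - freqs \<omega> \<kappa>) ** C - C ** (T - freqs \<omega> \<kappa>)) \<le> real CARD('n) * real CARD('n) * \<epsilon>"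
proof -
  define c where "c = (\<lambda>k i j. fcoef k (\<lambda>\<theta>. W \<theta> $ i $ j))"
  define g where "g = (\<lambda>k i j. fcoef k (\<lambda>\<theta>. G \<theta> $ i $ j))"
  \<comment> \<open>Resonance is encoded by the exact integer equation instead of a small divisor.
    It has at most one solution k for given (i, j).\<close>
  define P where "P = (\<lambda>i j. \<exists>k. k + k + \<kappa> i + \<kappa> j = 0)"
  define k0 where "k0 = (\<lambda>i j. SOME k. k + k + \<kappa> i + \<kappa> j = 0)"
  define C where "C = (\<chi> i j. if P i j then c (k0 i j) i j else 0)"
  have k0: "k0 i j + k0 i j + \<kappa> i + \<kappa> j = 0" if "P i j" for i j
    using that unfolding P_def k0_def by (rule someI_ex)
  have k0_unique: "P i j \<and> k = k0 i j" if "k + k + \<kappa> i + \<kappa> j = 0" for i j k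
  proof -
    have P: "P i j" using that by (auto simp: P_def)
    have "k + k = k0 i j + k0 i j" using that k0[OF P] by (metis add_right_cancel add.assoc)
    then show ?thesis using P double_injective by blast
  qed
  have \<epsilon>0: "0 \<le> \<epsilon>" using Gs(2) norm_ge_zero order_trans by blast
  have bl: "bounded_linear (\<lambda>M::complex^'n^'n. M $ i $ j)" for i j
    using bounded_linear_compose[OF bounded_linear_vec_nth bounded_linear_vec_nth] by blast
  have sW: "smooth (\<lambda>\<theta>. W \<theta> $ i $ j)" and sG: "smooth (\<lambda>\<theta>. G \<theta> $ i $ j)" for i j
    using smooth_nth[OF smooth_nth[OF W(1)]] smooth_nth[OF smooth_nth[OF Gs(1)]] by auto
  have pW: "periodic_map (\<lambda>\<theta>. W \<theta> $ i $ j)" for i j using periodic_map_comp[OF W(2)] .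
  have bW: "bounded_Cr r N (\<lambda>\<theta>. W \<theta> $ i $ j)" for i j
  proof -
    have "norm (M $ i $ j) \<le> 1 * norm M" for M :: "complex^'n^'n" using norm_entry_le[of M i j] by simp
    from bounded_Cr_linear[OF bl W(1,3) this] show ?thesis by simp
  qed
  have cW: "continuous_on UNIV (\<lambda>\<theta>. W \<theta> $ i $ j)" and cG: "continuous_on UNIV (\<lambda>\<theta>. G \<theta> $ i $ j)" for i j
    using sW sG by (auto intro: smooth_continuous_on)
  have g: "norm (g k i j) \<le> \<epsilon>" for k i j
    unfolding g_def using norm_entry_le order_trans Gs(2) by (intro fcoef_norm_le cG) blast
  have modes: "(2 * pi * \<i> * idot k \<omega>) * c k i j = (\<Sum>l\<in>UNIV. cnj (T $ i $ l) * c k l j) - (\<Sum>l\<in>UNIV. c k i l * T $ l $ j) + g k i j" for k i j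
  proof -
    have "(2 * pi * \<i> * idot k \<omega>) * c k i j = fcoef k (dir_deriv \<omega> (\<lambda>\<theta>. W \<theta> $ i $ j))"
      unfolding c_def by (rule fcoef_dir_deriv[OF sW pW, symmetric])
    also have "dir_deriv \<omega> (\<lambda>\<theta>. W \<theta> $ i $ j) = (\<lambda>\<theta>. dir_deriv \<omega> W \<theta> $ i $ j)"
      by (rule dir_deriv_linear[OF bl smooth_differentiable[OF W(1)]])
    also have "\<dots> = (\<lambda>\<theta>. (\<Sum>l\<in>UNIV. cnj (T $ i $ l) * W \<theta> $ l $ j) - (\<Sum>l\<in>UNIV. T $ l $ j * W \<theta> $ i $ l) + G \<theta> $ i $ j)"
      by (simp add: eq matrix_entry_mult mult.commute)
    also have "fcoef k \<dots> = (\<Sum>l\<in>UNIV. cnj (T $ i $ l) * c k l j) - (\<Sum>l\<in>UNIV. T $ l $ j * c k i l) + g k i j"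
      unfolding c_def g_def
      by (subst fcoef_add, (intro continuous_intros cW cG)+, subst fcoef_diff, (intro continuous_intros cW cG)+,
          subst fcoef_sum, (intro continuous_intros cW)+, subst fcoef_sum, (intro continuous_intros cW)+)
        (simp add: fcoef_cmult)
    finally show ?thesis by (simp add: mult.commute)
  qed
  have small: "norm (c k i j) \<le> X ^ (2 * CARD('n)) * \<epsilon>"
    if k: "\<And>l. \<bar>real_of_int (k $ l)\<bar> \<le> K" and ij: "\<not> (P i j \<and> k = k0 i j)" for k i j
  \<comment> \<open>T couples only indices with equal \<kappa>, so nonresonance of (i, j) at
    frequency k passes to every coupled pair. The gap comes from the imaginary part of the divisor
    alone, whatever the real parts of the eigenvalues.\<close>
  proof (rule triangular_solution_bound[where G="\<lambda>i j. k + k + \<kappa> i + \<kappa> j \<noteq> 0" and T=T, OF f T(1) modes g _ _ _ _ \<eta> X])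
    show "norm (T $ i $ j) \<le> L" for i j using norm_entry_le T(3) order_trans by blast
    fix i j assume nz: "k + k + \<kappa> i + \<kappa> j \<noteq> 0"
    then have "\<eta> \<le> \<bar>Im (T $ i $ i) + Im (T $ j $ j) + 2 * pi * idot k \<omega>\<bar>" using \<kappa>[of k i j] k by force
    also have "\<dots> = \<bar>Im (2 * pi * \<i> * idot k \<omega> - cnj (T $ i $ i) + T $ j $ j)\<bar>" by (simp add: algebra_simps)
    also have "\<dots> \<le> norm (2 * pi * \<i> * idot k \<omega> - cnj (T $ i $ i) + T $ j $ j)" by (rule abs_Im_le_cmod)
    finally show "\<eta> \<le> norm (2 * pi * \<i> * idot k \<omega> - cnj (T $ i $ i) + T $ j $ j)" .
    show "k + k + \<kappa> l + \<kappa> j \<noteq> 0" if "T $ i $ l \<noteq> 0" for l using nz T(2)[OF that] by simp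
    show "k + k + \<kappa> i + \<kappa> l \<noteq> 0" if "T $ l $ j \<noteq> 0" for l using nz T(2)[OF that] by simp
  next
    show "k + k + \<kappa> i + \<kappa> j \<noteq> 0" using ij k0_unique by blast
  qed
  let ?B = "5 ^ CARD('d) * (X ^ (2 * CARD('n)) * \<epsilon> * K ^ (2 * CARD('d)) + N / K ^ (r - 2 * CARD('d)))"
  have close: "norm (W \<theta> $ i $ j - C $ i $ j * chr (k0 i j) \<theta>) \<le> ?B" for \<theta> i j
  proof -
    have "norm (W \<theta> $ i $ j - (if P i j then fcoef (k0 i j) (\<lambda>\<theta>. W \<theta> $ i $ j) else 0) * chr (k0 i j) \<theta>) \<le> ?B"
      using X(2) \<epsilon>0 small by (intro fourier_remainder_bound[OF sW pW bW r K]) (auto simp: c_def)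
    then show ?thesis by (cases "P i j") (simp_all add: C_def c_def)
  qed
  show thesis
  proof
    fix \<theta>
    have "norm ((Phi \<kappa> \<theta> ** W (2 *\<^sub>R \<theta>) ** Phi \<kappa> \<theta> - C) $ i $ j) \<le> ?B" for i j
    proof -
      let ?u = "chr (\<kappa> i) \<theta> * chr (\<kappa> j) \<theta>"
      have C: "C $ i $ j * chr (k0 i j) (2 *\<^sub>R \<theta>) * ?u = C $ i $ j"
      proof (cases "P i j")
        case True
        have "chr (k0 i j) (2 *\<^sub>R \<theta>) * ?u = chr (k0 i j + k0 i j + \<kappa> i + \<kappa> j) \<theta>"
          by (simp only: chr_double chr_add_left mult.assoc)
        then show ?thesis by (simp only: k0[OF True] mult.assoc chr_zero mult_1_right)
      qed (simp add: C_def)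
      have "(Phi \<kappa> \<theta> ** W (2 *\<^sub>R \<theta>) ** Phi \<kappa> \<theta> - C) $ i $ j = (W (2 *\<^sub>R \<theta>) $ i $ j - C $ i $ j * chr (k0 i j) (2 *\<^sub>R \<theta>)) * ?u"
        using C by (simp add: Phi_def algebra_simps)
      then show ?thesis using close[of "2 *\<^sub>R \<theta>" i j] by (simp add: norm_mult)
    qed
    then show "norm (Phi \<kappa> \<theta> ** W (2 *\<^sub>R \<theta>) ** Phi \<kappa> \<theta> - C) \<le> real CARD('n) * real CARD('n) * ?B"
      by (rule norm_le_entries)
  next
    have "norm ((cnjm (T - freqs \<omega> \<kappa>) ** C - C ** (T - freqs \<omega> \<kappa>)) $ i $ j) \<le> \<epsilon>" for i j
    proof -
      have e: "(cnjm (T - freqs \<omega> \<kappa>) ** C - C ** (T - freqs \<omega> \<kappa>)) $ i $ j =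
          (\<Sum>l\<in>UNIV. cnj (T $ i $ l) * C $ l $ j) - (\<Sum>l\<in>UNIV. C $ i $ l * T $ l $ j) + pi * \<i> * idot (\<kappa> i + \<kappa> j) \<omega> * C $ i $ j"
      proof -
        have "cnjm (freqs \<omega> \<kappa>) = diagm (\<lambda>i. - (pi * \<i> * idot (\<kappa> i) \<omega>))"
          by (simp add: vec_eq_iff freqs_def)
        then show ?thesis
          by (simp add: cnjm_diff mm_diff_left mm_diff_right freqs_def idot_add_left algebra_simps)
            (simp add: matrix_entry_mult mult.commute)
      qed
      show ?thesis
      proof (cases "P i j")
        case True
        have k2: "\<kappa> i + \<kappa> j = - (k0 i j + k0 i j)"
          using k0[OF True] by (metis add.assoc add_eq_0_iff)
        \<comment> \<open>Coupled pairs have the same shift sum and hence the same resonant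
          frequency, so all coefficients in the equation belong to one mode of W.\<close>
        have C1: "cnj (T $ i $ l) * C $ l $ j = cnj (T $ i $ l) * c (k0 i j) l j" for l
        proof (cases "T $ i $ l = 0")
          case False
          then have "\<kappa> i = \<kappa> l" by (rule T(2))
          then have "P l j" "k0 l j = k0 i j" using True by (simp_all add: P_def k0_def)
          then show ?thesis by (simp add: C_def)
        qed simp
        have C2: "C $ i $ l * T $ l $ j = c (k0 i j) i l * T $ l $ j" for l
        proof (cases "T $ l $ j = 0")
          case False
          then have "\<kappa> l = \<kappa> j" by (rule T(2))
          then have "P i l" "k0 i l = k0 i j" using True by (simp_all add: P_def k0_def)
          then show ?thesis by (simp add: C_def)
        qed simp
        \<comment> \<open>By \<open>k2\<close>, pi times the shift sum is -2 pi times the resonant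
          frequency, so the term from \<open>freqs\<close> is the derivative term of that
          mode.\<close>
        have "(cnjm (T - freqs \<omega> \<kappa>) ** C - C ** (T - freqs \<omega> \<kappa>)) $ i $ j = - g (k0 i j) i j"
          unfolding e C1 C2 k2 idot_minus_left idot_add_left
          using modes[of "k0 i j" i j] True by (simp add: C_def algebra_simps)
        then show ?thesis using g by simp
      next
        case False
        have C1: "cnj (T $ i $ l) * C $ l $ j = 0" for l
          using False T(2)[of i l] by (cases "T $ i $ l = 0") (simp_all add: C_def P_def)
        have C2: "C $ i $ l * T $ l $ j = 0" for l
          using False T(2)[of l j] by (cases "T $ l $ j = 0") (simp_all add: C_def P_def)
        show ?thesis unfolding e C1 C2 using False \<epsilon>0 by (simp add: C_def)
      qed
    qed
    then show "norm (cnjm (T - freqs \<omega> \<kappa>) ** C - C ** (T - freqs \<omega> \<kappa>)) \<le> real CARD('n) * real CARD('n) * \<epsilon>"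
      by (rule norm_le_entries)
  qed
qed

section \<open>Passing to a real solution\<close>

lemma Phi_smooth: "smooth (Phi \<kappa>)"
proof (intro smooth_vec)
  fix i j
  show "smooth (\<lambda>\<theta>. Phi \<kappa> \<theta> $ i $ j)"
    using smooth_chr[of "\<kappa> i"] by (cases "i = j") (simp_all add: Phi_def)
qed

lemma Phi_periodic:
  fixes \<kappa> :: "'n::finite \<Rightarrow> int^'d"
  shows "periodic_map (Phi \<kappa>)"
proof -
  have "chr k (\<theta> + axis i 1) = chr k \<theta>" for k :: "int^'d" and \<theta> i
    using periodic_map_chr[of k] by (simp add: periodic_map_def)
  then show ?thesis by (simp add: periodic_map_def Phi_def)
qed

lemma cnjm_Phi: "cnjm (Phi \<kappa> \<theta>) ** Phi \<kappa> \<theta> = mat 1" "Phi \<kappa> \<theta> ** cnjm (Phi \<kappa> \<theta>) = mat 1"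
proof -
  have "cnjm (Phi \<kappa> \<theta>) = diagm (\<lambda>i. cnj (chr (\<kappa> i) \<theta>))" by (simp add: Phi_def vec_eq_iff)
  then show "cnjm (Phi \<kappa> \<theta>) ** Phi \<kappa> \<theta> = mat 1" "Phi \<kappa> \<theta> ** cnjm (Phi \<kappa> \<theta>) = mat 1"
    by (simp_all add: vec_eq_iff mat_nth Phi_def)
qed

lemma bounded_Cr_vec_entries:
  fixes f :: "real^'d \<Rightarrow> 'a::real_normed_vector^'n^'m"
  assumes "smooth f" "\<And>i j. bounded_Cr r K (\<lambda>\<theta>. f \<theta> $ i $ j)"
  shows "bounded_Cr r (real CARD('m) * real CARD('n) * K) f"
  unfolding bounded_Cr_def
proof (intro allI impI norm_le_entries)
  fix "is" :: "'d list" and \<theta> i j assume "length is \<le> r"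
  have bl: "bounded_linear (\<lambda>M::'a^'n^'m. M $ i $ j)"
    using bounded_linear_compose[OF bounded_linear_vec_nth bounded_linear_vec_nth] by blast
  have "dpart is f \<theta> $ i $ j = dpart is (\<lambda>\<theta>. f \<theta> $ i $ j) \<theta>"
    by (simp add: dpart_linear[OF bl assms(1)])
  then show "norm (dpart is f \<theta> $ i $ j) \<le> K"
    using assms(2) \<open>length is \<le> r\<close> by (simp add: bounded_Cr_def)
qed

lemma Phi_bounded:
  fixes \<kappa> :: "'n::finite \<Rightarrow> int^'d"
  assumes "\<And>i l. 2 * pi * \<bar>of_int (\<kappa> i $ l)\<bar> \<le> X" "1 \<le> X"
  shows "bounded_Cr r (real CARD('n) * real CARD('n) * X ^ r) (Phi \<kappa>)"
proof (rule bounded_Cr_vec_entries[OF Phi_smooth])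
  fix i j
  show "bounded_Cr r (X ^ r) (\<lambda>\<theta>. Phi \<kappa> \<theta> $ i $ j)"
  proof (cases "i = j")
    case True
    then show ?thesis using bounded_Cr_chr[of "\<kappa> i" X r] assms by (simp add: Phi_def eta_contract_eq)
  next
    case False
    then show ?thesis using assms(2) by (simp add: Phi_def bounded_Cr_const)
  qed
qed

lemma dir_deriv_Phi:
  "dir_deriv ((1/2) *\<^sub>R \<omega>) (Phi \<kappa>) \<theta> = freqs \<omega> \<kappa> ** Phi \<kappa> \<theta>"
proof -
  have "dir_deriv ((1/2) *\<^sub>R \<omega>) (Phi \<kappa>) \<theta> $ i $ j = (freqs \<omega> \<kappa> ** Phi \<kappa> \<theta>) $ i $ j" for i j
  proof -
    have bl: "bounded_linear (\<lambda>M::complex^'a^'a. M $ i $ j)"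
      using bounded_linear_compose[OF bounded_linear_vec_nth bounded_linear_vec_nth] by blast
    have "dir_deriv ((1/2) *\<^sub>R \<omega>) (Phi \<kappa>) \<theta> $ i $ j = dir_deriv ((1/2) *\<^sub>R \<omega>) (\<lambda>\<theta>. Phi \<kappa> \<theta> $ i $ j) \<theta>"
      by (simp add: dir_deriv_linear[OF bl smooth_differentiable[OF Phi_smooth]])
    also have "\<dots> = (freqs \<omega> \<kappa> ** Phi \<kappa> \<theta>) $ i $ j"
      by (cases "i = j") (simp_all add: Phi_def freqs_def dir_deriv_chr idot_scaleR)
    finally show ?thesis .
  qed
  then show ?thesis by (simp add: vec_eq_iff)
qed

text \<open>After the change of variables both the conjugation and the constant matrix are real up
  to small errors, and as A is real the real part can be taken in the equation. The condition
  \<open>L ^ 14 * \<delta> \<le> 1\<close> pays for the powers of L that multiply \<delta> before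
  the real part is shown to be invertible.\<close>

lemma realify:
  fixes A :: "real^'d \<Rightarrow> real^'n^'n" and Z F :: "real^'d \<Rightarrow> complex^'n^'n" and L \<delta> \<epsilon> :: real
  defines "V \<equiv> \<lambda>\<kappa> \<theta>. Phi \<kappa> \<theta> ** intertwiner Z (2 *\<^sub>R \<theta>) ** Phi \<kappa> \<theta>"
  assumes sol: "csol \<omega> A Z F T" and \<kappa>: "\<And>i j. T $ i $ j \<noteq> 0 \<Longrightarrow> \<kappa> i = \<kappa> j"
    and L: "2 \<le> L" "real CARD('n) * real CARD('n) \<le> L" "4 ^ R \<le> L"
    and Z: "bounded_Cr R L Z" "\<And>\<theta>. norm (matrix_inv (Z \<theta>)) \<le> L"
    and F: "bounded_Cr R \<epsilon> F" and P: "bounded_Cr R L (Phi \<kappa>)"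
    and V: "\<And>\<theta>. norm (V \<kappa> \<theta>) \<le> L" "\<And>\<theta>. norm (V \<kappa> \<theta> - C) \<le> \<delta>" "L ^ 14 * \<delta> \<le> 1"
    and C: "norm (cnjm (T - freqs \<omega> \<kappa>) ** C - C ** (T - freqs \<omega> \<kappa>)) \<le> L * \<epsilon>"
  obtains Z' F' :: "real^'d \<Rightarrow> real^'n^'n" and B' :: "real^'n^'n" where
    "periodic_map Z'" "smooth Z'" "\<And>\<theta>. invertible (Z' \<theta>)" "periodic_map F'" "smooth F'"
    "\<And>\<theta>. dir_deriv ((1/2) *\<^sub>R \<omega>) Z' \<theta> = A (2 *\<^sub>R \<theta>) ** Z' \<theta> - Z' \<theta> ** (B' + F' \<theta>)"
    "bounded_Cr R (L ^ 6) Z'" "bounded_Cr R (L ^ (10 * 3 ^ R)) (\<lambda>\<theta>. matrix_inv (Z' \<theta>))"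
    "bounded_Cr R (L ^ (10 * 3 ^ R + 26) * \<epsilon>) F'"
proof -
  let ?V = "V \<kappa>" and ?W = "intertwiner Z" and ?\<Phi> = "Phi \<kappa>"
  note s = csolD[OF sol]
  have L0: "0 \<le> L" "1 \<le> L" using L(1) by auto
  have \<epsilon>0: "0 \<le> \<epsilon>" using F by (rule bounded_Cr_nonneg)
  have \<delta>0: "0 \<le> \<delta>" using V(2) norm_ge_zero order_trans by blast
  have pw: "L ^ a \<le> L ^ b" if "a \<le> b" for a b using L0 that by (simp add: power_increasing)
  have pd: "L ^ a * \<delta> \<le> 1" if "a \<le> 14" for a
    using mult_right_mono[OF pw[OF that] \<delta>0] V(3) by simp
  have mb: "norm (X ** Y) \<le> a * b" if "norm X \<le> a" "norm Y \<le> b" for X Y :: "complex^'n^'n" and a b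
    using norm_matrix_mult[of X Y] mult_mono[OF that] order_trans[OF norm_ge_zero that(1)] by (auto intro: order_trans)

  have VV: "cnjm (?V \<theta>) ** ?V \<theta> = mat 1" for \<theta>
  proof -
    have "cnjm (?V \<theta>) ** ?V \<theta> = cnjm (?\<Phi> \<theta>) ** cnjm (?W (2 *\<^sub>R \<theta>)) ** (cnjm (?\<Phi> \<theta>) ** ?\<Phi> \<theta>) ** ?W (2 *\<^sub>R \<theta>) ** ?\<Phi> \<theta>"
      by (simp only: V_def cnjm_mult matrix_mul_assoc)
    also have "\<dots> = cnjm (?\<Phi> \<theta>) ** (cnjm (?W (2 *\<^sub>R \<theta>)) ** ?W (2 *\<^sub>R \<theta>)) ** ?\<Phi> \<theta>"
      by (simp add: cnjm_Phi matrix_mul_assoc)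
    finally show ?thesis by (simp add: intertwiner_conj(2)[of Z, OF s(3)] cnjm_Phi)
  qed
  have CV: "norm C \<le> L + 1"
    using norm_triangle_ineq4[of "?V 0" "?V 0 - C"] V(1)[of 0] V(2)[of 0] pd[of 0] by simp
  have L2: "L + 1 \<le> L ^ 2"
  proof -
    have "2 * L \<le> L * L" using L by (intro mult_right_mono) auto
    then show ?thesis using L(1) unfolding power2_eq_square by linarith
  qed
  have CL: "norm C \<le> L ^ 2" using CV L2 by simp
  have L3: "L + L ^ 2 \<le> L ^ 3"
  proof -
    have "L + L ^ 2 \<le> L ^ 2 + L ^ 2" using L2 by simp
    also have "\<dots> = 2 * L ^ 2" by simp
    also have "\<dots> \<le> L * L ^ 2" using L by (intro mult_right_mono) auto
    finally show ?thesis by (simp add: power3_eq_cube power2_eq_square)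
  qed
  have D: "norm (mat 1 - cnjm C ** C) \<le> L ^ 3 * \<delta>"
  proof -
    have "mat 1 - cnjm C ** C = cnjm (?V 0 - C) ** ?V 0 + cnjm C ** (?V 0 - C)"
      unfolding VV[of 0, symmetric] by (simp add: cnjm_diff mm_simps)
    then have "norm (mat 1 - cnjm C ** C) \<le> norm (cnjm (?V 0 - C) ** ?V 0) + norm (cnjm C ** (?V 0 - C))"
      using norm_triangle_ineq by metis
    also have "\<dots> \<le> \<delta> * L + L ^ 2 * \<delta>"
      using V CL by (intro add_mono mb) simp_all
    also have "\<dots> = (L + L ^ 2) * \<delta>" by (simp add: algebra_simps)
    also have "\<dots> \<le> L ^ 3 * \<delta>" using L3 \<delta>0 by (rule mult_right_mono)
    finally show ?thesis .
  qed
  have D16: "norm (mat 1 - cnjm C ** C) \<le> 1 / 16"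
  proof -
    have "16 \<le> L ^ 4" using power_mono[of 2 L 4] L by simp
    then have "16 * (L ^ 3 * \<delta>) \<le> L ^ 4 * (L ^ 3 * \<delta>)" using L0 \<delta>0 by (intro mult_right_mono) auto
    also have "\<dots> = L ^ 7 * \<delta>" by (simp flip: power_add mult.assoc)
    also have "\<dots> \<le> 1" by (rule pd) simp
    finally show ?thesis using D by simp
  qed
  obtain C' where C': "cnjm C' ** C' = mat 1" "norm (C' - C) \<le> norm C * norm (mat 1 - cnjm C ** C)"
    "norm (cnjm (T - freqs \<omega> \<kappa>) ** C' - C' ** (T - freqs \<omega> \<kappa>)) \<le> (2 + 4 * (norm C)\<^sup>2) * (L * \<epsilon>)"
    by (rule real_structure_correction[OF D16 C])
  have CC: "norm (C' - C) \<le> L ^ 5 * \<delta>"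
  proof -
    have "norm C * norm (mat 1 - cnjm C ** C) \<le> L ^ 2 * (L ^ 3 * \<delta>)"
      using CL D L0 by (intro mult_mono) auto
    also have "\<dots> = L ^ 5 * \<delta>" by (simp flip: power_add mult.assoc)
    finally show ?thesis using C'(2) by simp
  qed
  have C'L: "norm C' \<le> L ^ 3"
  proof -
    have "norm C' \<le> norm C + norm (C' - C)" using norm_triangle_ineq[of C "C' - C"] by simp
    also have "\<dots> \<le> L ^ 2 + 1" using CL CC pd[of 5] by simp
    also have "\<dots> \<le> L ^ 3" using L3 L by simp
    finally show ?thesis .
  qed
  have VC': "norm (?V \<theta> - C') \<le> L ^ 6 * \<delta>" for \<theta>
  proof -
    have "norm (?V \<theta> - C') \<le> norm (?V \<theta> - C) + norm (C' - C)"
      using norm_triangle_ineq4[of "?V \<theta> - C" "C' - C"] by simp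
    also have "\<dots> \<le> \<delta> + L ^ 5 * \<delta>" using V(2)[of \<theta>] CC by simp
    also have "\<dots> \<le> L ^ 5 * \<delta> + L ^ 5 * \<delta>" using mult_right_mono[OF one_le_power[OF L0(2), of 5] \<delta>0] by (simp add: mult.commute)
    also have "\<dots> = 2 * (L ^ 5 * \<delta>)" by simp
    also have "\<dots> \<le> L * (L ^ 5 * \<delta>)" using L L0 \<delta>0 by (intro mult_right_mono) auto
    finally show ?thesis by (simp flip: mult.assoc power_Suc)
  qed
  obtain P P' :: "complex^'n^'n" where PP: "P ** P' = mat 1" "P' ** P = mat 1" "C' ** P = cnjm P"
    "norm P \<le> (real CARD('n))\<^sup>2" "norm P' \<le> (real CARD('n))\<^sup>2 * (1 + norm C')"
    by (rule real_structure_basis[OF C'(1)])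
  have PL: "norm P \<le> L" using PP(4) L(2) by (simp add: power2_eq_square)
  have P'L: "norm P' \<le> L ^ 5"
  proof -
    have "1 + norm C' \<le> L ^ 3 + L ^ 3" using C'L one_le_power[OF L0(2), of 3] by simp
    also have "\<dots> = 2 * L ^ 3" by simp
    also have "\<dots> \<le> L * L ^ 3" using L L0 by (intro mult_right_mono) auto
    finally have "(real CARD('n))\<^sup>2 * (1 + norm C') \<le> L * (L * L ^ 3)"
      using L(2) L0 by (intro mult_mono) (auto simp: power2_eq_square)
    also have "\<dots> = L ^ 5" by (simp flip: power_Suc)
    finally show ?thesis using PP(5) by simp
  qed
  have PPc: "cnjm P ** cnjm P' = mat 1" using PP(1) by (metis cnjm_mat cnjm_mult)
  have P'c: "cnjm P' = P' ** cnjm C'"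
  proof -
    have "P' ** cnjm C' = (P' ** cnjm C') ** (cnjm P ** cnjm P')" by (simp add: PPc)
    also have "\<dots> = P' ** (cnjm C' ** C') ** P ** cnjm P'" by (simp only: PP(3)[symmetric] matrix_mul_assoc)
    also have "\<dots> = cnjm P'" by (simp add: C'(1) PP(2))
    finally show ?thesis by simp
  qed

  \<comment> \<open>In the coordinates given by P the real structure \<open>C'\<close> is plain
    conjugation, so H is close to its own conjugate.\<close>
  define H where "H = (\<lambda>\<theta>. Z (2 *\<^sub>R \<theta>) ** ?\<Phi> \<theta> ** P)"
  define Z' where "Z' = (\<lambda>\<theta>. Rem (H \<theta>))"
  define R1 where "R1 = (\<lambda>\<theta>. Z (2 *\<^sub>R \<theta>) ** F (2 *\<^sub>R \<theta>) ** ?\<Phi> \<theta> ** P)"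
  define B'' where "B'' = P' ** (T - freqs \<omega> \<kappa>) ** P"
  define J where "J = B'' - cmat (Rem B'')"
  \<comment> \<open>The imaginary part \<open>J\<close> of the constant matrix and the transformed
    old error are both moved into \<open>F'\<close>, so that the equation for \<open>Z'\<close>
    holds exactly.\<close>
  define F' where "F' = (\<lambda>\<theta>. matrix_inv (Z' \<theta>) ** Rem (H \<theta> ** J + R1 \<theta>))"
  have sZ2: "smooth (\<lambda>\<theta>. Z (2 *\<^sub>R \<theta>))" by (rule smooth_scale[OF s(2)])
  have sF2: "smooth (\<lambda>\<theta>. F (2 *\<^sub>R \<theta>))" by (rule smooth_scale[OF s(5)])
  have sH: "smooth H" unfolding H_def by (intro smooth_matrix_mult sZ2 Phi_smooth smooth_const)
  have pH: "periodic_map H" unfolding H_def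
    using periodic_map_comp2[OF periodic_map_double[OF s(1)] Phi_periodic, of "\<lambda>a b. a ** b ** P"] .
  have sZ': "smooth Z'" unfolding Z'_def by (rule smooth_Rem[OF sH])
  have pZ': "periodic_map Z'" unfolding Z'_def by (rule periodic_map_comp[OF pH])
  have sR1: "smooth R1" unfolding R1_def by (intro smooth_matrix_mult sZ2 sF2 Phi_smooth smooth_const)
  have pR1: "periodic_map R1" unfolding R1_def
    using periodic_map_comp2[OF periodic_map_comp2[OF periodic_map_double[OF s(1)] periodic_map_double[OF s(4)], of "(**)"] Phi_periodic, of "\<lambda>a b. a ** b ** P"] .
  have \<Phi>L: "norm (?\<Phi> \<theta>) \<le> L" for \<theta> using P by (rule bounded_Cr_norm)

  have inv: "\<exists>Y. Z' \<theta> ** Y = mat 1 \<and> norm Y \<le> L ^ 9" for \<theta>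
  proof -
    \<comment> \<open>Twice the real part of H turns out to be the conjugate of H times
      \<open>2 *\<^sub>R mat 1 + E\<close>, so E is the relative error that has to be at most
      1.\<close>
    define E where "E = cnjm P' ** (?V \<theta> - C') ** P"
    have "norm E \<le> L ^ 5 * (L ^ 6 * \<delta>) * L"
      unfolding E_def using P'L VC' PL by (intro mb) simp_all
    also have "\<dots> = L ^ 12 * \<delta>" by (simp add: eval_nat_numeral)
    also have "\<dots> \<le> 1" by (rule pd) simp
    finally obtain N where N: "(2 *\<^sub>R mat 1 + E) ** N = mat 1" "norm N \<le> (real CARD('n))\<^sup>2"
      by (rule inverse_near_two)
    let ?Zi = "cnjm (matrix_inv (Z (2 *\<^sub>R \<theta>)))" and ?Zc = "cnjm (Z (2 *\<^sub>R \<theta>))"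
    define Y where "Y = 2 *\<^sub>R (N ** cnjm P' ** ?\<Phi> \<theta> ** ?Zi)"
    have "cnjm P ** (2 *\<^sub>R mat 1 + E) = 2 *\<^sub>R cnjm P + (cnjm P ** cnjm P') ** ((?V \<theta> - C') ** P)"
      unfolding E_def by (simp only: mm_add_right mm_scaleR_right matrix_mul_rid matrix_mul_assoc)
    also have "\<dots> = ?V \<theta> ** P + cnjm P" by (simp add: PPc mm_diff_left PP(3) scaleR_2)
    finally have e1: "?V \<theta> ** P + cnjm P = cnjm P ** (2 *\<^sub>R mat 1 + E)" by simp
    have e2: "H \<theta> = ?Zc ** cnjm (?\<Phi> \<theta>) ** (?V \<theta> ** P)"
    proof -
      have "?Zc ** cnjm (?\<Phi> \<theta>) ** (?V \<theta> ** P) = ?Zc ** (cnjm (?\<Phi> \<theta>) ** ?\<Phi> \<theta>) ** ?W (2 *\<^sub>R \<theta>) ** ?\<Phi> \<theta> ** P"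
        by (simp only: V_def matrix_mul_assoc)
      also have "\<dots> = (?Zc ** ?W (2 *\<^sub>R \<theta>)) ** ?\<Phi> \<theta> ** P" by (simp add: cnjm_Phi)
      finally show ?thesis by (simp add: H_def intertwiner_conj(1)[of Z, OF s(3)])
    qed
    have e3: "cnjm (H \<theta>) = ?Zc ** cnjm (?\<Phi> \<theta>) ** cnjm P" by (simp add: H_def cnjm_mult)
    have "2 *\<^sub>R cmat (Z' \<theta>) = ?Zc ** cnjm (?\<Phi> \<theta>) ** (?V \<theta> ** P + cnjm P)"
      unfolding Z'_def cmat_Rem e3 by (subst e2) (simp only: mm_add_right)
    then have e4: "2 *\<^sub>R cmat (Z' \<theta>) = ?Zc ** cnjm (?\<Phi> \<theta>) ** cnjm P ** (2 *\<^sub>R mat 1 + E)"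
      unfolding e1 by (simp only: matrix_mul_assoc)
    have "cmat (Z' \<theta>) ** Y = (2 *\<^sub>R cmat (Z' \<theta>)) ** (N ** cnjm P' ** ?\<Phi> \<theta> ** ?Zi)"
      by (simp add: Y_def mm_scaleR_left mm_scaleR_right)
    also have "\<dots> = ?Zc ** cnjm (?\<Phi> \<theta>) ** cnjm P ** ((2 *\<^sub>R mat 1 + E) ** N) ** cnjm P' ** ?\<Phi> \<theta> ** ?Zi"
      unfolding e4 by (simp only: matrix_mul_assoc)
    also have "\<dots> = ?Zc ** cnjm (?\<Phi> \<theta>) ** (cnjm P ** cnjm P') ** ?\<Phi> \<theta> ** ?Zi"
      unfolding N(1) by (simp only: matrix_mul_rid matrix_mul_assoc)
    also have "\<dots> = ?Zc ** (cnjm (?\<Phi> \<theta>) ** ?\<Phi> \<theta>) ** ?Zi"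
      unfolding PPc by (simp only: matrix_mul_rid matrix_mul_assoc)
    also have "\<dots> = mat 1"
      unfolding cnjm_Phi by (simp add: matrix_inv_works s(3) flip: cnjm_mult)
    finally have "Z' \<theta> ** Rem Y = mat 1" using Rem_mult_left[of "Z' \<theta>" Y] by simp
    moreover have "norm (Rem Y) \<le> L ^ 9"
    proof -
      have NL: "norm N \<le> L" using N(2) L(2) by (simp add: power2_eq_square)
      have "norm (N ** cnjm P' ** ?\<Phi> \<theta> ** ?Zi) \<le> L * L ^ 5 * L * L"
        using NL P'L \<Phi>L Z(2) by (intro mb) simp_all
      then have "norm Y \<le> 2 * (L * L ^ 5 * L * L)" unfolding Y_def by simp
      also have "\<dots> \<le> L * (L * L ^ 5 * L * L)" using L L0 by (intro mult_right_mono) auto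
      also have "\<dots> = L ^ 9" by (simp flip: power_Suc power_Suc2)
      finally show ?thesis using norm_Rem[of Y] by simp
    qed
    ultimately show ?thesis by blast
  qed
  have invZ': "invertible (Z' \<theta>)" for \<theta> using inv[of \<theta>] invertibleI_right by blast
  have norm_inv: "norm (matrix_inv (Z' \<theta>)) \<le> L ^ 9" for \<theta> using inv[of \<theta>] matrix_inv_eqI by metis
  have sF': "smooth F'" unfolding F'_def
    by (intro smooth_matrix_mult smooth_matrix_inv invZ' sZ' smooth_Rem smooth_add sH sR1 smooth_const)
  have pF': "periodic_map F'" unfolding F'_def
    using pZ' pH pR1 by (simp add: periodic_map_def)

  have eq: "dir_deriv ((1/2) *\<^sub>R \<omega>) Z' \<theta> = A (2 *\<^sub>R \<theta>) ** Z' \<theta> - Z' \<theta> ** (Rem B'' + F' \<theta>)" for \<theta>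
  proof -
    let ?Z2 = "\<lambda>\<theta>. Z (2 *\<^sub>R \<theta>)"
    note s2 = sZ2
    have dZ: "dir_deriv ((1/2) *\<^sub>R \<omega>) ?Z2 \<theta> = cmat (A (2 *\<^sub>R \<theta>)) ** ?Z2 \<theta> - ?Z2 \<theta> ** (T + F (2 *\<^sub>R \<theta>))"
      using dir_deriv_scale[OF smooth_differentiable[OF s(2)], of "(1/2) *\<^sub>R \<omega>" 2 \<theta>] by (simp add: s(6))
    \<comment> \<open>This is where the decoupling pays off: T couples only indices with equal
      \<kappa>, so it commutes with the diagonal map and stays constant.\<close>
    have T\<Phi>: "T ** ?\<Phi> \<theta> = ?\<Phi> \<theta> ** T" 
    proof -
      have "(T ** ?\<Phi> \<theta>) $ i $ j = (?\<Phi> \<theta> ** T) $ i $ j" for i j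
        using \<kappa>[of i j] by (cases "T $ i $ j = 0") (simp_all add: Phi_def)
      then show ?thesis by (simp add: vec_eq_iff)
    qed
    have D\<Phi>: "freqs \<omega> \<kappa> ** ?\<Phi> \<theta> = ?\<Phi> \<theta> ** freqs \<omega> \<kappa>"
      by (simp add: vec_eq_iff Phi_def freqs_def)
    have "dir_deriv ((1/2) *\<^sub>R \<omega>) H \<theta> = dir_deriv ((1/2) *\<^sub>R \<omega>) (\<lambda>\<theta>. ?Z2 \<theta> ** ?\<Phi> \<theta>) \<theta> ** P"
      unfolding H_def by (rule dir_deriv_mult_const[OF smooth_differentiable[OF smooth_matrix_mult[OF s2 Phi_smooth]]])
    also have "dir_deriv ((1/2) *\<^sub>R \<omega>) (\<lambda>\<theta>. ?Z2 \<theta> ** ?\<Phi> \<theta>) \<theta> =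
        ?Z2 \<theta> ** (?\<Phi> \<theta> ** freqs \<omega> \<kappa>) + (cmat (A (2 *\<^sub>R \<theta>)) ** ?Z2 \<theta> - ?Z2 \<theta> ** (T + F (2 *\<^sub>R \<theta>))) ** ?\<Phi> \<theta>"
      by (subst dir_deriv_matrix_mult[OF smooth_differentiable[OF s2] smooth_differentiable[OF Phi_smooth]])
        (simp only: dir_deriv_Phi dZ D\<Phi>)
    also have "\<dots> = cmat (A (2 *\<^sub>R \<theta>)) ** ?Z2 \<theta> ** ?\<Phi> \<theta> - ?Z2 \<theta> ** (T ** ?\<Phi> \<theta> - ?\<Phi> \<theta> ** freqs \<omega> \<kappa>) - ?Z2 \<theta> ** F (2 *\<^sub>R \<theta>) ** ?\<Phi> \<theta>"
      by (simp add: mm_simps)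
    also have "T ** ?\<Phi> \<theta> - ?\<Phi> \<theta> ** freqs \<omega> \<kappa> = ?\<Phi> \<theta> ** (T - freqs \<omega> \<kappa>)" by (simp add: T\<Phi> mm_diff_right)
    also have "(cmat (A (2 *\<^sub>R \<theta>)) ** ?Z2 \<theta> ** ?\<Phi> \<theta> - ?Z2 \<theta> ** (?\<Phi> \<theta> ** (T - freqs \<omega> \<kappa>)) - ?Z2 \<theta> ** F (2 *\<^sub>R \<theta>) ** ?\<Phi> \<theta>) ** P
        = cmat (A (2 *\<^sub>R \<theta>)) ** H \<theta> - ?Z2 \<theta> ** ?\<Phi> \<theta> ** (T - freqs \<omega> \<kappa>) ** P - R1 \<theta>"
      by (simp only: mm_diff_left H_def R1_def matrix_mul_assoc)
    also have "?Z2 \<theta> ** ?\<Phi> \<theta> ** (T - freqs \<omega> \<kappa>) ** P = H \<theta> ** B''"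
    proof -
      have "H \<theta> ** B'' = ?Z2 \<theta> ** ?\<Phi> \<theta> ** (P ** P') ** (T - freqs \<omega> \<kappa>) ** P"
        by (simp only: H_def B''_def matrix_mul_assoc)
      then show ?thesis by (simp add: PP(1))
    qed
    also have "H \<theta> ** B'' = H \<theta> ** cmat (Rem B'') + H \<theta> ** J"
      by (simp add: J_def mm_diff_right)
    finally have dH: "dir_deriv ((1/2) *\<^sub>R \<omega>) H \<theta> = cmat (A (2 *\<^sub>R \<theta>)) ** H \<theta> - (H \<theta> ** cmat (Rem B'') + H \<theta> ** J) - R1 \<theta>" .
    have "dir_deriv ((1/2) *\<^sub>R \<omega>) Z' \<theta> = Rem (dir_deriv ((1/2) *\<^sub>R \<omega>) H \<theta>)"
      unfolding Z'_def by (simp add: dir_deriv_linear[OF bounded_linear_Rem smooth_differentiable[OF sH]])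
    also have "\<dots> = A (2 *\<^sub>R \<theta>) ** Z' \<theta> - (Z' \<theta> ** Rem B'' + Rem (H \<theta> ** J + R1 \<theta>))"
      unfolding dH by (simp add: Rem_diff Rem_add Rem_mult_left Rem_mult_right Z'_def)
    also have "Rem (H \<theta> ** J + R1 \<theta>) = Z' \<theta> ** F' \<theta>"
      by (simp add: F'_def matrix_mul_assoc matrix_inv_works[OF invZ'])
    finally show ?thesis by (simp add: mm_add_right)
  qed

  have R2: "2 ^ R \<le> L" using power_mono[of "2::real" 4 R] L(3) by simp
  have mbC: "bounded_Cr R (L * (a * b)) (\<lambda>\<theta>. X \<theta> ** Y \<theta>)" 
    if "smooth X" "smooth Y" "bounded_Cr R a X" "bounded_Cr R b Y" for X Y :: "real^'d \<Rightarrow> complex^'n^'n" and a b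
  proof (rule bounded_Cr_mono[OF bounded_Cr_matrix_mult[OF that] order_refl])
    have "0 \<le> a * b" using bounded_Cr_nonneg that by (metis mult_nonneg_nonneg)
    then show "2 ^ R * (a * b) \<le> L * (a * b)" using R2 by (rule mult_right_mono[rotated])
  qed
  have b2: "bounded_Cr R (L * a) (\<lambda>\<theta>. X (2 *\<^sub>R \<theta>))" if "smooth X" "bounded_Cr R a X" for X :: "real^'d \<Rightarrow> complex^'n^'n" and a
    using bounded_Cr_mono[OF bounded_Cr_scale[OF that, of 2] order_refl] mult_right_mono[OF R2 bounded_Cr_nonneg[OF that(2)]] by simp
  note bZ2 = b2[OF s(2) Z(1)] and bF2 = b2[OF s(5) F]
  have HL: "bounded_Cr R (L ^ 6) H"
  proof -
    have "bounded_Cr R (L * (L * ((L * L) * L) * L)) H"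
      unfolding H_def by (intro mbC bZ2 smooth_matrix_mult sZ2 Phi_smooth smooth_const P bounded_Cr_const PL)
    moreover have "L * (L * ((L * L) * L) * L) = L ^ 6" by (simp add: eval_nat_numeral)
    ultimately show ?thesis by simp
  qed
  have Z'L: "bounded_Cr R (L ^ 6) Z'" unfolding Z'_def by (rule bounded_Cr_Rem[OF sH HL])
  have invL: "bounded_Cr R (L ^ (10 * 3 ^ R)) (\<lambda>\<theta>. matrix_inv (Z' \<theta>))"
  proof (rule bounded_Cr_mono[OF bounded_Cr_matrix_inv[OF invZ' sZ' _ norm_inv] order_refl])
    show "1 \<le> L ^ 9" using L0 by simp
    show "bounded_Cr R (L ^ 9) Z'" using bounded_Cr_mono[OF Z'L order_refl pw] by simp
    have "4 ^ R * L ^ 9 \<le> L ^ 10" using mult_right_mono[OF L(3), of "L ^ 9"] L0 by (simp flip: power_Suc)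
    then have "(4 ^ R * L ^ 9) ^ 3 ^ R \<le> (L ^ 10) ^ 3 ^ R" using L0 by (intro power_mono) auto
    then show "(4 ^ R * L ^ 9) ^ 3 ^ R \<le> L ^ (10 * 3 ^ R)" by (simp add: power_mult)
  qed
  have JL: "norm J \<le> L ^ 17 * \<epsilon>"
  proof -
    let ?X = "cnjm (T - freqs \<omega> \<kappa>) ** C' - C' ** (T - freqs \<omega> \<kappa>)"
    \<comment> \<open>Conjugating \<open>B''\<close> amounts to moving
      \<open>T - freqs \<omega> \<kappa>\<close> past \<open>C'\<close>, so its imaginary part is
      governed by the intertwining defect \<open>?X\<close> of \<open>C'\<close>.\<close>
    have "2 *\<^sub>R J = B'' - cnjm B''"
      unfolding J_def scaleR_diff_right cmat_Rem by (simp add: scaleR_2)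
    moreover have "cnjm B'' = P' ** cnjm C' ** (cnjm (T - freqs \<omega> \<kappa>) ** C') ** P"
    proof -
      have "cnjm B'' = cnjm P' ** cnjm (T - freqs \<omega> \<kappa>) ** cnjm P" by (simp only: B''_def cnjm_mult)
      then show ?thesis by (simp only: P'c PP(3)[symmetric] matrix_mul_assoc)
    qed
    moreover have "B'' = P' ** cnjm C' ** (C' ** (T - freqs \<omega> \<kappa>)) ** P"
    proof -
      have "P' ** cnjm C' ** (C' ** (T - freqs \<omega> \<kappa>)) ** P = P' ** (cnjm C' ** C') ** (T - freqs \<omega> \<kappa>) ** P"
        by (simp only: matrix_mul_assoc)
      then show ?thesis by (simp add: C'(1) B''_def)
    qed
    ultimately have j: "2 *\<^sub>R J = - (P' ** cnjm C' ** ?X ** P)" by (simp add: mm_diff_left mm_diff_right)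
    have "2 * norm J = norm (2 *\<^sub>R J)" by simp
    also have "\<dots> = norm (P' ** cnjm C' ** ?X ** P)" unfolding j by (rule norm_minus_cancel)
    also have "\<dots> \<le> L ^ 5 * L ^ 3 * ((2 + 4 * (norm C)\<^sup>2) * (L * \<epsilon>)) * L"
      using P'L C'L C'(3) PL by (intro mb) simp_all
    also have "\<dots> \<le> L ^ 5 * L ^ 3 * (L ^ 7 * (L * \<epsilon>)) * L"
    proof (intro mult_right_mono mult_left_mono)
      have "(norm C)\<^sup>2 \<le> (L ^ 2)\<^sup>2" using CL by (intro power_mono) auto
      then have "2 + 4 * (norm C)\<^sup>2 \<le> 2 + 4 * L ^ 4" by simp
      also have "\<dots> \<le> 8 * L ^ 4" using one_le_power[OF L0(2), of 4] by simp
      also have "\<dots> \<le> L ^ 3 * L ^ 4" using power_mono[of 2 L 3] L L0 by (intro mult_right_mono) auto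
      finally show "2 + 4 * (norm C)\<^sup>2 \<le> L ^ 7" by (simp flip: power_add)
    qed (use L0 \<epsilon>0 in auto)
    also have "\<dots> = L ^ 17 * \<epsilon>" by (simp add: eval_nat_numeral)
    finally have "2 * norm J \<le> L ^ 17 * \<epsilon>" .
    moreover have "0 \<le> L ^ 17 * \<epsilon>" using L0 \<epsilon>0 by simp
    ultimately show ?thesis by linarith
  qed
  have F'L: "bounded_Cr R (L ^ (10 * 3 ^ R + 26) * \<epsilon>) F'"
  proof -
    have 1: "bounded_Cr R (L * (L ^ 6 * (L ^ 17 * \<epsilon>))) (\<lambda>\<theta>. H \<theta> ** J)"
      by (intro mbC sH smooth_const HL bounded_Cr_const JL)
    have 2: "bounded_Cr R (L * (L * (L * ((L * L) * (L * \<epsilon>)) * L) * L)) R1"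
      unfolding R1_def by (intro mbC bZ2 bF2 smooth_matrix_mult sZ2 sF2 Phi_smooth smooth_const P bounded_Cr_const PL)
    have "L * (L ^ 6 * (L ^ 17 * \<epsilon>)) + L * (L * (L * ((L * L) * (L * \<epsilon>)) * L) * L) = L ^ 24 * \<epsilon> + L ^ 8 * \<epsilon>"
      by (simp add: eval_nat_numeral)
    also have "\<dots> \<le> L ^ 24 * \<epsilon> + L ^ 24 * \<epsilon>" using mult_right_mono[OF pw[of 8 24] \<epsilon>0] by (simp add: mult.commute)
    also have "\<dots> = 2 * (L ^ 24 * \<epsilon>)" by simp
    also have "\<dots> \<le> L * (L ^ 24 * \<epsilon>)" using L L0 \<epsilon>0 by (intro mult_right_mono) auto
    also have "\<dots> = L ^ 25 * \<epsilon>" by (simp flip: power_Suc mult.assoc)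
    finally have 3: "bounded_Cr R (L ^ 25 * \<epsilon>) (\<lambda>\<theta>. H \<theta> ** J + R1 \<theta>)"
      using bounded_Cr_mono[OF bounded_Cr_add[OF smooth_matrix_mult[OF sH smooth_const] sR1 1 2] order_refl] by blast
    have sHJ: "smooth (\<lambda>\<theta>. H \<theta> ** J + R1 \<theta>)" by (intro smooth_add smooth_matrix_mult sH smooth_const sR1)
    have "bounded_Cr R (2 ^ R * (L ^ (10 * 3 ^ R) * (L ^ 25 * \<epsilon>))) F'"
      unfolding F'_def
      by (intro bounded_Cr_matrix_mult smooth_matrix_inv invZ' sZ' smooth_Rem sHJ invL bounded_Cr_Rem 3)
    moreover have "2 ^ R * (L ^ (10 * 3 ^ R) * (L ^ 25 * \<epsilon>)) \<le> L * (L ^ (10 * 3 ^ R) * (L ^ 25 * \<epsilon>))"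
      using R2 L0 \<epsilon>0 by (intro mult_right_mono) auto
    moreover have "L * (L ^ (10 * 3 ^ R) * (L ^ 25 * \<epsilon>)) = L ^ (10 * 3 ^ R + 26) * \<epsilon>"
    proof -
      have "L * (x * (L ^ 25 * \<epsilon>)) = x * L ^ 26 * \<epsilon>" for x by (simp add: eval_nat_numeral)
      then show ?thesis unfolding power_add by blast
    qed
    ultimately show ?thesis using bounded_Cr_mono[OF _ order_refl] by metis
  qed
  show thesis by (rule that[OF pZ' sZ' invZ' pF' sF' eq Z'L invL F'L])
qed

section \<open>Choice of scales and exponents\<close>

definition rsol :: "real^'d \<Rightarrow> (real^'d \<Rightarrow> real^'n^'n) \<Rightarrow> (real^'d \<Rightarrow> real^'n^'n) \<Rightarrow>
    (real^'d \<Rightarrow> real^'n^'n) \<Rightarrow> real^'n^'n \<Rightarrow> bool" where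
  "rsol \<omega> A Z F B \<longleftrightarrow> periodic_map Z \<and> smooth Z \<and> (\<forall>\<theta>. invertible (Z \<theta>)) \<and> periodic_map F \<and> smooth F \<and>
     (\<forall>\<theta>. dir_deriv \<omega> Z \<theta> = A \<theta> ** Z \<theta> - Z \<theta> ** (B + F \<theta>))"

text \<open>The hypotheses of almost reducibility give no bound on B. Solving the equation at
  \<theta> = 0 for B bounds it by the sizes of A, Z, its inverse and its first derivatives.\<close>

lemma csol_constant_bound:
  assumes sol: "csol \<omega> A Z F B" and a: "\<And>\<theta>. norm (A \<theta>) \<le> a" and Z: "bounded_Cr r M Z" "1 \<le> r"
    and Zi: "norm (matrix_inv (Z 0)) \<le> M" and F: "norm (F 0) \<le> 1"
    and M: "a + (\<Sum>i\<in>UNIV. \<bar>\<omega> $ i\<bar>) \<le> M" "2 \<le> M"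
  shows "norm B \<le> M ^ 4"
proof -
  note s = csolD[OF sol]
  let ?Zi = "matrix_inv (Z 0)" and ?w = "\<Sum>i\<in>UNIV. \<bar>\<omega> $ i\<bar>"
  have Zn: "norm (Z 0) \<le> M" using Z(1) by (rule bounded_Cr_norm)
  have "B = ?Zi ** (cmat (A 0) ** Z 0 - dir_deriv \<omega> Z 0) - F 0"
    unfolding s(6)[of 0] by (simp add: matrix_mul_assoc matrix_inv_works s(3))
  then have "norm B \<le> norm (?Zi ** (cmat (A 0) ** Z 0 - dir_deriv \<omega> Z 0)) + norm (F 0)"
    using norm_triangle_ineq4 by metis
  also have "\<dots> \<le> M * (M * M) + 1"
  proof (rule add_mono[OF _ F])
    have d: "norm (dir_deriv (axis i 1) Z 0) \<le> M" for i
    proof -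
      have "norm (dpart [i] Z 0) \<le> M" using Z unfolding bounded_Cr_def by (metis length_Cons list.size(3) One_nat_def)
      then show ?thesis by simp
    qed
    have "norm (dir_deriv \<omega> Z 0) \<le> (\<Sum>i\<in>UNIV. \<bar>\<omega> $ i\<bar> * M)"
      unfolding dir_deriv_axis_sum[OF smooth_differentiable[OF s(2)], of \<omega>]
      by (intro sum_norm_le) (simp add: d mult_left_mono)
    then have 1: "norm (dir_deriv \<omega> Z 0) \<le> ?w * M" by (simp add: sum_distrib_right)
    have 2: "norm (cmat (A 0) ** Z 0) \<le> a * M"
      using norm_matrix_mult[of "cmat (A 0)" "Z 0"] mult_mono[OF a[of 0] Zn] a[of 0] order_trans[OF norm_ge_zero a[of 0]] by simp
    have "norm (cmat (A 0) ** Z 0 - dir_deriv \<omega> Z 0) \<le> (a + ?w) * M"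
      using norm_triangle_ineq4[of "cmat (A 0) ** Z 0" "dir_deriv \<omega> Z 0"] 1 2 by (simp add: distrib_right)
    also have "\<dots> \<le> M * M" using M by (intro mult_right_mono) auto
    finally have 3: "norm (cmat (A 0) ** Z 0 - dir_deriv \<omega> Z 0) \<le> M * M" .
    show "norm (?Zi ** (cmat (A 0) ** Z 0 - dir_deriv \<omega> Z 0)) \<le> M * (M * M)"
      using norm_matrix_mult[of ?Zi "cmat (A 0) ** Z 0 - dir_deriv \<omega> Z 0"] mult_mono[OF Zi 3] M(2) by simp
  qed
  also have "\<dots> \<le> M ^ 3 + M ^ 3" using one_le_power[of M 3] M(2) by (simp add: power3_eq_cube)
  also have "\<dots> = 2 * M ^ 3" by simp
  also have "\<dots> \<le> M * M ^ 3" using M(2) by (intro mult_right_mono) auto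
  finally show ?thesis by (simp flip: power_Suc)
qed

text \<open>At a cutoff proportional to M the divisors are at least of order M^(-\<tau>). An error
  M^(-t) with t at least \<tau> + 1 is smaller by a full power of M, which absorbs the constants
  once M is large.\<close>

lemma diophantine_sep_power:
  fixes \<omega> :: "real^'d"
  assumes dio: "diophantine \<kappa> \<tau> \<omega>" and \<kappa>: "0 < \<kappa>" and \<tau>: "0 \<le> \<tau>" "\<tau> + 1 \<le> real t" and c: "1 \<le> c"
    and M: "1 \<le> M" "3 * c / (2 * pi * \<kappa> * (3 * c * real CARD('d)) powr (- \<tau>)) < M"
  shows "sep \<omega> (3 * (c * M)) (3 * (c * (1 / M ^ t)))"
proof (rule diophantine_sep[OF dio \<kappa> \<tau>(1)])
  let ?u = "(3 * c * real CARD('d)) powr (- \<tau>)"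
  have u: "0 < 2 * pi * \<kappa> * ?u" using \<kappa> c by (intro mult_pos_pos) (auto simp: powr_gt_zero)
  have "1 / M ^ t = M powr (- real t)" using M(1) by (simp add: powr_minus powr_realpow divide_inverse)
  also have "\<dots> \<le> M powr (- \<tau> - 1)" using M(1) \<tau>(2) by (intro powr_mono) auto
  also have "\<dots> = M powr (- \<tau>) / M" using M(1) by (simp add: powr_diff)
  finally have "3 * c * (1 / M ^ t) \<le> 3 * c * (M powr (- \<tau>) / M)" using c by (intro mult_left_mono) auto
  also have "\<dots> = 3 * c / M * M powr (- \<tau>)" by simp
  also have "\<dots> < 2 * pi * \<kappa> * ?u * M powr (- \<tau>)"
    using M u by (intro mult_strict_right_mono) (auto simp: field_simps)
  also have "\<dots> = 2 * pi * \<kappa> * (real CARD('d) * (3 * (c * M))) powr (- \<tau>)"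
  proof -
    have "real CARD('d) * (3 * (c * M)) = (3 * c * real CARD('d)) * M" by simp
    then show ?thesis using c M(1) by (simp only: powr_mult)
  qed
  finally show "3 * (c * (1 / M ^ t)) < 2 * pi * \<kappa> * (real CARD('d) * (3 * (c * M))) powr (- \<tau>)" by simp
qed

text \<open>The numbers r, p and M0 do not depend on the solution, so they can be fixed before a
  member of the given sequence is chosen. Derivatives are lost: control to order r yields a result
  to order R.\<close>

lemma real_solution_from_complex:
  fixes \<omega> :: "real^'d" and A :: "real^'d \<Rightarrow> real^'n^'n" and \<kappa> \<tau> a :: real
  assumes \<kappa>: "0 < \<kappa>" and \<tau>: "0 \<le> \<tau>" and dio: "diophantine \<kappa> \<tau> \<omega>" and a: "\<And>\<theta>. norm (A \<theta>) \<le> a"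
  shows "\<exists>r p M0. \<forall>M\<ge>M0. \<forall>Z F B \<epsilon>. csol \<omega> A Z F B \<longrightarrow> bounded_Cr r M Z \<longrightarrow> bounded_Cr r M (\<lambda>\<theta>. matrix_inv (Z \<theta>)) \<longrightarrow>
     bounded_Cr r \<epsilon> F \<longrightarrow> M ^ p * \<epsilon> \<le> 1 \<longrightarrow>
     (\<exists>Z' F' B'. rsol ((1/2) *\<^sub>R \<omega>) (\<lambda>\<theta>. A (2 *\<^sub>R \<theta>)) Z' F' B' \<and> bounded_Cr R (M ^ p) Z' \<and>
        bounded_Cr R (M ^ p) (\<lambda>\<theta>. matrix_inv (Z' \<theta>)) \<and> bounded_Cr R (M ^ p * \<epsilon>) F')"
proof -
  obtain p1 where p1: "\<And>M \<eta>. \<And>B :: complex^'n^'n. 2 + norm (mat 1 :: complex^'n^'n) \<le> M \<Longrightarrow> norm B \<le> M \<Longrightarrow> 0 < \<eta> \<Longrightarrow> 1 / \<eta> \<le> M \<Longrightarrow>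
     (\<exists>f (Q :: complex^'n^'n) Q' T. inj f \<and> range f \<subseteq> {..<CARD('n)} \<and> Q ** Q' = mat 1 \<and> Q' ** Q = mat 1 \<and> B ** Q = Q ** T \<and>
        norm Q \<le> M ^ p1 \<and> norm Q' \<le> M ^ p1 \<and> norm T \<le> M ^ p1 \<and>
        (\<forall>i j. T $ i $ j \<noteq> 0 \<longrightarrow> f i \<le> f j \<and> norm (T $ i $ i - T $ j $ j) \<le> \<eta>))"
    using cluster_triangularization[where 'n='n] by metis
  define n where "n = real CARD('n)"
  define d where "d = CARD('d)"
  define c where "c = (2::real) ^ CARD('n \<times> bool)\<^sup>2"
  define t where "t = nat \<lceil>\<tau>\<rceil> + 1"
  \<comment> \<open>Exponent for the basis change and T: \<open>cluster_triangularization\<close> is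
    applied at size \<open>M ^ (t + 4)\<close>, which covers both \<open>1 / \<eta> = M ^ t\<close>
    and the bound \<open>M ^ 4\<close> on B.\<close>
  define q where "q = (t + 4) * p1"
  \<comment> \<open>The size L will be \<open>M ^ expo\<close>. It has to cover W of size
    \<open>M ^ (2 * q + 5)\<close> between two factors \<open>Phi\<close> of size
    \<open>M ^ (2 * R + 1)\<close>.\<close>
  define expo where "expo = 4 * R + 2 * q + 10"
  \<comment> \<open>Loss in the Fourier estimate: \<open>X ^ (2 * CARD('n))\<close> from the
    triangular system, \<open>4 * q + 6\<close> from the error G, and 2 d from the weights at cutoff
    M.\<close>
  define s where "s = (q + 1 + t) * (2 * CARD('n)) + (4 * q + 6) + 2 * d"
  \<comment> \<open>Chosen so that the Fourier tail
    \<open>M ^ (2 * q + 5) / M ^ (r - 2 * d)\<close>, multiplied by \<open>L ^ 14\<close> and by one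
    M for the constants of the dimension, is 1 / M.\<close>
  define r where "r = 14 * expo + 2 * q + 7 + 2 * d"
  \<comment> \<open>The first summand makes the conjugated W close enough to a constant; the second
    covers the losses of \<open>realify\<close> and of the basis change in the error.\<close>
  define p where "p = (14 * expo + 2 + s) + (expo * (10 * 3 ^ R + 26) + (4 * q + 7))"
  define M0 where "M0 = 2 + norm (mat 1 :: complex^'n^'n) + \<bar>a\<bar> + (\<Sum>i\<in>UNIV. \<bar>\<omega> $ i\<bar>) + 4 ^ r + (2 * n + 1) + n * n * 5 ^ d +
     4 * pi * c + 3 * c / (2 * pi * \<kappa> * (3 * c * real CARD('d)) powr (- \<tau>)) + 1"
  have c1: "1 \<le> c" by (simp add: c_def)
  have t: "\<tau> + 1 \<le> real t" using \<tau> by (simp add: t_def)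
  have n1: "1 \<le> n" by (simp add: n_def)
  show ?thesis
  proof (rule exI[of _ r], rule exI[of _ p], rule exI[of _ M0], intro allI impI)
    fix M Z F B \<epsilon>
    assume MM0: "M0 \<le> M" and sol: "csol \<omega> A Z F B" and Z: "bounded_Cr r M Z"
      and Zi: "bounded_Cr r M (\<lambda>\<theta>. matrix_inv (Z \<theta>))" and F: "bounded_Cr r \<epsilon> F" and M\<epsilon>: "M ^ p * \<epsilon> \<le> 1"
    have pos: "0 \<le> norm (mat 1 :: complex^'n^'n)" "0 \<le> \<bar>a\<bar>" "0 \<le> (\<Sum>i\<in>UNIV. \<bar>\<omega> $ i\<bar>)" "1 \<le> (4::real) ^ r" "0 \<le> 2 * n + 1"
      "0 \<le> n * n * 5 ^ d" "0 \<le> 4 * pi * c" "0 \<le> 3 * c / (2 * pi * \<kappa> * (3 * c * real CARD('d)) powr (- \<tau>))"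
      using n1 c1 \<kappa> by (auto intro!: sum_nonneg)
    have M: "2 \<le> M" "2 + norm (mat 1 :: complex^'n^'n) \<le> M" "a + (\<Sum>i\<in>UNIV. \<bar>\<omega> $ i\<bar>) \<le> M" "4 ^ r \<le> M" "2 * n + 1 \<le> M"
      "n * n * 5 ^ d \<le> M" "4 * pi * c \<le> M" "3 * c / (2 * pi * \<kappa> * (3 * c * real CARD('d)) powr (- \<tau>)) < M"
      using MM0 pos unfolding M0_def by linarith+
    have M1: "1 \<le> M" "0 \<le> M" "0 < M" using M(1) by auto
    have nn: "n * n \<le> M"
    proof -
      have "n * n * 1 \<le> n * n * 5 ^ d" using n1 by (intro mult_left_mono) auto
      then show ?thesis using M(6) by simp
    qed
    have \<epsilon>0: "0 \<le> \<epsilon>" using F by (rule bounded_Cr_nonneg)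
    have pw: "M ^ i \<le> M ^ j" if "i \<le> j" for i j using M1 that by (simp add: power_increasing)
    have pw\<epsilon>: "M ^ i * \<epsilon> \<le> M ^ j * \<epsilon>" if "i \<le> j" for i j using pw[OF that] \<epsilon>0 by (rule mult_right_mono)
    have pm: "x * y \<le> M ^ (i + j)" if "x \<le> M ^ i" "y \<le> M ^ j" "0 \<le> x" "0 \<le> y" for x y i j
      using mult_mono[OF that(1,2)] that(3,4) M1 by (simp add: power_add)
    have \<epsilon>1: "\<epsilon> \<le> 1" using pw\<epsilon>[of 0 p] M\<epsilon> by simp
    have r2: "2 ^ r \<le> M" using power_mono[of "2::real" 4 r] M(4) by simp
    have Rr: "R \<le> r" by (simp add: r_def expo_def)
    have R4: "4 ^ R \<le> M" by (rule order_trans[OF power_increasing[OF Rr] M(4)]) simp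
    note s = csolD[OF sol]
    have sZi: "smooth (\<lambda>\<theta>. matrix_inv (Z \<theta>))" by (intro smooth_matrix_inv s)

    have B: "norm B \<le> M ^ 4"
      using csol_constant_bound[OF sol a Z _ bounded_Cr_norm[OF Zi] order_trans[OF bounded_Cr_norm[OF F] \<epsilon>1] M(3,1)]
      by (simp add: r_def)
    define \<eta> where "\<eta> = 1 / M ^ t"
    have \<eta>: "0 < \<eta>" "1 / \<eta> = M ^ t" using M1 by (simp_all add: \<eta>_def)
    obtain f and Q Q' T :: "complex^'n^'n" where h: "inj f" "range f \<subseteq> {..<CARD('n)}" "Q ** Q' = mat 1" "Q' ** Q = mat 1" "B ** Q = Q ** T"
        "norm Q \<le> M ^ q" "norm Q' \<le> M ^ q" "norm T \<le> M ^ q"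
        "\<And>i j. T $ i $ j \<noteq> 0 \<Longrightarrow> f i \<le> f j" "\<And>i j. T $ i $ j \<noteq> 0 \<Longrightarrow> norm (T $ i $ i - T $ j $ j) \<le> \<eta>"
    proof -
      have "2 + norm (mat 1 :: complex^'n^'n) \<le> M ^ (t + 4)" using M(2) pw[of 1 "t + 4"] by simp
      moreover have "norm B \<le> M ^ (t + 4)" using B pw[of 4 "t + 4"] by simp
      moreover have "1 / \<eta> \<le> M ^ (t + 4)" unfolding \<eta>(2) by (rule pw) simp
      ultimately show ?thesis
        using p1[of "M ^ (t + 4)" B \<eta>] \<eta>(1) that unfolding q_def power_mult by blast
    qed
    define Z1 where "Z1 = (\<lambda>\<theta>. Z \<theta> ** Q)"
    define F1 where "F1 = (\<lambda>\<theta>. Q' ** F \<theta> ** Q)"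
    have sol1: "csol \<omega> A Z1 F1 T" and Z1i: "matrix_inv (Z1 \<theta>) = Q' ** matrix_inv (Z \<theta>)" for \<theta>
      unfolding Z1_def F1_def using csol_change_basis[OF sol h(3,5)] by auto
    note s1 = csolD[OF sol1]
    have mbC: "bounded_Cr k (M * (x * y)) (\<lambda>\<theta>. X \<theta> ** Y \<theta>)" 
      if "k \<le> r" "smooth X" "smooth Y" "bounded_Cr k x X" "bounded_Cr k y Y" for X Y :: "real^'d \<Rightarrow> complex^'n^'n" and x y k
    proof (rule bounded_Cr_mono[OF bounded_Cr_matrix_mult[OF that(2-5)] order_refl])
      have "(2::real) ^ k \<le> M" by (rule order_trans[OF power_increasing[OF that(1)] r2]) simp
      moreover have "0 \<le> x * y" using bounded_Cr_nonneg that by (metis mult_nonneg_nonneg)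
      ultimately show "2 ^ k * (x * y) \<le> M * (x * y)" by (rule mult_right_mono)
    qed
    have Z1b: "bounded_Cr r (M ^ (q + 2)) Z1"
    proof -
      have "bounded_Cr r (M * (M * M ^ q)) Z1"
        unfolding Z1_def by (intro mbC order_refl s(2) smooth_const Z bounded_Cr_const h(6))
      then show ?thesis by (simp add: mult.assoc flip: power_Suc)
    qed
    have Z1ib: "bounded_Cr r (M ^ (q + 2)) (\<lambda>\<theta>. matrix_inv (Z1 \<theta>))"
    proof -
      have "bounded_Cr r (M * (M ^ q * M)) (\<lambda>\<theta>. matrix_inv (Z1 \<theta>))"
        unfolding Z1i by (intro mbC order_refl sZi smooth_const Zi bounded_Cr_const h(7))
      then show ?thesis by (simp add: mult.commute[of "M ^ q"] mult.assoc flip: power_Suc)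
    qed
    define W where "W = intertwiner Z1"
    have sW: "smooth W" "periodic_map W" unfolding W_def by (rule intertwiner_smooth[OF sol1])+
    have sZ1i: "smooth (\<lambda>\<theta>. matrix_inv (Z1 \<theta>))" by (intro smooth_matrix_inv s1)
    have Wb: "bounded_Cr r (M ^ (2 * q + 5)) W"
    proof -
      have "bounded_Cr r (M * (M ^ (q + 2) * M ^ (q + 2))) W"
        unfolding W_def intertwiner_def[abs_def]
        by (intro mbC order_refl smooth_cnjm sZ1i s1(2) bounded_Cr_cnjm Z1ib Z1b)
      moreover have "M * (M ^ (q + 2) * M ^ (q + 2)) = M ^ (2 * q + 5)"
        by (simp add: eval_nat_numeral power_add mult_ac)
      ultimately show ?thesis by simp
    qed
    have Wn: "norm (W \<theta>) \<le> M ^ (2 * q + 5)" for \<theta> using Wb by (rule bounded_Cr_norm)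
    have F1n: "norm (F1 \<theta>) \<le> M ^ (2 * q) * \<epsilon>" for \<theta>
    proof -
      have "norm (F1 \<theta>) \<le> norm Q' * norm (F \<theta>) * norm Q"
        unfolding F1_def using norm_matrix_mult[of "Q' ** F \<theta>" Q] norm_matrix_mult[of Q' "F \<theta>"]
        by (meson mult_right_mono norm_ge_zero order_trans)
      also have "\<dots> \<le> M ^ q * \<epsilon> * M ^ q"
        using h(6,7) bounded_Cr_norm[OF F, of \<theta>] M1 \<epsilon>0 by (intro mult_mono) auto
      also have "\<dots> = M ^ (2 * q) * \<epsilon>" by (simp add: mult_2 power_add)
      finally show ?thesis .
    qed
    define G where "G = (\<lambda>\<theta>. cnjm (F1 \<theta>) ** W \<theta> - W \<theta> ** F1 \<theta>)"
    have sG: "smooth G" unfolding G_def by (intro smooth_diff smooth_matrix_mult smooth_cnjm s1(5) sW(1))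
    have Gn: "norm (G \<theta>) \<le> M ^ (4 * q + 6) * \<epsilon>" for \<theta>
    proof -
      have "norm (G \<theta>) \<le> norm (cnjm (F1 \<theta>) ** W \<theta>) + norm (W \<theta> ** F1 \<theta>)"
        unfolding G_def by (rule norm_triangle_ineq4)
      also have "\<dots> \<le> norm (F1 \<theta>) * norm (W \<theta>) + norm (W \<theta>) * norm (F1 \<theta>)"
        using norm_matrix_mult[of "cnjm (F1 \<theta>)" "W \<theta>"] norm_matrix_mult[of "W \<theta>" "F1 \<theta>"]
        unfolding norm_cnjm by (rule add_mono)
      also have "\<dots> = 2 * (norm (F1 \<theta>) * norm (W \<theta>))" by (simp add: mult.commute)
      also have "\<dots> \<le> M * ((M ^ (2 * q) * \<epsilon>) * M ^ (2 * q + 5))"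
        using F1n[of \<theta>] Wn[of \<theta>] M(1) M1 \<epsilon>0 by (intro mult_mono) auto
      also have "\<dots> = M ^ (4 * q + 6) * \<epsilon>"
      proof -
        have "M ^ (4 * q + 6) = M * (M ^ (2 * q) * M ^ (2 * q + 5))"
        proof -
          have "4 * q + 6 = Suc (2 * q + (2 * q + 5))" by simp
          then show ?thesis by (simp only: power_Suc power_add)
        qed
        then show ?thesis by (simp add: mult_ac)
      qed
      finally show ?thesis .
    qed
    have Weq: "dir_deriv \<omega> W \<theta> = cnjm T ** W \<theta> - W \<theta> ** T + G \<theta>" for \<theta>
      unfolding W_def G_def by (rule intertwiner_equation[OF sol1])

    have sep: "sep \<omega> (3 * (c * M)) (3 * (c * \<eta>))"
      unfolding \<eta>_def by (rule diophantine_sep_power[OF dio \<kappa> \<tau> t c1 M1(1) M(8)])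
    obtain k :: "'n \<Rightarrow> int^'d" where k1: "\<And>i l. \<bar>real_of_int (k i $ l)\<bar> \<le> 2 * (c * M)"
      and k2: "\<And>i j. \<bar>Im (T $ i $ i) - Im (T $ j $ j)\<bar> \<le> \<eta> \<Longrightarrow> k i = k j"
      and k3: "\<And>i j m. (\<And>l. \<bar>real_of_int (m $ l)\<bar> \<le> M) \<Longrightarrow> \<bar>Im (T $ i $ i) + Im (T $ j $ j) + 2 * pi * idot m \<omega>\<bar> \<le> \<eta> \<Longrightarrow> m + m + k i + k j = 0"
      using resonance_shift[OF M1(2) less_imp_le[OF \<eta>(1)] sep[unfolded c_def], of "\<lambda>i. Im (T $ i $ i)"] unfolding c_def by metis
    have Tk: "k i = k j" if "T $ i $ j \<noteq> 0" for i j
      using h(10)[OF that] abs_Im_le_cmod[of "T $ i $ i - T $ j $ j"] by (intro k2) simp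
    define X where "X = M ^ (q + 1 + t)"
    have X: "(2 * real CARD('n) * M ^ q + 1) / \<eta> \<le> X" "1 \<le> X"
    proof -
      have "2 * n * M ^ q + 1 \<le> (2 * n + 1) * M ^ q" using one_le_power[OF M1(1), of q] by (simp add: distrib_right)
      also have "\<dots> \<le> M * M ^ q" using M(5) M1 by (intro mult_right_mono) auto
      finally have "(2 * n * M ^ q + 1) * M ^ t \<le> M * M ^ q * M ^ t" using M1 by (intro mult_right_mono) auto
      then show "(2 * real CARD('n) * M ^ q + 1) / \<eta> \<le> X"
        by (simp add: X_def \<eta>_def n_def power_add mult_ac)
      show "1 \<le> X" unfolding X_def by (rule one_le_power[OF M1(1)])
    qed
    have rd: "2 * CARD('d) \<le> r" by (simp add: r_def d_def)
    let ?\<delta>0 = "real CARD('n) * real CARD('n) * (5 ^ CARD('d) * (X ^ (2 * CARD('n)) * (M ^ (4 * q + 6) * \<epsilon>) * M ^ (2 * CARD('d)) +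
         M ^ (2 * q + 5) / M ^ (r - 2 * CARD('d))))"
    have "\<exists>C. (\<forall>\<theta>. norm (Phi k \<theta> ** W (2 *\<^sub>R \<theta>) ** Phi k \<theta> - C) \<le> ?\<delta>0) \<and>
      norm (cnjm (T - freqs \<omega> k) ** C - C ** (T - freqs \<omega> k)) \<le> real CARD('n) * real CARD('n) * (M ^ (4 * q + 6) * \<epsilon>)"
    proof (rule intertwiner_almost_constant[where W=W and G=G and T=T and f=f and \<kappa>=k and K=M and L="M ^ q" and X=X
          and \<eta>=\<eta> and N="M ^ (2 * q + 5)" and r=r and \<omega>=\<omega> and \<epsilon>="M ^ (4 * q + 6) * \<epsilon>"])
      show "norm (G \<theta>) \<le> M ^ (4 * q + 6) * \<epsilon>" for \<theta> by (rule Gn)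
      show "dir_deriv \<omega> W \<theta> = cnjm T ** W \<theta> - W \<theta> ** T + G \<theta>" for \<theta> by (rule Weq)
      show "f i \<le> f j" if "T $ i $ j \<noteq> 0" for i j using that by (rule h(9))
      show "k i = k j" if "T $ i $ j \<noteq> 0" for i j using that by (rule Tk)
      show "m + m + k i + k j = 0" if "\<And>l. \<bar>real_of_int (m $ l)\<bar> \<le> M"
        "\<bar>Im (T $ i $ i) + Im (T $ j $ j) + 2 * pi * idot m \<omega>\<bar> \<le> \<eta>" for i j m
        using that by (rule k3)
    qed ((rule sW Wb sG h(1,2,8) \<eta>(1) X rd M1(1))+, blast)
    then obtain C where C1: "\<And>\<theta>. norm (Phi k \<theta> ** W (2 *\<^sub>R \<theta>) ** Phi k \<theta> - C) \<le> ?\<delta>0"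
      and C2: "norm (cnjm (T - freqs \<omega> k) ** C - C ** (T - freqs \<omega> k)) \<le> real CARD('n) * real CARD('n) * (M ^ (4 * q + 6) * \<epsilon>)"
      by blast
    define \<delta> where "\<delta> = M * (M ^ s * \<epsilon> + M ^ (2 * q + 5) / M ^ (14 * expo + 2 * q + 7))"
    have \<delta>0: "?\<delta>0 \<le> \<delta>"
    proof -
      have e: "X ^ (2 * CARD('n)) * (M ^ (4 * q + 6) * \<epsilon>) * M ^ (2 * CARD('d)) = M ^ s * \<epsilon>"
        unfolding X_def s_def d_def power_add power_mult by (simp add: mult_ac)
      have "r - 2 * CARD('d) = 14 * expo + 2 * q + 7" by (simp add: r_def d_def)
      then have "?\<delta>0 = (n * n * 5 ^ d) * (M ^ s * \<epsilon> + M ^ (2 * q + 5) / M ^ (14 * expo + 2 * q + 7))"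
        unfolding e by (simp add: n_def d_def mult.assoc)
      also have "\<dots> \<le> \<delta>" unfolding \<delta>_def using M(6) M1 \<epsilon>0 by (intro mult_right_mono) auto
      finally show ?thesis .
    qed
    define L where "L = M ^ expo"
    have Mpow_le_L: "M ^ i \<le> L" if "i \<le> expo" for i unfolding L_def by (rule pw[OF that])
    have M_le_L: "M \<le> L" using Mpow_le_L[of 1] by (simp add: expo_def)
    have L14: "L ^ 14 * \<delta> \<le> 1"
    proof -
      have "M * (M ^ (14 * expo + 1 + s) * \<epsilon>) = M ^ (14 * expo + 2 + s) * \<epsilon>" by (simp add: power_add)
      also have "\<dots> \<le> M ^ p * \<epsilon>" by (rule pw\<epsilon>) (simp add: p_def)
      finally have "2 * (M ^ (14 * expo + 1 + s) * \<epsilon>) \<le> 1"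
      proof -
        assume *: "M * (M ^ (14 * expo + 1 + s) * \<epsilon>) \<le> M ^ p * \<epsilon>"
        have "0 \<le> M ^ (14 * expo + 1 + s) * \<epsilon>" using M1 \<epsilon>0 by simp
        from mult_right_mono[OF M(1) this] show ?thesis using * M\<epsilon> by linarith
      qed
      moreover have "M ^ (14 * expo + 1) * (M ^ (2 * q + 5) / M ^ (14 * expo + 2 * q + 7)) \<le> 1 / 2"
      proof -
        have "M ^ (14 * expo + 2 * q + 7) = M ^ (14 * expo + 1) * M ^ (2 * q + 5) * M"
          by (simp add: power_add eval_nat_numeral mult_ac)
        then have "M ^ (14 * expo + 1) * (M ^ (2 * q + 5) / M ^ (14 * expo + 2 * q + 7)) = 1 / M"
          using M1 by simp
        also have "\<dots> \<le> 1 / 2" using M(1) by (simp add: field_simps)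
        finally show ?thesis .
      qed
      moreover have "L ^ 14 * \<delta> = M ^ (14 * expo + 1 + s) * \<epsilon> + M ^ (14 * expo + 1) * (M ^ (2 * q + 5) / M ^ (14 * expo + 2 * q + 7))"
      proof -
        have "L ^ 14 * M = M ^ (14 * expo + 1)" by (simp add: L_def mult.commute flip: power_mult)
        then have "L ^ 14 * \<delta> = M ^ (14 * expo + 1) * (M ^ s * \<epsilon> + M ^ (2 * q + 5) / M ^ (14 * expo + 2 * q + 7))"
          unfolding \<delta>_def by (metis mult.assoc)
        then show ?thesis by (simp only: distrib_left power_add mult.assoc)
      qed
      ultimately show ?thesis by linarith
    qed
    have \<Phi>b: "bounded_Cr R (M ^ (2 * R + 1)) (Phi k)"
    proof (rule bounded_Cr_mono[OF Phi_bounded order_refl])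
      show "2 * pi * \<bar>of_int (k i $ l)\<bar> \<le> M ^ 2" for i l
      proof -
        have "2 * pi * \<bar>of_int (k i $ l)\<bar> \<le> 2 * pi * (2 * (c * M))" using k1[of i l] by (intro mult_left_mono) auto
        also have "\<dots> = 4 * pi * c * M" by simp
        also have "\<dots> \<le> M * M" using M(7) M1 by (intro mult_right_mono) auto
        finally show ?thesis by (simp add: power2_eq_square)
      qed
      show "1 \<le> M ^ 2" using M1 by (simp add: one_le_power)
      have "n * n * (M ^ 2) ^ R \<le> M * (M ^ 2) ^ R" using nn M1 by (intro mult_right_mono) auto
      then show "real CARD('n) * real CARD('n) * (M ^ 2) ^ R \<le> M ^ (2 * R + 1)"
        by (simp add: n_def power_mult)
    qed
    define \<epsilon>' where "\<epsilon>' = M ^ (4 * q + 7) * \<epsilon>"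
    have \<epsilon>'0: "0 \<le> \<epsilon>'" using M1 \<epsilon>0 by (simp add: \<epsilon>'_def)
    have F1b: "bounded_Cr R \<epsilon>' F1"
    proof -
      have "bounded_Cr R (M * ((M * (M ^ q * \<epsilon>)) * M ^ q)) F1"
        unfolding F1_def
        by (intro mbC Rr smooth_matrix_mult s(5) smooth_const bounded_Cr_const h(6,7) bounded_Cr_mono[OF F Rr order_refl])
      moreover have "M * ((M * (M ^ q * \<epsilon>)) * M ^ q) = M ^ (2 * q + 2) * \<epsilon>"
        by (simp add: power_add mult_2 mult_ac eval_nat_numeral)
      moreover have "M ^ (2 * q + 2) * \<epsilon> \<le> \<epsilon>'" unfolding \<epsilon>'_def by (rule pw\<epsilon>) simp
      ultimately show ?thesis using bounded_Cr_mono[OF _ order_refl] by metis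
    qed
    have \<Phi>n: "norm (Phi k \<theta>) \<le> M ^ (2 * R + 1)" for \<theta> using \<Phi>b by (rule bounded_Cr_norm)
    have Lp: "L ^ i \<le> M ^ p" if "i \<le> 14 \<or> i \<le> 10 * 3 ^ R + 26" for i
    proof -
      have "expo * i \<le> expo * 14 \<or> expo * i \<le> expo * (10 * 3 ^ R + 26)" using that by (metis mult_le_mono2)
      then have "expo * i \<le> p" unfolding p_def by (elim disjE) linarith+
      then show ?thesis unfolding L_def using pw by (simp flip: power_mult)
    qed
    have F'p: "L ^ (10 * 3 ^ R + 26) * \<epsilon>' \<le> M ^ p * \<epsilon>"
    proof -
      have "L ^ (10 * 3 ^ R + 26) * \<epsilon>' = M ^ (expo * (10 * 3 ^ R + 26) + (4 * q + 7)) * \<epsilon>"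
      proof -
        have "(M ^ expo) ^ i * (M ^ u * \<epsilon>) = M ^ (expo * i + u) * \<epsilon>" for i u by (simp add: power_add power_mult)
        then show ?thesis unfolding L_def \<epsilon>'_def .
      qed
      also have "\<dots> \<le> M ^ p * \<epsilon>" by (rule pw\<epsilon>) (simp add: p_def)
      finally show ?thesis .
    qed
    show "\<exists>Z' F' B'. rsol ((1/2) *\<^sub>R \<omega>) (\<lambda>\<theta>. A (2 *\<^sub>R \<theta>)) Z' F' B' \<and> bounded_Cr R (M ^ p) Z' \<and>
        bounded_Cr R (M ^ p) (\<lambda>\<theta>. matrix_inv (Z' \<theta>)) \<and> bounded_Cr R (M ^ p * \<epsilon>) F'"
    proof (rule realify[OF sol1 Tk])
      show "2 \<le> L" using M(1) M_le_L by simp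
      show "real CARD('n) * real CARD('n) \<le> L" using nn M_le_L by (simp add: n_def)
      show "4 ^ R \<le> L" using R4 M_le_L by simp
      show "bounded_Cr R L Z1" by (rule bounded_Cr_mono[OF Z1b Rr Mpow_le_L]) (simp add: expo_def)
      show "norm (matrix_inv (Z1 \<theta>)) \<le> L" for \<theta>
        using bounded_Cr_norm[OF Z1ib, of \<theta>] Mpow_le_L[of "q + 2"] by (simp add: expo_def)
      show "bounded_Cr R \<epsilon>' F1" by (rule F1b)
      show "bounded_Cr R L (Phi k)" by (rule bounded_Cr_mono[OF \<Phi>b order_refl Mpow_le_L]) (simp add: expo_def)
      show "norm (Phi k \<theta> ** intertwiner Z1 (2 *\<^sub>R \<theta>) ** Phi k \<theta>) \<le> L" for \<theta>
      proof -
        have "norm (Phi k \<theta> ** intertwiner Z1 (2 *\<^sub>R \<theta>) ** Phi k \<theta>) \<le> norm (Phi k \<theta>) * norm (W (2 *\<^sub>R \<theta>)) * norm (Phi k \<theta>)"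
          unfolding W_def using norm_matrix_mult[of "Phi k \<theta> ** intertwiner Z1 (2 *\<^sub>R \<theta>)" "Phi k \<theta>"] norm_matrix_mult[of "Phi k \<theta>" "intertwiner Z1 (2 *\<^sub>R \<theta>)"]
          by (meson mult_right_mono norm_ge_zero order_trans)
        also have "\<dots> \<le> M ^ (((2 * R + 1) + (2 * q + 5)) + (2 * R + 1))"
          by (intro pm \<Phi>n Wn) auto
        also have "\<dots> \<le> L" by (rule Mpow_le_L) (simp add: expo_def)
        finally show ?thesis .
      qed
      show "norm (Phi k \<theta> ** intertwiner Z1 (2 *\<^sub>R \<theta>) ** Phi k \<theta> - C) \<le> \<delta>" for \<theta>
        using C1[of \<theta>] \<delta>0 unfolding W_def by (rule order_trans)
      show "L ^ 14 * \<delta> \<le> 1" by (rule L14)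
      have "n * n * (M ^ (4 * q + 6) * \<epsilon>) \<le> M * (M ^ (4 * q + 6) * \<epsilon>)" using nn M1 \<epsilon>0 by (intro mult_right_mono) auto
      also have "\<dots> = \<epsilon>'" by (simp add: \<epsilon>'_def eval_nat_numeral mult_ac)
      also have "\<dots> \<le> L * \<epsilon>'" using mult_right_mono[of 1 L \<epsilon>'] M_le_L M1 \<epsilon>'0 by simp
      finally show "norm (cnjm (T - freqs \<omega> k) ** C - C ** (T - freqs \<omega> k)) \<le> L * \<epsilon>'" using C2 by (simp add: n_def)
    next
      fix Z' F' :: "real^'d \<Rightarrow> real^'n^'n" and B' :: "real^'n^'n"
      assume res: "periodic_map Z'" "smooth Z'" "\<And>\<theta>. invertible (Z' \<theta>)" "periodic_map F'" "smooth F'"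
        "\<And>\<theta>. dir_deriv ((1/2) *\<^sub>R \<omega>) Z' \<theta> = A (2 *\<^sub>R \<theta>) ** Z' \<theta> - Z' \<theta> ** (B' + F' \<theta>)"
        "bounded_Cr R (L ^ 6) Z'" "bounded_Cr R (L ^ (10 * 3 ^ R)) (\<lambda>\<theta>. matrix_inv (Z' \<theta>))"
        "bounded_Cr R (L ^ (10 * 3 ^ R + 26) * \<epsilon>') F'"
      have "rsol ((1/2) *\<^sub>R \<omega>) (\<lambda>\<theta>. A (2 *\<^sub>R \<theta>)) Z' F' B'" using res(1-6) by (simp add: rsol_def)
      moreover have "bounded_Cr R (M ^ p) Z'" by (rule bounded_Cr_mono[OF res(7) order_refl Lp]) simp
      moreover have "bounded_Cr R (M ^ p) (\<lambda>\<theta>. matrix_inv (Z' \<theta>))" by (rule bounded_Cr_mono[OF res(8) order_refl Lp]) simp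
      moreover have "bounded_Cr R (M ^ p * \<epsilon>) F'" by (rule bounded_Cr_mono[OF res(9) order_refl F'p])
      ultimately show "\<exists>Z' F' B'. rsol ((1/2) *\<^sub>R \<omega>) (\<lambda>\<theta>. A (2 *\<^sub>R \<theta>)) Z' F' B' \<and> bounded_Cr R (M ^ p) Z' \<and>
        bounded_Cr R (M ^ p) (\<lambda>\<theta>. matrix_inv (Z' \<theta>)) \<and> bounded_Cr R (M ^ p * \<epsilon>) F'" by blast
    qed
  qed
qed

section \<open>Choice of the sequence of real solutions\<close>

lemma tendsto_power_sum_zero:
  fixes x y e :: "nat \<Rightarrow> real"
  assumes nn: "\<And>j. 0 \<le> x j" "\<And>j. 0 \<le> y j" "\<And>j. 0 \<le> e j" "0 \<le> c"
    and x: "(\<lambda>j. x j ^ q * e j) \<longlonglongrightarrow> 0" and y: "(\<lambda>j. y j ^ q * e j) \<longlonglongrightarrow> 0" and e: "e \<longlonglongrightarrow> 0"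
  shows "(\<lambda>j. (c + x j + y j) ^ q * e j) \<longlonglongrightarrow> 0"
proof (rule tendsto_sandwich[of "\<lambda>_. 0"])
  have "(c + x j + y j) ^ q \<le> 3 ^ q * (c ^ q + x j ^ q + y j ^ q)" for j
  proof -
    \<comment> \<open>The sum is at most three times its largest term, whose power is one of the
      three on the right.\<close>
    define m where "m = max c (max (x j) (y j))"
    have m: "c \<le> m" "x j \<le> m" "y j \<le> m" "m = c \<or> m = x j \<or> m = y j" "0 \<le> m"
      unfolding m_def using nn by (auto simp: max_def)
    have "(c + x j + y j) ^ q \<le> (3 * m) ^ q" using m nn by (intro power_mono) auto
    also have "\<dots> = 3 ^ q * m ^ q" by (rule power_mult_distrib)
    also have "m ^ q \<le> c ^ q + x j ^ q + y j ^ q" using m(4) nn by auto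
    finally show ?thesis by simp
  qed
  then show "\<forall>\<^sub>F j in sequentially. (c + x j + y j) ^ q * e j \<le> 3 ^ q * (c ^ q * e j + x j ^ q * e j + y j ^ q * e j)"
  proof (intro always_eventually allI)
    fix j
    assume *: "\<And>j. (c + x j + y j) ^ q \<le> 3 ^ q * (c ^ q + x j ^ q + y j ^ q)"
    show "(c + x j + y j) ^ q * e j \<le> 3 ^ q * (c ^ q * e j + x j ^ q * e j + y j ^ q * e j)"
      using mult_right_mono[OF *[of j] nn(3)[of j]] by (simp only: mult.assoc distrib_right)
  qed
  have "(\<lambda>j. 3 ^ q * (c ^ q * e j + x j ^ q * e j + y j ^ q * e j)) \<longlonglongrightarrow> 3 ^ q * (c ^ q * 0 + 0 + 0)"
    by (intro tendsto_intros x y e)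
  then show "(\<lambda>j. 3 ^ q * (c ^ q * e j + x j ^ q * e j + y j ^ q * e j)) \<longlonglongrightarrow> 0" by simp
qed (use nn in auto)

theorem theorem2:
  fixes \<omega> :: "real^'d" and A :: "real^'d \<Rightarrow> real^'n^'n" and \<kappa> \<tau> :: real
  assumes "\<kappa> > 0" and "\<tau> > real CARD('d) - 1" and "diophantine \<kappa> \<tau> \<omega>"
    and "periodic_map A" and "smooth A"
    and "almost_reducible \<omega> (\<lambda>\<theta>. cmat (A \<theta>))"
  shows "real_almost_reducible ((1/2) *\<^sub>R \<omega>) (\<lambda>\<theta>. A (2 *\<^sub>R \<theta>))"
proof -
  have "1 \<le> CARD('d)" by (simp add: Suc_le_eq)
  then have \<tau>: "0 \<le> \<tau>" using assms(2) by linarith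
  obtain a where a: "\<And>\<theta>. norm (A \<theta>) \<le> a"
    using periodic_bounded[OF assms(4) smooth_continuous_on[OF assms(5)]] by blast
  obtain Z F :: "nat \<Rightarrow> real^'d \<Rightarrow> complex^'n^'n" and B :: "nat \<Rightarrow> complex^'n^'n" where
    sol0: "\<forall>j. periodic_map (Z j) \<and> smooth (Z j) \<and> (\<forall>\<theta>. invertible (Z j \<theta>)) \<and>
           periodic_map (F j) \<and> smooth (F j) \<and>
           (\<forall>\<theta>. dir_deriv \<omega> (Z j) \<theta> = cmat (A \<theta>) ** Z j \<theta> - Z j \<theta> ** (B j + F j \<theta>))"
    and lim: "\<forall>r m. (\<lambda>j. Cr_norm r (Z j) ^ m * Cr_norm r (F j)) \<longlonglongrightarrow> 0 \<and>
             (\<lambda>j. Cr_norm r (\<lambda>\<theta>. matrix_inv (Z j \<theta>)) ^ m * Cr_norm r (F j)) \<longlonglongrightarrow> 0"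
    using assms(6) unfolding almost_reducible_def by blast
  have sol: "csol \<omega> A (Z j) (F j) (B j)" for j using sol0 by (simp add: csol_def)
  note s = csolD[OF sol]
  have si: "smooth (\<lambda>\<theta>. matrix_inv (Z j \<theta>))" for j by (intro smooth_matrix_inv s)
  have per_i: "periodic_map (\<lambda>\<theta>. matrix_inv (Z j \<theta>))" for j by (rule periodic_map_comp[OF s(1)])
  let ?A2 = "\<lambda>\<theta>. A (2 *\<^sub>R \<theta>)" and ?\<omega>2 = "(1/2) *\<^sub>R \<omega>"
  \<comment> \<open>One real solution for each order R, with the bound 1 / (R + 1) already for the
    order R and the power R. The new sequence is indexed by R instead of by j.\<close>
  have "\<exists>Z' F' B' L e. rsol ?\<omega>2 ?A2 Z' F' B' \<and> bounded_Cr R L Z' \<and>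
      bounded_Cr R L (\<lambda>\<theta>. matrix_inv (Z' \<theta>)) \<and> bounded_Cr R e F' \<and> 1 \<le> L \<and> L ^ R * e \<le> 1 / real (Suc R)" for R
  proof -
    obtain r p M0 where core: "\<And>M Z F B \<epsilon>. M0 \<le> M \<Longrightarrow> csol \<omega> A Z F B \<Longrightarrow> bounded_Cr r M Z \<Longrightarrow>
      bounded_Cr r M (\<lambda>\<theta>. matrix_inv (Z \<theta>)) \<Longrightarrow> bounded_Cr r \<epsilon> F \<Longrightarrow> M ^ p * \<epsilon> \<le> 1 \<Longrightarrow>
      (\<exists>Z' F' B'. rsol ?\<omega>2 ?A2 Z' F' B' \<and> bounded_Cr R (M ^ p) Z' \<and>
        bounded_Cr R (M ^ p) (\<lambda>\<theta>. matrix_inv (Z' \<theta>)) \<and> bounded_Cr R (M ^ p * \<epsilon>) F')"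
      using real_solution_from_complex[where A=A and R=R, OF assms(1) \<tau> assms(3) a] by metis
    define nn where "nn = real CARD('n) * real CARD('n)"
    have nn0: "0 \<le> nn" by (simp add: nn_def)
    define x where "x = (\<lambda>j. nn * Cr_norm r (Z j))"
    define y where "y = (\<lambda>j. nn * Cr_norm r (\<lambda>\<theta>. matrix_inv (Z j \<theta>)))"
    define e where "e = (\<lambda>j. nn * Cr_norm r (F j))"
    define c where "c = max 1 M0"
    \<comment> \<open>A single size for \<open>Z j\<close> and its inverse, which also stays above
      the threshold \<open>M0\<close>.\<close>
    define M where "M = (\<lambda>j. c + x j + y j)"
    have pos: "0 \<le> x j" "0 \<le> y j" "0 \<le> e j" for j
      unfolding x_def y_def e_def using nn0 Cr_norm_nonneg[OF s(1,2)] Cr_norm_nonneg[OF per_i si] Cr_norm_nonneg[OF s(4,5)] by auto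
    have bx: "bounded_Cr r (x j) (Z j)" "bounded_Cr r (y j) (\<lambda>\<theta>. matrix_inv (Z j \<theta>))" "bounded_Cr r (e j) (F j)" for j
      unfolding x_def y_def e_def nn_def
      using bounded_Cr_Cr_norm[OF s(1,2)] bounded_Cr_Cr_norm[OF per_i si] bounded_Cr_Cr_norm[OF s(4,5)] by auto
    \<comment> \<open>The real solution has size \<open>M j ^ p\<close> and error
      \<open>M j ^ p * e j\<close>. Its power R times the error contains M to the exponent
      \<open>p * R + p\<close>.\<close>
    define Q where "Q = p * R + p"
    have "(\<lambda>j. M j ^ Q * e j) \<longlonglongrightarrow> 0"
      unfolding M_def
    proof (rule tendsto_power_sum_zero[OF pos])
      show "0 \<le> c" by (simp add: c_def)
      have "(\<lambda>j. nn ^ Q * nn * (Cr_norm r (Z j) ^ Q * Cr_norm r (F j))) \<longlonglongrightarrow> nn ^ Q * nn * 0"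
        by (intro tendsto_intros) (use lim in blast)
      then show "(\<lambda>j. x j ^ Q * e j) \<longlonglongrightarrow> 0" by (simp add: x_def e_def power_mult_distrib mult_ac)
      have "(\<lambda>j. nn ^ Q * nn * (Cr_norm r (\<lambda>\<theta>. matrix_inv (Z j \<theta>)) ^ Q * Cr_norm r (F j))) \<longlonglongrightarrow> nn ^ Q * nn * 0"
        by (intro tendsto_intros) (use lim in blast)
      then show "(\<lambda>j. y j ^ Q * e j) \<longlonglongrightarrow> 0" by (simp add: y_def e_def power_mult_distrib mult_ac)
      have "(\<lambda>j. Cr_norm r (Z j) ^ 0 * Cr_norm r (F j)) \<longlonglongrightarrow> 0" using lim by blast
      then have "(\<lambda>j. nn * Cr_norm r (F j)) \<longlonglongrightarrow> nn * 0" by (intro tendsto_intros) simp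
      then show "e \<longlonglongrightarrow> 0" by (simp add: e_def[abs_def])
    qed
    then have "\<forall>\<^sub>F j in sequentially. M j ^ Q * e j < 1 / real (Suc R)" by (rule order_tendstoD) simp
    then obtain j where j: "M j ^ Q * e j < 1 / real (Suc R)" by (auto simp: eventually_sequentially)
    have M1: "1 \<le> M j" using pos[of j] by (simp add: M_def c_def)
    have "M j ^ p * e j \<le> M j ^ Q * e j" using M1 pos[of j] by (intro mult_right_mono power_increasing) (auto simp: Q_def)
    also have "\<dots> \<le> 1" using j by (simp add: order_trans[OF less_imp_le[OF j]])
    finally have p1: "M j ^ p * e j \<le> 1" .
    have "\<exists>Z' F' B'. rsol ?\<omega>2 ?A2 Z' F' B' \<and> bounded_Cr R (M j ^ p) Z' \<and>
        bounded_Cr R (M j ^ p) (\<lambda>\<theta>. matrix_inv (Z' \<theta>)) \<and> bounded_Cr R (M j ^ p * e j) F'"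
    proof (rule core[OF _ sol[of j] _ _ bx(3) p1])
      show "M0 \<le> M j" using pos[of j] by (simp add: M_def c_def)
      show "bounded_Cr r (M j) (Z j)"
        using pos[of j] by (intro bounded_Cr_mono[OF bx(1) order_refl]) (simp add: M_def c_def)
      show "bounded_Cr r (M j) (\<lambda>\<theta>. matrix_inv (Z j \<theta>))"
        using pos[of j] by (intro bounded_Cr_mono[OF bx(2) order_refl]) (simp add: M_def c_def)
    qed
    moreover have "1 \<le> M j ^ p" using M1 by (rule one_le_power)
    moreover have "(M j ^ p) ^ R * (M j ^ p * e j) \<le> 1 / real (Suc R)"
      using less_imp_le[OF j] by (simp only: Q_def power_add power_mult mult.assoc)
    ultimately show ?thesis by blast
  qed
  then obtain Z' F' B' L e where res: "\<And>R. rsol ?\<omega>2 ?A2 (Z' R) (F' R) (B' R)" "\<And>R. bounded_Cr R (L R) (Z' R)"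
      "\<And>R. bounded_Cr R (L R) (\<lambda>\<theta>. matrix_inv (Z' R \<theta>))" "\<And>R. bounded_Cr R (e R) (F' R)" "\<And>R. 1 \<le> L R"
      "\<And>R. L R ^ R * e R \<le> 1 / real (Suc R)"
    by metis
  have r1: "periodic_map (Z' R)" "smooth (Z' R)" "invertible (Z' R \<theta>)" "periodic_map (F' R)" "smooth (F' R)" for R \<theta>
    using res(1)[of R] by (auto simp: rsol_def)
  have small: "(\<lambda>R. Cr_norm r (X R) ^ m * Cr_norm r (F' R)) \<longlonglongrightarrow> 0"
    if X: "\<And>R. bounded_Cr R (L R) (X R)" "\<And>R. periodic_map (X R)" "\<And>R. smooth (X R)"
    for r m and X :: "nat \<Rightarrow> real^'d \<Rightarrow> real^'n^'n"
  proof (rule tendsto_sandwich[of "\<lambda>_. 0"])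
    show "\<forall>\<^sub>F R in sequentially. 0 \<le> Cr_norm r (X R) ^ m * Cr_norm r (F' R)"
      using Cr_norm_nonneg[OF X(2,3)] Cr_norm_nonneg[OF r1(4,5)] by auto
    \<comment> \<open>As \<open>1 \<le> L R\<close>, raising the order and the exponent to R only
      enlarges the bound, so fixed r and m are covered once R is at least both.\<close>
    have "Cr_norm r (X R) ^ m * Cr_norm r (F' R) \<le> 1 / real (Suc R)" if R: "max r m \<le> R" for R
    proof -
      have "Cr_norm r (X R) \<le> L R" "Cr_norm r (F' R) \<le> e R"
        using R bounded_Cr_mono[OF X(1), of r R "L R"] bounded_Cr_mono[OF res(4), of r R "e R"] by (auto intro!: Cr_norm_le)
      then have "Cr_norm r (X R) ^ m * Cr_norm r (F' R) \<le> L R ^ m * e R"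
        using Cr_norm_nonneg[OF X(2,3)] Cr_norm_nonneg[OF r1(4,5)] res(5)[of R] by (intro mult_mono power_mono) auto
      also have "\<dots> \<le> L R ^ R * e R"
        using R res(5)[of R] bounded_Cr_nonneg[OF res(4)[of R]] by (intro mult_right_mono power_increasing) auto
      also have "\<dots> \<le> 1 / real (Suc R)" by (rule res(6))
      finally show ?thesis .
    qed
    then show "\<forall>\<^sub>F R in sequentially. Cr_norm r (X R) ^ m * Cr_norm r (F' R) \<le> 1 / real (Suc R)"
      unfolding eventually_sequentially by blast
    show "(\<lambda>R. 1 / real (Suc R)) \<longlonglongrightarrow> 0"
      using LIMSEQ_inverse_real_of_nat by (simp add: inverse_eq_divide)
  qed simp
  show ?thesis
    unfolding real_almost_reducible_def
  proof (rule exI[of _ Z'], rule exI[of _ F'], rule exI[of _ B'], intro conjI allI)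
    fix r m
    show "(\<lambda>j. Cr_norm r (Z' j) ^ m * Cr_norm r (F' j)) \<longlonglongrightarrow> 0"
      by (rule small[OF res(2) r1(1,2)])
    show "(\<lambda>j. Cr_norm r (\<lambda>\<theta>. matrix_inv (Z' j \<theta>)) ^ m * Cr_norm r (F' j)) \<longlonglongrightarrow> 0"
      by (rule small[OF res(3) periodic_map_comp[OF r1(1)] smooth_matrix_inv[OF r1(3,2)]])
  qed (use res(1) in \<open>auto simp: rsol_def\<close>)
qed

end
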